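(* Let $(M,g)$ be a Riemannian manifold with a smooth function $f$ and a constant $\lambda\in\mathbb{R}$ such that $\mathrm{Ric}+\mathrm{Hess} f=\lambda g$, and let $S=\nabla\nabla f$ be the Hessian of $f$ viewed as a $(1,1)$-tensor. Then, as vector fields, $$\nabla\mathrm{scal}=2\,\mathrm{Ric}(\nabla f),$$ as $(1,1)$-tensors, $$\nabla_{\nabla f}S+S\circ(S-\lambda I)=-R(\cdot,\nabla f)\nabla f-\tfrac12\nabla_{\cdot}\nabla\mathrm{scal},$$ $$\nabla_{\nabla f}\mathrm{Ric}+\mathrm{Ric}\circ(\lambda I-\mathrm{Ric})=R(\cdot,\nabla f)\nabla f+\tfrac12\nabla_{\cdot}\nabla\mathrm{scal},$$ and $$\tfrac12(\Delta-D_{\nabla f})\mathrm{scal}=\tfrac12\Delta_f\mathrm{scal}=\mathrm{tr}\left(\mathrm{Ric}\circ(\lambda I-\mathrm{Ric})\right).$$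
   Context: All data are smooth. $\mathrm{Ric}$ is viewed as a $(1,1)$-tensor (endomorphism of $TM$) via $g$, $I$ is the identity endomorphism, $S(E)=\nabla_E\nabla f$, and $\mathrm{scal}$ is the scalar curvature. $\nabla_{\cdot}\nabla\mathrm{scal}$ is the $(1,1)$-tensor $E\mapsto\nabla_E\nabla\mathrm{scal}$ and $R(\cdot,\nabla f)\nabla f$ is $E\mapsto R(E,\nabla f)\nabla f$, with the convention $R(X,Y)Z=\nabla_X\nabla_YZ-\nabla_Y\nabla_XZ-\nabla_{[X,Y]}Z$. $D_X$ is the directional derivative of functions, $\Delta$ is the Laplacian (trace of the Hessian), and $\Delta_f=\Delta-D_{\nabla f}$. *)

theory Defs
  imports "HOL-Analysis.Analysis" "HOL-Library.Function_Algebras"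
begin

text \<open>Pointwise real vector space structure on functions; tangent vectors below are functions.\<close>

instantiation "fun" :: (type, scaleR) scaleR
begin
definition scaleR_fun_def: "a *\<^sub>R f = (\<lambda>x. a *\<^sub>R f x)"
instance ..
end

instance "fun" :: (type, real_vector) real_vector
  by standard (simp_all add: scaleR_fun_def plus_fun_def scaleR_add_left scaleR_add_right)


subsection \<open>Smooth maps between Euclidean spaces\<close>

text \<open>Intended for open \<open>S\<close> and a finite-dimensional domain.\<close>

fun Ck_on :: "nat \<Rightarrow> 'a::euclidean_space set \<Rightarrow> ('a \<Rightarrow> 'b::real_normed_vector) \<Rightarrow> bool" where
  "Ck_on 0 S f = continuous_on S f"
| "Ck_on (Suc k) S f =
     ((\<forall>x\<in>S. f differentiable (at x)) \<and>
      (\<forall>v. Ck_on k S (\<lambda>x. frechet_derivative f (at x) v)))"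

definition smooth_on :: "'a::euclidean_space set \<Rightarrow> ('a \<Rightarrow> 'b::real_normed_vector) \<Rightarrow> bool" where
  "smooth_on S f \<longleftrightarrow> (\<forall>k. Ck_on k S f)"


subsection \<open>Smooth manifolds\<close>

text \<open>The points of the manifold are the elements of the type \<open>'m\<close>, the model space is the
  Euclidean space \<open>'e\<close>.  A chart is a pair of its domain and the coordinate map; the values of the
  coordinate map outside the domain are irrelevant.\<close>

type_synonym ('m, 'e) chart = "'m set \<times> ('m \<Rightarrow> 'e)"

definition chart_inv :: "('m, 'e) chart \<Rightarrow> 'e \<Rightarrow> 'm" where
  "chart_inv c = inv_into (fst c) (snd c)"

definition smooth_atlas ::
  "('m::{t2_space,second_countable_topology}, 'e::euclidean_space) chart set \<Rightarrow> bool" where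
  "smooth_atlas A \<longleftrightarrow>
     (\<forall>c\<in>A. open (fst c) \<and> open (snd c ` fst c) \<and>
            homeomorphism (fst c) (snd c ` fst c) (snd c) (chart_inv c)) \<and>
     (\<Union>c\<in>A. fst c) = UNIV \<and>
     (\<forall>c\<in>A. \<forall>c'\<in>A. smooth_on (snd c ` (fst c \<inter> fst c')) (snd c' \<circ> chart_inv c))"

definition charts_at :: "('m, 'e) chart set \<Rightarrow> 'm \<Rightarrow> ('m, 'e) chart set" where
  "charts_at A p = {c\<in>A. p \<in> fst c}"

definition chart_at :: "('m, 'e) chart set \<Rightarrow> 'm \<Rightarrow> ('m, 'e) chart" where
  "chart_at A p = (SOME c. c \<in> charts_at A p)"

definition smooth_fun ::
  "('m, 'e::euclidean_space) chart set \<Rightarrow> 'm set \<Rightarrow> ('m \<Rightarrow> real) \<Rightarrow> bool" where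
  "smooth_fun A U h \<longleftrightarrow> (\<forall>c\<in>A. smooth_on (snd c ` (fst c \<inter> U)) (h \<circ> chart_inv c))"

definition smooth_fun_near ::
  "('m::topological_space, 'e::euclidean_space) chart set \<Rightarrow> 'm \<Rightarrow> ('m \<Rightarrow> real) \<Rightarrow> bool" where
  "smooth_fun_near A p h \<longleftrightarrow> (\<exists>U. open U \<and> p \<in> U \<and> smooth_fun A U h)"


subsection \<open>Tangent vectors and vector fields\<close>

text \<open>A tangent vector at \<open>p\<close> is a family of components, one in \<open>'e\<close> for every chart at \<open>p\<close>, which
  transforms by the derivative of the coordinate change.  It is \<open>0\<close> on all other arguments, so that
  equality of tangent vectors is equality of functions.\<close>

type_synonym ('m, 'e) tvec = "('m, 'e) chart \<Rightarrow> 'e"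

definition tangent_space ::
  "('m, 'e::euclidean_space) chart set \<Rightarrow> 'm \<Rightarrow> ('m, 'e) tvec set" where
  "tangent_space A p =
     {v. (\<forall>c\<in>charts_at A p. \<forall>c'\<in>charts_at A p.
            v c' = frechet_derivative (snd c' \<circ> chart_inv c) (at (snd c p)) (v c)) \<and>
         (\<forall>c. c \<notin> charts_at A p \<longrightarrow> v c = 0)}"

text \<open>The vector at \<open>p\<close> with component \<open>b\<close> in the chart \<open>c\<close>.\<close>

definition coord_vec ::
  "('m, 'e::euclidean_space) chart set \<Rightarrow> ('m, 'e) chart \<Rightarrow> 'm \<Rightarrow> 'e \<Rightarrow> ('m, 'e) tvec" where
  "coord_vec A c p b = (THE v. v \<in> tangent_space A p \<and> v c = b)"

text \<open>Trace of an endomorphism of the tangent space at \<open>p\<close>: the sum of the diagonal entries of its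
  matrix with respect to the coordinate basis of a chart at \<open>p\<close>.\<close>

definition trace_at ::
  "('m, 'e::euclidean_space) chart set \<Rightarrow> 'm \<Rightarrow> (('m, 'e) tvec \<Rightarrow> ('m, 'e) tvec) \<Rightarrow> real" where
  "trace_at A p L =
     (\<Sum>b\<in>Basis. L (coord_vec A (chart_at A p) p b) (chart_at A p) \<bullet> b)"

definition smooth_vf ::
  "('m, 'e::euclidean_space) chart set \<Rightarrow> 'm set \<Rightarrow> ('m \<Rightarrow> ('m, 'e) tvec) \<Rightarrow> bool" where
  "smooth_vf A U X \<longleftrightarrow>
     (\<forall>p\<in>U. X p \<in> tangent_space A p) \<and>
     (\<forall>c\<in>A. smooth_on (snd c ` (fst c \<inter> U)) (\<lambda>x. X (chart_inv c x) c))"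

definition smooth_vf_near ::
  "('m::topological_space, 'e::euclidean_space) chart set \<Rightarrow> 'm \<Rightarrow> ('m \<Rightarrow> ('m, 'e) tvec) \<Rightarrow> bool" where
  "smooth_vf_near A p X \<longleftrightarrow> (\<exists>U. open U \<and> p \<in> U \<and> smooth_vf A U X)"

text \<open>An arbitrary local extension of a tangent vector at \<open>p\<close> to a smooth vector field.  It only
  enters expressions that are tensorial, hence independent of the choice.\<close>

definition vf_extension ::
  "('m::topological_space, 'e::euclidean_space) chart set \<Rightarrow> 'm \<Rightarrow> ('m, 'e) tvec \<Rightarrow>
     'm \<Rightarrow> ('m, 'e) tvec" where
  "vf_extension A p v = (SOME X. smooth_vf_near A p X \<and> X p = v)"

definition dir_deriv ::
  "('m, 'e::euclidean_space) chart set \<Rightarrow> 'm \<Rightarrow> ('m, 'e) tvec \<Rightarrow> ('m \<Rightarrow> real) \<Rightarrow> real" where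
  "dir_deriv A p v h =
     frechet_derivative (h \<circ> chart_inv (chart_at A p)) (at (snd (chart_at A p) p)) (v (chart_at A p))"

definition lie_bracket ::
  "('m::topological_space, 'e::euclidean_space) chart set \<Rightarrow> ('m \<Rightarrow> ('m, 'e) tvec) \<Rightarrow>
     ('m \<Rightarrow> ('m, 'e) tvec) \<Rightarrow> 'm \<Rightarrow> ('m, 'e) tvec" where
  "lie_bracket A X Y p =
     (THE v. v \<in> tangent_space A p \<and>
        (\<forall>h. smooth_fun_near A p h \<longrightarrow>
           dir_deriv A p v h =
             dir_deriv A p (X p) (\<lambda>q. dir_deriv A q (Y q) h) -
             dir_deriv A p (Y p) (\<lambda>q. dir_deriv A q (X q) h)))"


subsection \<open>Riemannian metrics and the Levi-Civita connection\<close>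

type_synonym ('m, 'e) metric = "'m \<Rightarrow> ('m, 'e) tvec \<Rightarrow> ('m, 'e) tvec \<Rightarrow> real"

definition riemannian_metric ::
  "('m::topological_space, 'e::euclidean_space) chart set \<Rightarrow> ('m, 'e) metric \<Rightarrow> bool" where
  "riemannian_metric A g \<longleftrightarrow>
     (\<forall>p. \<forall>u\<in>tangent_space A p. \<forall>v\<in>tangent_space A p.
        g p u v = g p v u \<and>
        (\<forall>w\<in>tangent_space A p. \<forall>a b. g p (a *\<^sub>R u + b *\<^sub>R v) w = a * g p u w + b * g p v w)) \<and>
     (\<forall>p. \<forall>v\<in>tangent_space A p. v \<noteq> 0 \<longrightarrow> g p v v > 0) \<and>
     (\<forall>U X Y. open U \<longrightarrow> smooth_vf A U X \<longrightarrow> smooth_vf A U Y \<longrightarrow>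
        smooth_fun A U (\<lambda>p. g p (X p) (Y p)))"

text \<open>A connection assigns to a point \<open>p\<close>, a tangent vector \<open>v\<close> at \<open>p\<close> and a vector field \<open>Y\<close> that is
  smooth near \<open>p\<close> the covariant derivative \<open>D p v Y\<close>, a tangent vector at \<open>p\<close>, which only depends
  on the germ of \<open>Y\<close> at \<open>p\<close>.\<close>

type_synonym ('m, 'e) connection =
  "'m \<Rightarrow> ('m, 'e) tvec \<Rightarrow> ('m \<Rightarrow> ('m, 'e) tvec) \<Rightarrow> ('m, 'e) tvec"

definition affine_connection ::
  "('m::topological_space, 'e::euclidean_space) chart set \<Rightarrow> ('m, 'e) connection \<Rightarrow> bool" where
  "affine_connection A D \<longleftrightarrow>
     (\<forall>p Y. \<forall>v\<in>tangent_space A p. smooth_vf_near A p Y \<longrightarrow>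
        D p v Y \<in> tangent_space A p \<and>
        (\<forall>w\<in>tangent_space A p. \<forall>a b. D p (a *\<^sub>R v + b *\<^sub>R w) Y = a *\<^sub>R D p v Y + b *\<^sub>R D p w Y) \<and>
        (\<forall>Z. smooth_vf_near A p Z \<longrightarrow> D p v (\<lambda>q. Y q + Z q) = D p v Y + D p v Z) \<and>
        (\<forall>h. smooth_fun_near A p h \<longrightarrow>
           D p v (\<lambda>q. h q *\<^sub>R Y q) = dir_deriv A p v h *\<^sub>R Y p + h p *\<^sub>R D p v Y) \<and>
        (\<forall>Z. (\<forall>\<^sub>F q in nhds p. Z q = Y q) \<longrightarrow> D p v Z = D p v Y)) \<and>
     (\<forall>U X Y. open U \<longrightarrow> smooth_vf A U X \<longrightarrow> smooth_vf A U Y \<longrightarrow>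
        smooth_vf A U (\<lambda>p. D p (X p) Y))"

definition torsion_free ::
  "('m::topological_space, 'e::euclidean_space) chart set \<Rightarrow> ('m, 'e) connection \<Rightarrow> bool" where
  "torsion_free A D \<longleftrightarrow>
     (\<forall>p X Y. smooth_vf_near A p X \<longrightarrow> smooth_vf_near A p Y \<longrightarrow>
        D p (X p) Y - D p (Y p) X = lie_bracket A X Y p)"

definition metric_compatible ::
  "('m::topological_space, 'e::euclidean_space) chart set \<Rightarrow> ('m, 'e) metric \<Rightarrow>
     ('m, 'e) connection \<Rightarrow> bool" where
  "metric_compatible A g D \<longleftrightarrow>
     (\<forall>p Y Z. \<forall>v\<in>tangent_space A p. smooth_vf_near A p Y \<longrightarrow> smooth_vf_near A p Z \<longrightarrow>
        dir_deriv A p v (\<lambda>q. g q (Y q) (Z q)) = g p (D p v Y) (Z p) + g p (Y p) (D p v Z))"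

definition levi_civita ::
  "('m::topological_space, 'e::euclidean_space) chart set \<Rightarrow> ('m, 'e) metric \<Rightarrow>
     ('m, 'e) connection \<Rightarrow> bool" where
  "levi_civita A g D \<longleftrightarrow> affine_connection A D \<and> torsion_free A D \<and> metric_compatible A g D"


subsection \<open>Curvature\<close>

definition curvature_op ::
  "('m::topological_space, 'e::euclidean_space) chart set \<Rightarrow> ('m, 'e) connection \<Rightarrow>
     ('m \<Rightarrow> ('m, 'e) tvec) \<Rightarrow> ('m \<Rightarrow> ('m, 'e) tvec) \<Rightarrow> ('m \<Rightarrow> ('m, 'e) tvec) \<Rightarrow> 'm \<Rightarrow> ('m, 'e) tvec" where
  "curvature_op A D X Y Z p =
     D p (X p) (\<lambda>q. D q (Y q) Z) - D p (Y p) (\<lambda>q. D q (X q) Z) - D p (lie_bracket A X Y p) Z"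

definition Riem ::
  "('m::topological_space, 'e::euclidean_space) chart set \<Rightarrow> ('m, 'e) connection \<Rightarrow> 'm \<Rightarrow>
     ('m, 'e) tvec \<Rightarrow> ('m, 'e) tvec \<Rightarrow> ('m, 'e) tvec \<Rightarrow> ('m, 'e) tvec" where
  "Riem A D p u v w =
     curvature_op A D (vf_extension A p u) (vf_extension A p v) (vf_extension A p w) p"

text \<open>Raising an index: the vector representing the linear form \<open>\<omega>\<close> on the tangent space at \<open>p\<close>.\<close>

definition sharp ::
  "('m, 'e::euclidean_space) chart set \<Rightarrow> ('m, 'e) metric \<Rightarrow> 'm \<Rightarrow> (('m, 'e) tvec \<Rightarrow> real) \<Rightarrow>
     ('m, 'e) tvec" where
  "sharp A g p \<omega> =
     (THE w. w \<in> tangent_space A p \<and> (\<forall>u\<in>tangent_space A p. g p w u = \<omega> u))"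

definition ric_form ::
  "('m::topological_space, 'e::euclidean_space) chart set \<Rightarrow> ('m, 'e) connection \<Rightarrow> 'm \<Rightarrow>
     ('m, 'e) tvec \<Rightarrow> ('m, 'e) tvec \<Rightarrow> real" where
  "ric_form A D p v w = trace_at A p (\<lambda>u. Riem A D p u v w)"

definition Ric ::
  "('m::topological_space, 'e::euclidean_space) chart set \<Rightarrow> ('m, 'e) metric \<Rightarrow>
     ('m, 'e) connection \<Rightarrow> 'm \<Rightarrow> ('m, 'e) tvec \<Rightarrow> ('m, 'e) tvec" where
  "Ric A g D p v = sharp A g p (ric_form A D p v)"

definition scal ::
  "('m::topological_space, 'e::euclidean_space) chart set \<Rightarrow> ('m, 'e) metric \<Rightarrow>
     ('m, 'e) connection \<Rightarrow> 'm \<Rightarrow> real" where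
  "scal A g D p = trace_at A p (Ric A g D p)"


subsection \<open>Gradient, Hessian, Laplacians\<close>

definition grad ::
  "('m, 'e::euclidean_space) chart set \<Rightarrow> ('m, 'e) metric \<Rightarrow> ('m \<Rightarrow> real) \<Rightarrow> 'm \<Rightarrow> ('m, 'e) tvec" where
  "grad A g h p = sharp A g p (\<lambda>u. dir_deriv A p u h)"

text \<open>The Hessian as a (1,1)-tensor and as a (0,2)-tensor.\<close>

definition hess_op ::
  "('m, 'e::euclidean_space) chart set \<Rightarrow> ('m, 'e) metric \<Rightarrow> ('m, 'e) connection \<Rightarrow>
     ('m \<Rightarrow> real) \<Rightarrow> 'm \<Rightarrow> ('m, 'e) tvec \<Rightarrow> ('m, 'e) tvec" where
  "hess_op A g D h p v = D p v (grad A g h)"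

definition hess_form ::
  "('m, 'e::euclidean_space) chart set \<Rightarrow> ('m, 'e) metric \<Rightarrow> ('m, 'e) connection \<Rightarrow>
     ('m \<Rightarrow> real) \<Rightarrow> 'm \<Rightarrow> ('m, 'e) tvec \<Rightarrow> ('m, 'e) tvec \<Rightarrow> real" where
  "hess_form A g D h p v w = g p (hess_op A g D h p v) w"

definition laplacian ::
  "('m, 'e::euclidean_space) chart set \<Rightarrow> ('m, 'e) metric \<Rightarrow> ('m, 'e) connection \<Rightarrow>
     ('m \<Rightarrow> real) \<Rightarrow> 'm \<Rightarrow> real" where
  "laplacian A g D h p = trace_at A p (hess_op A g D h p)"

definition drift_laplacian ::
  "('m, 'e::euclidean_space) chart set \<Rightarrow> ('m, 'e) metric \<Rightarrow> ('m, 'e) connection \<Rightarrow>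
     ('m \<Rightarrow> real) \<Rightarrow> ('m \<Rightarrow> real) \<Rightarrow> 'm \<Rightarrow> real" where
  "drift_laplacian A g D f h p = laplacian A g D h p - dir_deriv A p (grad A g f p) h"

text \<open>Covariant derivative of a (1,1)-tensor field, \<open>(\<nabla>\<^sub>v T)(e) = \<nabla>\<^sub>v (T E) - T (\<nabla>\<^sub>v E)\<close> for a
  local extension \<open>E\<close> of \<open>e\<close>.\<close>

definition cov_endo ::
  "('m::topological_space, 'e::euclidean_space) chart set \<Rightarrow> ('m, 'e) connection \<Rightarrow> 'm \<Rightarrow>
     ('m, 'e) tvec \<Rightarrow> ('m \<Rightarrow> ('m, 'e) tvec \<Rightarrow> ('m, 'e) tvec) \<Rightarrow> ('m, 'e) tvec \<Rightarrow> ('m, 'e) tvec" where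
  "cov_endo A D p v T e =
     D p v (\<lambda>q. T q (vf_extension A p e q)) - T p (D p v (vf_extension A p e))"

end

theory Submission
  imports Defs
begin

text \<open>The soliton equation says \<open>Ric = \<lambda> I - S\<close>.  Since \<open>R(X, Y)\<nabla>f = (\<nabla>\<^sub>X S)Y - (\<nabla>\<^sub>Y S)X\<close>, taking the trace
  gives \<open>Ric(\<nabla>f) = div S - \<nabla>tr S\<close>, while the contracted second Bianchi identity reads
  \<open>2 div S = \<nabla>tr S\<close>; together they yield \<open>\<nabla>scal = 2 Ric(\<nabla>f)\<close>.  The second equation is
  \<open>R(E, \<nabla>f)\<nabla>f = (\<nabla>\<^sub>E S)\<nabla>f - (\<nabla>\<^bsub>\<nabla>f\<^esub> S)E\<close> with \<open>S(\<nabla>f) = \<lambda>\<nabla>f - \<nabla>scal / 2\<close> inserted,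
  the third restates it for \<open>Ric\<close>, and the last is the trace of the third.\<close>

subsection \<open>Calculus of smooth maps\<close>

text \<open>\<open>Riem\<close>, \<open>cov_endo\<close> and \<open>trace_at\<close> are defined
  through arbitrary choices: extensions of vectors by \<open>SOME\<close> and the chart picked by
  \<open>chart_at\<close>. The tensor argument can start only once these choices are shown not to
  matter. Local orthonormal frames, obtained from coordinate fields by Gram-Schmidt, serve for both:
  they give a chart-free formula for traces, and expanding a field in such a frame shows that
  tensorial expressions see only its value at \<open>p\<close>. As fields are smooth only near a
  point, all identities between them are treated as identities of germs. The derivation of the
  contracted Bianchi identity rests on two further facts. Every tangent vector extends to a field
  whose covariant derivative vanishes at \<open>p\<close>, which reduces the identity to commuting
  derivatives at one point. And the trace commutes with the covariant derivative, because the
  connection coefficients in an orthonormal frame are skew. Smoothness and symmetry of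
  \<open>Ric\<close> are inherited from \<open>lam I - S\<close>; \<open>S\<close> is symmetric
  because the connection is torsion-free and metric.\<close>

lemma Ck_on_subset: "Ck_on k S f \<Longrightarrow> T \<subseteq> S \<Longrightarrow> Ck_on k T f"
  by (induction k arbitrary: f) (auto intro: continuous_on_subset)

text \<open>Openness of \<open>S\<close> matters: derivatives are taken with the unrestricted filter
  \<open>at x\<close>, so they agree only for functions that agree near \<open>x\<close>.\<close>

lemma Ck_on_cong:
  assumes "open S" "\<And>x. x \<in> S \<Longrightarrow> f x = g x" "Ck_on k S f"
  shows "Ck_on k S g"
  using assms(2,3)
proof (induction k arbitrary: f g)
  case 0
  then show ?case by (simp cong: continuous_on_cong)
next
  case (Suc k)
  have g: "(g has_derivative frechet_derivative f (at x)) (at x)" if x: "x \<in> S" for x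
  proof (rule has_derivative_transform_within_open[OF _ assms(1) x])
    show "(f has_derivative frechet_derivative f (at x)) (at x)"
      using Suc.prems(2) x by (simp add: frechet_derivative_works)
  qed (use Suc.prems(1) in auto)
  have "Ck_on k S (\<lambda>x. frechet_derivative g (at x) v)" for v
  proof (rule Suc.IH)
    show "Ck_on k S (\<lambda>x. frechet_derivative f (at x) v)"
      using Suc.prems(2) by simp
  qed (use frechet_derivative_at[OF g] in simp)
  then show ?case
    using g by (auto simp: differentiable_def)
qed

text \<open>The closure proofs below all produce an explicit derivative \<open>f'\<close>; on an
  open set it agrees with the \<open>frechet_derivative\<close> that \<open>Ck_on\<close>
  mentions.\<close>

lemma Ck_on_SucI:
  assumes S: "open S" and d: "\<And>x. x \<in> S \<Longrightarrow> (f has_derivative f' x) (at x)"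
    and c: "\<And>v. Ck_on k S (\<lambda>x. f' x v)"
  shows "Ck_on (Suc k) S f"
proof -
  have "Ck_on k S (\<lambda>x. frechet_derivative f (at x) v)" for v
    using frechet_derivative_at[OF d] by (intro Ck_on_cong[OF S _ c[of v]]) simp
  then show ?thesis
    using d by (auto simp: differentiable_def)
qed

lemma Ck_on_Suc_derivative:
  assumes "Ck_on (Suc k) S f" "x \<in> S"
  shows "(f has_derivative frechet_derivative f (at x)) (at x)"
  using assms by (simp add: frechet_derivative_works)

lemma Ck_on_SucD: "Ck_on (Suc k) S f \<Longrightarrow> Ck_on k S f"
proof (induction k arbitrary: f)
  case 0
  then show ?case
    by (auto intro!: continuous_at_imp_continuous_on differentiable_imp_continuous_within)
next
  case (Suc k)
  then show ?case by (metis Ck_on.simps(2))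
qed

lemma Ck_on_const: "Ck_on k S (\<lambda>x. c)"
  by (induction k arbitrary: c) auto

lemma Ck_on_bounded_linear:
  assumes "bounded_linear L" "open S" "Ck_on k S f"
  shows "Ck_on k S (\<lambda>x. L (f x))"
  using assms(3)
proof (induction k arbitrary: f)
  case 0
  then show ?case
    using assms(1) by (simp add: bounded_linear.continuous_on)
next
  case (Suc k)
  show ?case
  proof (rule Ck_on_SucI)
    fix x assume "x \<in> S"
    then show "((\<lambda>x. L (f x)) has_derivative (\<lambda>v. L (frechet_derivative f (at x) v))) (at x)"
      using Suc.prems by (intro bounded_linear.has_derivative[OF assms(1)] Ck_on_Suc_derivative)
  qed (use Suc assms(2) in auto)
qed

lemma Ck_on_add:
  assumes "open S" "Ck_on k S f" "Ck_on k S g"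
  shows "Ck_on k S (\<lambda>x. f x + g x)"
  using assms(2,3)
proof (induction k arbitrary: f g)
  case (Suc k)
  show ?case
  proof (rule Ck_on_SucI)
    fix x assume "x \<in> S"
    then show "((\<lambda>x. f x + g x) has_derivative
      (\<lambda>v. frechet_derivative f (at x) v + frechet_derivative g (at x) v)) (at x)"
      using Suc.prems by (intro has_derivative_add Ck_on_Suc_derivative)
  qed (use Suc assms(1) in auto)
qed (auto intro: continuous_intros)

lemma Ck_on_bilinear:
  assumes B: "bounded_bilinear B" and S: "open S" and fg: "Ck_on k S f" "Ck_on k S g"
  shows "Ck_on k S (\<lambda>x. B (f x) (g x))"
  using fg
proof (induction k arbitrary: f g)
  case 0
  then show ?case
    using B by (simp add: bounded_bilinear.continuous_on)
next
  case (Suc k)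
  show ?case
  proof (rule Ck_on_SucI)
    fix x assume x: "x \<in> S"
    show "((\<lambda>x. B (f x) (g x)) has_derivative
      (\<lambda>v. B (f x) (frechet_derivative g (at x) v) + B (frechet_derivative f (at x) v) (g x))) (at x)"
      using Suc.prems x by (intro bounded_bilinear.FDERIV[OF B] Ck_on_Suc_derivative)
  next
    fix v
    \<comment> \<open>Each Leibniz term pairs a derivative with an undifferentiated factor, so both
      functions are also used at the lower order \<open>k\<close>.\<close>
    show "Ck_on k S (\<lambda>x. B (f x) (frechet_derivative g (at x) v) + B (frechet_derivative f (at x) v) (g x))"
      using Suc.prems Suc.prems[THEN Ck_on_SucD] by (intro Ck_on_add Suc.IH S) auto
  qed (use S in auto)
qed

lemma Ck_on_sum:
  assumes "open S" "\<And>i. i \<in> I \<Longrightarrow> Ck_on k S (f i)"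
  shows "Ck_on k S (\<lambda>x. \<Sum>i\<in>I. f i x)"
  using assms(2)
  by (induction I rule: infinite_finite_induct) (auto intro: Ck_on_const Ck_on_add assms(1))

lemma Ck_on_inverse:
  fixes h :: "'a::euclidean_space \<Rightarrow> real"
  assumes S: "open S" and h: "\<And>x. x \<in> S \<Longrightarrow> h x \<noteq> 0" and k: "Ck_on k S h"
  shows "Ck_on k S (\<lambda>x. inverse (h x))"
  using k
proof (induction k)
  case 0
  then show ?case
    using h by (auto intro: continuous_intros)
next
  case (Suc k)
  \<comment> \<open>The derivative of the inverse contains the inverse itself, whose regularity of
    order \<open>k\<close> comes from the induction hypothesis.\<close>
  have inv: "Ck_on k S (\<lambda>x. inverse (h x))"
    using Suc Ck_on_SucD by blast
  show ?case
  proof (rule Ck_on_SucI)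
    fix x assume x: "x \<in> S"
    show "((\<lambda>x. inverse (h x)) has_derivative
      (\<lambda>v. - (inverse (h x) * frechet_derivative h (at x) v * inverse (h x)))) (at x)"
      using Suc.prems x h by (intro Deriv.has_derivative_inverse Ck_on_Suc_derivative)
  next
    fix v
    have "Ck_on k S (\<lambda>x. inverse (h x) * frechet_derivative h (at x) v * inverse (h x))"
      using Suc.prems inv by (intro Ck_on_bilinear[OF bounded_bilinear_mult] S) auto
    then show "Ck_on k S (\<lambda>x. - (inverse (h x) * frechet_derivative h (at x) v * inverse (h x)))"
      using S by (intro Ck_on_bounded_linear[OF bounded_linear_minus[OF bounded_linear_ident]]) auto
  qed (use S in auto)
qed

lemma Ck_on_sqrt:
  assumes S: "open S" and h: "\<And>x. x \<in> S \<Longrightarrow> h x > 0" and k: "Ck_on k S h"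
  shows "Ck_on k S (\<lambda>x. sqrt (h x))"
  using k
proof (induction k)
  case 0
  then show ?case
    by (auto intro: continuous_intros)
next
  case (Suc k)
  have inv: "Ck_on k S (\<lambda>x. sqrt (h x))"
    using Suc Ck_on_SucD by blast
  show ?case
  proof (rule Ck_on_SucI)
    fix x assume x: "x \<in> S"
    show "((\<lambda>x. sqrt (h x)) has_derivative
      (\<lambda>v. frechet_derivative h (at x) v * (inverse (sqrt (h x)) / 2))) (at x)"
      using DERIV_compose_FDERIV[OF DERIV_real_sqrt[OF h[OF x]] Ck_on_Suc_derivative[OF Suc.prems x]]
      by simp
  next
    fix v
    have "Ck_on k S (\<lambda>x. inverse (sqrt (h x)))"
    proof (rule Ck_on_inverse[OF S _ inv])
      show "sqrt (h x) \<noteq> 0" if "x \<in> S" for x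
        using h[OF that] by simp
    qed
    then show "Ck_on k S (\<lambda>x. frechet_derivative h (at x) v * (inverse (sqrt (h x)) / 2))"
      using Suc.prems
      by (intro Ck_on_bilinear[OF bounded_bilinear_mult] Ck_on_bounded_linear[OF bounded_linear_divide] S) auto
  qed (use S in auto)
qed

lemma frechet_derivative_Basis:
  fixes f :: "'a::euclidean_space \<Rightarrow> 'b::real_normed_vector"
  assumes "f differentiable (at x)"
  shows "frechet_derivative f (at x) v = (\<Sum>b\<in>Basis. (v \<bullet> b) *\<^sub>R frechet_derivative f (at x) b)"
proof -
  interpret linear "frechet_derivative f (at x)"
    using assms by (simp add: linear_frechet_derivative)
  have "frechet_derivative f (at x) v = frechet_derivative f (at x) (\<Sum>b\<in>Basis. (v \<bullet> b) *\<^sub>R b)"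
    by (simp add: euclidean_representation)
  then show ?thesis
    by (simp add: sum scaleR)
qed

text \<open>\<open>Ck_on\<close> controls derivatives in fixed directions only; a direction that
  varies with the point is expanded in the basis.\<close>

lemma Ck_on_frechet_derivative:
  assumes S: "open S" and f: "Ck_on (Suc k) S f" and v: "Ck_on k S v"
  shows "Ck_on k S (\<lambda>x. frechet_derivative f (at x) (v x))"
proof (rule Ck_on_cong[OF S])
  show "Ck_on k S (\<lambda>x. \<Sum>b\<in>Basis. (v x \<bullet> b) *\<^sub>R frechet_derivative f (at x) b)"
    using f v
    by (intro Ck_on_sum S Ck_on_bilinear[OF bounded_bilinear_scaleR]
        Ck_on_bounded_linear[OF bounded_linear_inner_left]) auto
qed (use f in \<open>simp add: frechet_derivative_Basis[symmetric]\<close>)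

text \<open>In the chain rule the direction for \<open>f\<close> depends on the point. Expanded in
  the basis, it leaves the partial derivatives of \<open>f\<close> composed with \<open>h\<close>,
  to which the induction hypothesis for arbitrary \<open>f\<close> applies.\<close>

lemma Ck_on_compose:
  assumes S: "open S" and T: "open T" and h: "Ck_on k S h" and f: "Ck_on k T f"
    and hS: "h ` S \<subseteq> T"
  shows "Ck_on k S (\<lambda>x. f (h x))"
  using h f
proof (induction k arbitrary: f)
  case 0
  then show ?case
    using hS continuous_on_compose2[of T f S h] by auto
next
  case (Suc k)
  show ?case
  proof (rule Ck_on_SucI)
    fix x assume x: "x \<in> S"
    show "((\<lambda>x. f (h x)) has_derivative
      (\<lambda>v. frechet_derivative f (at (h x)) (frechet_derivative h (at x) v))) (at x)"
      using hS x by (intro has_derivative_compose[OF Ck_on_Suc_derivative[OF Suc.prems(1) x]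
            Ck_on_Suc_derivative[OF Suc.prems(2)]]) auto
  next
    fix v
    show "Ck_on k S (\<lambda>x. frechet_derivative f (at (h x)) (frechet_derivative h (at x) v))"
    proof (rule Ck_on_cong[OF S])
      show "Ck_on k S (\<lambda>x. \<Sum>b\<in>Basis. (frechet_derivative h (at x) v \<bullet> b) *\<^sub>R
          frechet_derivative f (at (h x)) b)"
      proof (intro Ck_on_sum S Ck_on_bilinear[OF bounded_bilinear_scaleR]
            Ck_on_bounded_linear[OF bounded_linear_inner_left])
        show "Ck_on k S (\<lambda>x. frechet_derivative h (at x) v)"
          using Suc.prems(1) by simp
        show "Ck_on k S (\<lambda>x. frechet_derivative f (at (h x)) b)" for b
          using Suc.prems by (intro Suc.IH Ck_on_SucD[OF Suc.prems(1)]) auto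
      qed
    next
      fix x assume "x \<in> S"
      then have "f differentiable (at (h x))"
        using Suc.prems(2) hS by auto
      then show "(\<Sum>b\<in>Basis. (frechet_derivative h (at x) v \<bullet> b) *\<^sub>R frechet_derivative f (at (h x)) b) =
          frechet_derivative f (at (h x)) (frechet_derivative h (at x) v)"
        by (rule frechet_derivative_Basis[symmetric])
    qed
  qed (use S in auto)
qed

section \<open>Symmetry of second derivatives\<close>

text \<open>The mean value theorem is applied twice: in direction \<open>u\<close> to the difference
  of \<open>H\<close> along two parallel segments, then in direction \<open>v\<close> to the
  derivative of \<open>H\<close> along \<open>u\<close>.\<close>

lemma second_difference_mean_value:
  fixes H :: "'a::euclidean_space \<Rightarrow> real"
  assumes H: "Ck_on 2 S H" and s: "s > 0"
    and seg: "\<And>a b. 0 \<le> a \<Longrightarrow> a \<le> s \<Longrightarrow> 0 \<le> b \<Longrightarrow> b \<le> s \<Longrightarrow> x + a *\<^sub>R u + b *\<^sub>R v \<in> S"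
  obtains a b where "0 < a" "a < s" "0 < b" "b < s"
    "H (x + s *\<^sub>R u + s *\<^sub>R v) - H (x + s *\<^sub>R u) - H (x + s *\<^sub>R v) + H x =
      s\<^sup>2 * frechet_derivative (\<lambda>y. frechet_derivative H (at y) u) (at (x + a *\<^sub>R u + b *\<^sub>R v)) v"
proof -
  define Hu where "Hu = (\<lambda>y. frechet_derivative H (at y) u)"
  have dH: "(H has_derivative frechet_derivative H (at y)) (at y)"
    and dHu: "(Hu has_derivative frechet_derivative Hu (at y)) (at y)" if "y \<in> S" for y
    using H that unfolding Hu_def by (auto simp: numeral_2_eq_2 frechet_derivative_works)
  have line: "((\<lambda>a. F (y + a *\<^sub>R w)) has_real_derivative F' w) (at a)"
    if "(F has_derivative F') (at (y + a *\<^sub>R w))" for F :: "'a \<Rightarrow> real" and F' y w a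
  proof -
    have "((\<lambda>a. y + a *\<^sub>R w) has_derivative (\<lambda>t. t *\<^sub>R w)) (at a)"
      by (auto intro!: derivative_eq_intros)
    from has_derivative_compose[OF this, of F F'] that
    have "((\<lambda>a. F (y + a *\<^sub>R w)) has_derivative (\<lambda>t. F' (t *\<^sub>R w))) (at a)" .
    moreover have "F' (t *\<^sub>R w) = F' w * t" for t
      using has_derivative_bounded_linear[OF that]
      by (simp add: linear_simps mult.commute)
    ultimately show ?thesis
      by (simp add: has_field_derivative_def)
  qed
  define \<phi> where "\<phi> a = H ((x + s *\<^sub>R v) + a *\<^sub>R u) - H (x + a *\<^sub>R u)" for a
  have "(\<phi> has_real_derivative Hu ((x + s *\<^sub>R v) + a *\<^sub>R u) - Hu (x + a *\<^sub>R u)) (at a)"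
    if "0 \<le> a" "a \<le> s" for a
    unfolding \<phi>_def Hu_def
    using seg[of a s] seg[of a 0] that s
    by (intro DERIV_diff line dH) (auto simp: algebra_simps)
  from MVT2[OF s this] obtain a where a: "0 < a" "a < s"
    "\<phi> s - \<phi> 0 = s * (Hu ((x + s *\<^sub>R v) + a *\<^sub>R u) - Hu (x + a *\<^sub>R u))"
    by auto
  have "((\<lambda>b. Hu ((x + a *\<^sub>R u) + b *\<^sub>R v)) has_real_derivative
      frechet_derivative Hu (at ((x + a *\<^sub>R u) + b *\<^sub>R v)) v) (at b)"
    if "0 \<le> b" "b \<le> s" for b
    using seg[of a b] that a by (intro line dHu) auto
  from MVT2[OF s this] obtain b where b: "0 < b" "b < s"
    "Hu ((x + a *\<^sub>R u) + s *\<^sub>R v) - Hu (x + a *\<^sub>R u) = s * frechet_derivative Hu (at ((x + a *\<^sub>R u) + b *\<^sub>R v)) v"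
    by auto
  show thesis
    using a b that[of a b] unfolding \<phi>_def Hu_def
    by (simp add: algebra_simps power2_eq_square)
qed

text \<open>The second difference is symmetric in \<open>u\<close> and \<open>v\<close>, and divided
  by the square of \<open>s\<close> it tends to either mixed derivative. This symmetry is what makes
  the Lie bracket a first-order operator.\<close>

theorem second_derivative_symmetric:
  fixes H :: "'a::euclidean_space \<Rightarrow> real"
  assumes S: "open S" "x \<in> S" and H: "Ck_on 2 S H"
  shows "frechet_derivative (\<lambda>y. frechet_derivative H (at y) u) (at x) v =
    frechet_derivative (\<lambda>y. frechet_derivative H (at y) v) (at x) u"
proof -
  define P where "P u v = (\<lambda>x. frechet_derivative (\<lambda>y. frechet_derivative H (at y) u) (at x) v)" for u v
  have cont: "isCont (P u v) x" for u v
    using H S unfolding P_def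
    by (simp add: numeral_2_eq_2 continuous_on_eq_continuous_at)
  have "\<exists>d>0. \<forall>s. 0 < s \<longrightarrow> s < d \<longrightarrow>
      \<bar>(H (x + s *\<^sub>R u + s *\<^sub>R v) - H (x + s *\<^sub>R u) - H (x + s *\<^sub>R v) + H x) / s\<^sup>2 - P u v x\<bar> < e"
    if e: "e > 0" for e u v
  proof -
    obtain r where r: "r > 0" "ball x r \<subseteq> S"
      using S by (meson openE)
    obtain r' where r': "r' > 0" "\<And>y. y \<noteq> x \<Longrightarrow> norm (y - x) < r' \<Longrightarrow> \<bar>P u v y - P u v x\<bar> < e"
      using LIM_D[OF cont[of u v, unfolded isCont_def] e] by auto
    have r'': "\<bar>P u v y - P u v x\<bar> < e" if "dist y x < r'" for y
      using r'(2)[of y] that e by (cases "y = x") (auto simp: dist_norm)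
    \<comment> \<open>Chosen so that every point of the parallelogram with sides at most
      \<open>d\<close> times \<open>u\<close> and \<open>v\<close> is close to \<open>x\<close>; the
      summand 1 keeps the denominator positive when \<open>u\<close> and \<open>v\<close>
      vanish.\<close>
    define d where "d = min r r' / (norm u + norm v + 1)"
    have pos: "norm u + norm v + 1 > 0"
      by (simp add: add_nonneg_pos)
    have "d > 0"
      using r(1) r'(1) pos by (simp add: d_def)
    have small: "dist (x + a *\<^sub>R u + b *\<^sub>R v) x < min r r'"
      if "0 \<le> a" "a \<le> s" "0 \<le> b" "b \<le> s" "0 < s" "s < d" for a b s
    proof -
      have "dist (x + a *\<^sub>R u + b *\<^sub>R v) x \<le> a * norm u + b * norm v"
        unfolding dist_norm using that norm_triangle_ineq[of "a *\<^sub>R u" "b *\<^sub>R v"] by (simp add: algebra_simps)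
      also have "\<dots> \<le> s * norm u + s * norm v"
        using that by (intro add_mono mult_right_mono) auto
      also have "\<dots> < s * (norm u + norm v + 1)"
        using that by (simp add: algebra_simps)
      also have "\<dots> < d * (norm u + norm v + 1)"
        using that pos by simp
      also have "\<dots> = min r r'"
        unfolding d_def using pos by simp
      finally show ?thesis .
    qed
    show ?thesis
    proof (intro exI[of _ d] conjI allI impI \<open>d > 0\<close>)
      fix s :: real assume s: "0 < s" "s < d"
      have seg: "x + a *\<^sub>R u + b *\<^sub>R v \<in> S"
        if "0 \<le> a" "a \<le> s" "0 \<le> b" "b \<le> s" for a b
        using small[OF that s] r(2) by (auto simp: dist_commute)
      obtain a b where ab:
        "0 < a" "a < s" "0 < b" "b < s"
        "H (x + s *\<^sub>R u + s *\<^sub>R v) - H (x + s *\<^sub>R u) - H (x + s *\<^sub>R v) + H x = s\<^sup>2 * P u v (x + a *\<^sub>R u + b *\<^sub>R v)"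
        unfolding P_def by (rule second_difference_mean_value[OF H s(1) seg])
      have "\<bar>P u v (x + a *\<^sub>R u + b *\<^sub>R v) - P u v x\<bar> < e"
        using small[of a s b] ab s by (intro r'') auto
      then show "\<bar>(H (x + s *\<^sub>R u + s *\<^sub>R v) - H (x + s *\<^sub>R u) - H (x + s *\<^sub>R v) + H x) / s\<^sup>2 - P u v x\<bar> < e"
        using s by (simp add: ab(5))
    qed
  qed note key = this
  have "\<bar>P u v x - P v u x\<bar> \<le> e" if e: "e > 0" for e
  proof -
    obtain d where d: "d > 0" "\<And>s. 0 < s \<Longrightarrow> s < d \<Longrightarrow>
      \<bar>(H (x + s *\<^sub>R u + s *\<^sub>R v) - H (x + s *\<^sub>R u) - H (x + s *\<^sub>R v) + H x) / s\<^sup>2 - P u v x\<bar> < e / 2"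
      using key[of "e/2" u v] e by auto
    obtain d' where d': "d' > 0" "\<And>s. 0 < s \<Longrightarrow> s < d' \<Longrightarrow>
      \<bar>(H (x + s *\<^sub>R v + s *\<^sub>R u) - H (x + s *\<^sub>R v) - H (x + s *\<^sub>R u) + H x) / s\<^sup>2 - P v u x\<bar> < e / 2"
      using key[of "e/2" v u] e by auto
    define s where "s = min d d' / 2"
    have "0 < s" "s < d" "s < d'"
      using d(1) d'(1) by (auto simp: s_def)
    have swap: "x + s *\<^sub>R v + s *\<^sub>R u = x + s *\<^sub>R u + s *\<^sub>R v"
      by (simp add: add.assoc add.commute)
    have comm: "a - b - c + d = a - c - b + d" for a b c d :: real
      by simp
    \<comment> \<open>One and the same number lies within \<open>e / 2\<close> of both mixed
      derivatives.\<close>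
    define Q where "Q = (H (x + s *\<^sub>R u + s *\<^sub>R v) - H (x + s *\<^sub>R u) - H (x + s *\<^sub>R v) + H x) / s\<^sup>2"
    have "Q = (H (x + s *\<^sub>R v + s *\<^sub>R u) - H (x + s *\<^sub>R v) - H (x + s *\<^sub>R u) + H x) / s\<^sup>2"
      unfolding Q_def swap by (subst comm) (rule refl)
    note Q_alt = this
    have "\<bar>Q - P v u x\<bar> < e / 2"
      unfolding Q_alt by (rule d'(2)[OF \<open>0 < s\<close> \<open>s < d'\<close>])
    moreover
    have "\<bar>Q - P u v x\<bar> < e / 2"
      using d(2)[OF \<open>0 < s\<close> \<open>s < d\<close>] unfolding Q_def .
    ultimately
    show ?thesis
      by linarith
  qed
  then have "\<bar>P u v x - P v u x\<bar> \<le> 0 + e" if "e > 0" for e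
    using that by simp
  then have "\<bar>P u v x - P v u x\<bar> \<le> 0"
    by (rule field_le_epsilon)
  then show ?thesis
    by (simp add: P_def)
qed


subsection \<open>Charts and tangent vectors\<close>

lemma scaleR_fun_apply [simp]: "(a *\<^sub>R f) x = a *\<^sub>R f x"
  by (simp add: scaleR_fun_def)

lemma sum_fun_apply: "(\<Sum>i\<in>I. f i) x = (\<Sum>i\<in>I. f i x)"
  for f :: "'i \<Rightarrow> 'a \<Rightarrow> 'b::comm_monoid_add"
  by (induction I rule: infinite_finite_induct) auto

lemma smooth_onD: "smooth_on S f \<Longrightarrow> Ck_on k S f"
  by (simp add: smooth_on_def)

lemma smooth_on_cong: "open S \<Longrightarrow> (\<And>x. x \<in> S \<Longrightarrow> f x = g x) \<Longrightarrow> smooth_on S f \<Longrightarrow> smooth_on S g"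
  unfolding smooth_on_def using Ck_on_cong by blast

lemma smooth_on_derivative:
  "smooth_on S f \<Longrightarrow> x \<in> S \<Longrightarrow> (f has_derivative frechet_derivative f (at x)) (at x)"
  using Ck_on_Suc_derivative[OF smooth_onD] .

locale smooth_manifold =
  fixes A :: "('m::{t2_space,second_countable_topology}, 'e::euclidean_space) chart set"
  assumes atlas: "smooth_atlas A"
begin

abbreviation "T \<equiv> tangent_space A"
abbreviation "smooth_at \<equiv> smooth_fun_near A"
abbreviation "smooth_vf_at \<equiv> smooth_vf_near A"

lemma charts_at_iff: "c \<in> charts_at A p \<longleftrightarrow> c \<in> A \<and> p \<in> fst c"
  by (simp add: charts_at_def)

lemma chart_at_in: "chart_at A p \<in> charts_at A p"
proof -
  have "p \<in> (\<Union>c\<in>A. fst c)"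
    using atlas by (simp add: smooth_atlas_def)
  then have "\<exists>c. c \<in> charts_at A p"
    by (auto simp: charts_at_iff)
  then show ?thesis
    unfolding chart_at_def by (rule someI_ex)
qed

lemma chart_homeomorphism:
  "c \<in> A \<Longrightarrow> homeomorphism (fst c) (snd c ` fst c) (snd c) (chart_inv c)"
  using atlas by (simp add: smooth_atlas_def)

lemma open_chart: "c \<in> A \<Longrightarrow> open (fst c)"
  using atlas by (simp add: smooth_atlas_def)

lemma chart_inv_chart: "c \<in> A \<Longrightarrow> p \<in> fst c \<Longrightarrow> chart_inv c (snd c p) = p"
  using homeomorphism_apply1[OF chart_homeomorphism] .

lemma open_chart_image:
  assumes "c \<in> A" "open U"
  shows "open (snd c ` (fst c \<inter> U))"
proof -
  have "open (snd c ` fst c \<inter> chart_inv c -` U)"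
    using atlas assms homeomorphism_cont2[OF chart_homeomorphism]
    by (intro continuous_open_preimage) (auto simp: smooth_atlas_def)
  moreover have "snd c ` fst c \<inter> chart_inv c -` U = snd c ` (fst c \<inter> U)"
    using assms(1) by (auto simp: chart_inv_chart)
  ultimately show ?thesis
    by simp
qed

lemma smooth_transition:
  "c \<in> A \<Longrightarrow> c' \<in> A \<Longrightarrow> smooth_on (snd c ` (fst c \<inter> fst c')) (snd c' \<circ> chart_inv c)"
  using atlas by (simp add: smooth_atlas_def)

definition jac :: "('m, 'e) chart \<Rightarrow> ('m, 'e) chart \<Rightarrow> 'm \<Rightarrow> 'e \<Rightarrow> 'e" where
  "jac c c' p = frechet_derivative (snd c' \<circ> chart_inv c) (at (snd c p))"

lemma jac_derivative:
  assumes "c \<in> charts_at A p" "c' \<in> charts_at A p"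
  shows "((snd c' \<circ> chart_inv c) has_derivative jac c c' p) (at (snd c p))"
  unfolding jac_def
  using assms by (intro smooth_on_derivative[OF smooth_transition]) (auto simp: charts_at_iff)

lemma linear_jac: "c \<in> charts_at A p \<Longrightarrow> c' \<in> charts_at A p \<Longrightarrow> linear (jac c c' p)"
  using jac_derivative has_derivative_linear by blast

text \<open>On the overlap of the two chart domains, \<open>h\<close> read in \<open>c\<close> is
  \<open>h\<close> read in \<open>c'\<close> after the coordinate change, so this is the chain rule.
  With a coordinate map for \<open>h\<close> it gives the cocycle rule
  \<open>jac_compose\<close>.\<close>

lemma chart_change_derivative:
  assumes c: "c \<in> charts_at A p" "c' \<in> charts_at A p"
    and h: "((h \<circ> chart_inv c') has_derivative h') (at (snd c' p))"
  shows "((h \<circ> chart_inv c) has_derivative (\<lambda>v. h' (jac c c' p v))) (at (snd c p))"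
proof -
  have 1: "((h \<circ> chart_inv c') has_derivative h') (at ((snd c' \<circ> chart_inv c) (snd c p)))"
    using c h by (simp add: charts_at_iff chart_inv_chart)
  have 2: "((\<lambda>x. (h \<circ> chart_inv c') ((snd c' \<circ> chart_inv c) x)) has_derivative
      (\<lambda>v. h' (jac c c' p v))) (at (snd c p))"
    by (rule has_derivative_compose[OF jac_derivative[OF c] 1])
  show ?thesis
  proof (rule has_derivative_transform_within_open[OF 2])
    show "open (snd c ` (fst c \<inter> fst c'))"
      using c by (intro open_chart_image open_chart) (auto simp: charts_at_iff)
    show "snd c p \<in> snd c ` (fst c \<inter> fst c')"
      using c by (auto simp: charts_at_iff)
  qed (use c in \<open>auto simp: charts_at_iff chart_inv_chart\<close>)
qed

lemma jac_compose:
  assumes "c \<in> charts_at A p" "c' \<in> charts_at A p" "c'' \<in> charts_at A p"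
  shows "jac c' c'' p (jac c c' p v) = jac c c'' p v"
  using has_derivative_unique[OF chart_change_derivative[OF assms(1,2) jac_derivative[OF assms(2,3)]]
      jac_derivative[OF assms(1,3)]]
  by (rule fun_cong)

lemma jac_same:
  assumes "c \<in> charts_at A p"
  shows "jac c c p v = v"
proof -
  have "((snd c \<circ> chart_inv c) has_derivative (\<lambda>v. v)) (at (snd c p))"
  proof (rule has_derivative_transform_within_open[OF has_derivative_ident])
    show "open (snd c ` (fst c \<inter> UNIV))"
      using assms by (intro open_chart_image) (auto simp: charts_at_iff)
  qed (use assms in \<open>auto simp: charts_at_iff chart_inv_chart\<close>)
  from has_derivative_unique[OF jac_derivative[OF assms assms] this] show ?thesis
    by simp
qed

lemma tangent_space_iff:
  "v \<in> T p \<longleftrightarrow> (\<forall>c\<in>charts_at A p. \<forall>c'\<in>charts_at A p. v c' = jac c c' p (v c)) \<and>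
    (\<forall>c. c \<notin> charts_at A p \<longrightarrow> v c = 0)"
  by (simp add: tangent_space_def jac_def)

lemma tangent_spaceD:
  "v \<in> T p \<Longrightarrow> c \<in> charts_at A p \<Longrightarrow> c' \<in> charts_at A p \<Longrightarrow> v c' = jac c c' p (v c)"
  unfolding tangent_space_iff by blast

lemma tangent_spaceI:
  assumes "\<And>c c'. c \<in> charts_at A p \<Longrightarrow> c' \<in> charts_at A p \<Longrightarrow> v c' = jac c c' p (v c)"
    and "\<And>c. c \<notin> charts_at A p \<Longrightarrow> v c = 0"
  shows "v \<in> T p"
  unfolding tangent_space_iff using assms by blast

lemma tangent_space_outside: "v \<in> T p \<Longrightarrow> c \<notin> charts_at A p \<Longrightarrow> v c = 0"
  unfolding tangent_space_iff by blast

lemma tangent_eqI: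
  assumes "v \<in> T p" "w \<in> T p" "c \<in> charts_at A p" "v c = w c"
  shows "v = w"
proof
  fix c'
  show "v c' = w c'"
  proof (cases "c' \<in> charts_at A p")
    case True
    from tangent_spaceD[OF assms(1,3) this] tangent_spaceD[OF assms(2,3) this] assms(4)
    show ?thesis
      by (simp only:)
  next
    case False
    with assms(1,2) show ?thesis
      unfolding tangent_space_iff by (metis (no_types))
  qed
qed

text \<open>The family \<open>jac c c' p b\<close>, with \<open>c'\<close> ranging over the charts
  at \<open>p\<close>, is compatible by the cocycle rule, and a single component determines a
  tangent vector. Hence the definite description in \<open>coord_vec\<close> is proper.\<close>

lemma coord_vec:
  assumes c: "c \<in> charts_at A p"
  shows coord_vec_tangent: "coord_vec A c p b \<in> T p" and coord_vec_chart: "coord_vec A c p b c = b"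
proof -
  define v where "v c' = (if c' \<in> charts_at A p then jac c c' p b else 0)" for c'
  have "v \<in> T p \<and> v c = b"
    using c by (auto simp: tangent_space_iff v_def jac_same jac_compose)
  moreover have "w = v" if "w \<in> T p \<and> w c = b" for w
    using that calculation tangent_eqI[OF _ _ c] by blast
  ultimately have "\<exists>!v. v \<in> T p \<and> v c = b"
    by blast
  from theI'[OF this] show "coord_vec A c p b \<in> T p" "coord_vec A c p b c = b"
    by (auto simp: coord_vec_def)
qed

lemma coord_vec_component: "c \<in> charts_at A p \<Longrightarrow> v \<in> T p \<Longrightarrow> coord_vec A c p (v c) = v"
  using tangent_eqI coord_vec by metis

lemma tangent_zero [simp]: "0 \<in> T p"
  using linear_jac by (auto simp: tangent_space_iff linear_0)

lemma tangent_add [simp]: "v \<in> T p \<Longrightarrow> w \<in> T p \<Longrightarrow> v + w \<in> T p"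
  by (rule tangent_spaceI)
    (simp_all add: linear_add[OF linear_jac] tangent_spaceD[symmetric] tangent_space_outside)

lemma tangent_scaleR [simp]: "v \<in> T p \<Longrightarrow> a *\<^sub>R v \<in> T p"
  by (rule tangent_spaceI)
    (simp_all add: linear_scale[OF linear_jac] tangent_spaceD[symmetric] tangent_space_outside)

lemma tangent_minus [simp]: "v \<in> T p \<Longrightarrow> - v \<in> T p"
  using tangent_scaleR[of v p "-1"] by simp

lemma tangent_diff [simp]: "v \<in> T p \<Longrightarrow> w \<in> T p \<Longrightarrow> v - w \<in> T p"
  using tangent_add[of v p "- w"] by simp

lemma tangent_sum: "(\<And>i. i \<in> I \<Longrightarrow> v i \<in> T p) \<Longrightarrow> (\<Sum>i\<in>I. v i) \<in> T p"
  by (induction I rule: infinite_finite_induct) auto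

lemma tangent_Basis_expand:
  assumes c: "c \<in> charts_at A p" and v: "v \<in> T p"
  shows "v = (\<Sum>b\<in>Basis. (v c \<bullet> b) *\<^sub>R coord_vec A c p b)"
proof (rule tangent_eqI[OF v _ c])
  show "(\<Sum>b\<in>Basis. (v c \<bullet> b) *\<^sub>R coord_vec A c p b) \<in> T p"
    by (intro tangent_sum tangent_scaleR coord_vec_tangent c)
  show "v c = (\<Sum>b\<in>Basis. (v c \<bullet> b) *\<^sub>R coord_vec A c p b) c"
    by (simp add: sum_fun_apply coord_vec_chart[OF c] euclidean_representation)
qed


subsection \<open>Smooth functions and vector fields\<close>

lemma smooth_fun_subset: "smooth_fun A U h \<Longrightarrow> V \<subseteq> U \<Longrightarrow> smooth_fun A V h"
  unfolding smooth_fun_def smooth_on_def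
  by (meson Ck_on_subset Int_mono image_mono order_refl)

lemma smooth_vf_subset: "smooth_vf A U X \<Longrightarrow> V \<subseteq> U \<Longrightarrow> smooth_vf A V X"
  unfolding smooth_vf_def smooth_on_def
  by (meson Ck_on_subset Int_mono image_mono order_refl subsetD)

lemma smooth_fun_cong:
  assumes "open U" "\<And>q. q \<in> U \<Longrightarrow> h q = h' q" "smooth_fun A U h"
  shows "smooth_fun A U h'"
  unfolding smooth_fun_def
proof
  fix c assume c: "c \<in> A"
  show "smooth_on (snd c ` (fst c \<inter> U)) (h' \<circ> chart_inv c)"
  proof (rule smooth_on_cong[OF open_chart_image[OF c assms(1)]])
    show "smooth_on (snd c ` (fst c \<inter> U)) (h \<circ> chart_inv c)"
      using assms(3) c by (simp add: smooth_fun_def)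
  qed (use assms(2) chart_inv_chart[OF c] in force)
qed

lemma smooth_vf_cong:
  assumes "open U" "\<And>q. q \<in> U \<Longrightarrow> X q = Y q" "smooth_vf A U X"
  shows "smooth_vf A U Y"
  unfolding smooth_vf_def
proof safe
  show "Y q \<in> T q" if "q \<in> U" for q
    using assms(2)[OF that] assms(3) that by (auto simp: smooth_vf_def)
next
  fix a b assume c: "(a, b) \<in> A"
  show "smooth_on (snd (a, b) ` (fst (a, b) \<inter> U)) (\<lambda>x. Y (chart_inv (a, b) x) (a, b))"
  proof (rule smooth_on_cong[OF open_chart_image[OF c assms(1)]])
    show "smooth_on (snd (a, b) ` (fst (a, b) \<inter> U)) (\<lambda>x. X (chart_inv (a, b) x) (a, b))"
      using assms(3) c unfolding smooth_vf_def by blast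
  qed (use assms(2) chart_inv_chart[OF c] in force)
qed

lemma smooth_fun_const: "smooth_fun A U (\<lambda>q. a)"
  by (simp add: smooth_fun_def smooth_on_def Ck_on_const comp_def)

lemma smooth_fun_add:
  "open U \<Longrightarrow> smooth_fun A U h \<Longrightarrow> smooth_fun A U k \<Longrightarrow> smooth_fun A U (\<lambda>q. h q + k q)"
  unfolding smooth_fun_def smooth_on_def comp_def
  using Ck_on_add open_chart_image by blast

lemma smooth_fun_mult:
  "open U \<Longrightarrow> smooth_fun A U h \<Longrightarrow> smooth_fun A U k \<Longrightarrow> smooth_fun A U (\<lambda>q. h q * k q)"
  unfolding smooth_fun_def smooth_on_def comp_def
  using Ck_on_bilinear[OF bounded_bilinear_mult] open_chart_image by blast

lemma smooth_fun_inverse: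
  assumes "open U" "\<And>q. q \<in> U \<Longrightarrow> h q \<noteq> 0" "smooth_fun A U h"
  shows "smooth_fun A U (\<lambda>q. inverse (h q))"
  unfolding smooth_fun_def smooth_on_def comp_def
proof (intro ballI allI)
  fix c k assume "c \<in> A"
  with assms show "Ck_on k (snd c ` (fst c \<inter> U)) (\<lambda>x. inverse (h (chart_inv c x)))"
    by (intro Ck_on_inverse)
      (auto simp: open_chart_image chart_inv_chart smooth_fun_def smooth_on_def comp_def)
qed

lemma smooth_fun_sqrt:
  assumes "open U" "\<And>q. q \<in> U \<Longrightarrow> h q > 0" "smooth_fun A U h"
  shows "smooth_fun A U (\<lambda>q. sqrt (h q))"
  unfolding smooth_fun_def smooth_on_def comp_def
proof (intro ballI allI)
  fix c k assume "c \<in> A"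
  with assms show "Ck_on k (snd c ` (fst c \<inter> U)) (\<lambda>x. sqrt (h (chart_inv c x)))"
    by (intro Ck_on_sqrt)
      (auto simp: open_chart_image chart_inv_chart smooth_fun_def smooth_on_def comp_def)
qed

lemma smooth_vf_zero: "smooth_vf A U (\<lambda>q. 0)"
  by (simp add: smooth_vf_def smooth_on_def Ck_on_const)

lemma smooth_vf_add:
  assumes "open U" "smooth_vf A U X" "smooth_vf A U Y"
  shows "smooth_vf A U (\<lambda>q. X q + Y q)"
  unfolding smooth_vf_def smooth_on_def
proof (intro conjI ballI allI)
  fix c k assume c: "c \<in> A"
  show "Ck_on k (snd c ` (fst c \<inter> U)) (\<lambda>x. (X (chart_inv c x) + Y (chart_inv c x)) c)"
    unfolding plus_fun_apply using assms(2,3) c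
    by (intro Ck_on_add open_chart_image assms(1) smooth_onD) (auto simp: smooth_vf_def)
qed (use assms in \<open>auto simp: smooth_vf_def simp del: plus_fun_apply\<close>)

lemma smooth_vf_scaleR:
  assumes "open U" "smooth_fun A U h" "smooth_vf A U X"
  shows "smooth_vf A U (\<lambda>q. h q *\<^sub>R X q)"
  unfolding smooth_vf_def smooth_on_def
proof (intro conjI ballI allI)
  fix c k assume c: "c \<in> A"
  show "Ck_on k (snd c ` (fst c \<inter> U)) (\<lambda>x. (h (chart_inv c x) *\<^sub>R X (chart_inv c x)) c)"
    unfolding scaleR_fun_apply using assms(2,3) c
    by (intro Ck_on_bilinear[OF bounded_bilinear_scaleR] open_chart_image assms(1) smooth_onD)
      (auto simp: smooth_vf_def smooth_fun_def comp_def)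
qed (use assms in \<open>auto simp: smooth_vf_def simp del: scaleR_fun_apply\<close>)

text \<open>In another chart the components are the derivative of the coordinate change applied to
  the components in \<open>c\<close>, all composed with the inverse change. So smoothness need be
  checked in one chart covering \<open>U\<close>.\<close>

lemma smooth_vf_chartI:
  assumes c: "c \<in> A" and U: "open U" "U \<subseteq> fst c"
    and X: "\<And>q. q \<in> U \<Longrightarrow> X q \<in> T q" "smooth_on (snd c ` U) (\<lambda>x. X (chart_inv c x) c)"
  shows "smooth_vf A U X"
  unfolding smooth_vf_def smooth_on_def
proof (intro conjI ballI allI)
  fix c' k assume c': "c' \<in> A"
  define \<tau> where "\<tau> = snd c \<circ> chart_inv c'"
  define F where "F x = frechet_derivative (snd c' \<circ> chart_inv c) (at x) (X (chart_inv c x) c)" for x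
  have o: "open (snd c ` (fst c \<inter> (fst c' \<inter> U)))" "open (snd c' ` (fst c' \<inter> U))"
    using c c' U by (auto intro!: open_chart_image open_chart)
  have sub: "snd c ` (fst c \<inter> (fst c' \<inter> U)) \<subseteq> snd c ` U"
    "snd c ` (fst c \<inter> (fst c' \<inter> U)) \<subseteq> snd c ` (fst c \<inter> fst c')"
    "snd c' ` (fst c' \<inter> U) \<subseteq> snd c' ` (fst c' \<inter> fst c)"
    using U by auto
  have F: "Ck_on k (snd c ` (fst c \<inter> (fst c' \<inter> U))) F"
    unfolding F_def
  proof (rule Ck_on_frechet_derivative[OF o(1)])
    show "Ck_on (Suc k) (snd c ` (fst c \<inter> (fst c' \<inter> U))) (snd c' \<circ> chart_inv c)"
      by (rule Ck_on_subset[OF smooth_onD[OF smooth_transition[OF c c']] sub(2)])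
    show "Ck_on k (snd c ` (fst c \<inter> (fst c' \<inter> U))) (\<lambda>x. X (chart_inv c x) c)"
      by (rule Ck_on_subset[OF smooth_onD[OF X(2)] sub(1)])
  qed
  have "Ck_on k (snd c' ` (fst c' \<inter> U)) (\<lambda>x. F (\<tau> x))"
  proof (rule Ck_on_compose[OF o(2,1) _ F])
    show "Ck_on k (snd c' ` (fst c' \<inter> U)) \<tau>"
      unfolding \<tau>_def by (rule Ck_on_subset[OF smooth_onD[OF smooth_transition[OF c' c]] sub(3)])
    show "\<tau> ` (snd c' ` (fst c' \<inter> U)) \<subseteq> snd c ` (fst c \<inter> (fst c' \<inter> U))"
      using U c c' by (auto simp: \<tau>_def chart_inv_chart)
  qed
  then show "Ck_on k (snd c' ` (fst c' \<inter> U)) (\<lambda>x. X (chart_inv c' x) c')"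
  proof (rule Ck_on_cong[OF o(2), rotated])
    show "F (\<tau> x) = X (chart_inv c' x) c'" if x: "x \<in> snd c' ` (fst c' \<inter> U)" for x
  proof -
    obtain q where q: "q \<in> fst c'" "q \<in> U" "x = snd c' q"
      using x by auto
    then have "X q c' = jac c c' q (X q c)"
      using U c c' X(1) by (intro tangent_spaceD) (auto simp: charts_at_iff)
    then show ?thesis
      using q U c c' by (auto simp: F_def \<tau>_def chart_inv_chart jac_def)
  qed
  qed
qed (use X in auto)

lemma smooth_coord_vec: "c \<in> A \<Longrightarrow> smooth_vf A (fst c) (\<lambda>q. coord_vec A c q b)"
proof (rule smooth_vf_chartI[of c])
  assume c: "c \<in> A"
  have "open (snd c ` fst c)"
    using open_chart_image[OF c open_UNIV] by simp
  then show "smooth_on (snd c ` fst c) (\<lambda>x. coord_vec A c (chart_inv c x) b c)"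
    by (rule smooth_on_cong[of _ "\<lambda>x. b"])
      (use c in \<open>auto simp: chart_inv_chart coord_vec_chart charts_at_iff smooth_on_def Ck_on_const\<close>)
qed (auto simp: open_chart coord_vec_tangent charts_at_iff)

lemma smooth_coord: "c \<in> A \<Longrightarrow> smooth_fun A (fst c) (\<lambda>q. snd c q \<bullet> b)"
  unfolding smooth_fun_def smooth_on_def comp_def
proof (intro ballI allI)
  fix c' k assume c: "c \<in> A" "c' \<in> A"
  show "Ck_on k (snd c' ` (fst c' \<inter> fst c)) (\<lambda>x. snd c (chart_inv c' x) \<bullet> b)"
    by (rule Ck_on_bounded_linear[OF bounded_linear_inner_left open_chart_image[OF c(2) open_chart[OF c(1)]]
          smooth_onD[OF smooth_transition[OF c(2,1)], unfolded comp_def]])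
qed

lemma eventually_nhds_Int:
  assumes "open U" "p \<in> U" "\<forall>\<^sub>F q in nhds p. P q"
  obtains V where "open V" "p \<in> V" "V \<subseteq> U" "\<And>q. q \<in> V \<Longrightarrow> P q"
proof -
  obtain W where "open W" "p \<in> W" "\<forall>q\<in>W. P q"
    using assms(3) by (auto simp: eventually_nhds)
  then show thesis
    using assms that[of "U \<inter> W"] by auto
qed

text \<open>The field with constant components in a chart at \<open>p\<close> is smooth on the chart
  domain, which is all that \<open>smooth_vf_near\<close> asks for; it witnesses the choice in
  \<open>vf_extension\<close>.\<close>

lemma smooth_vf_extension:
  assumes "v \<in> T p"
  shows "smooth_vf_at p (vf_extension A p v)" "vf_extension A p v p = v"
proof -
  define c where "c = chart_at A p"
  have c: "c \<in> charts_at A p" "c \<in> A" "p \<in> fst c"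
    using chart_at_in[of p] by (auto simp: c_def charts_at_iff)
  have "smooth_vf_at p (\<lambda>q. coord_vec A c q (v c)) \<and> coord_vec A c p (v c) = v"
    using smooth_coord_vec[OF c(2)] open_chart[OF c(2)] c coord_vec_component[OF c(1) assms]
    by (auto simp: smooth_vf_near_def)
  then have "\<exists>X. smooth_vf_at p X \<and> X p = v"
    by (intro exI) auto
  from someI_ex[OF this] show "smooth_vf_at p (vf_extension A p v)" "vf_extension A p v p = v"
    by (auto simp: vf_extension_def)
qed

lemma smooth_at_const: "smooth_at p (\<lambda>q. a)"
  unfolding smooth_fun_near_def using smooth_fun_const open_UNIV by blast

lemma smooth_at_add:
  assumes "smooth_at p h" "smooth_at p k"
  shows "smooth_at p (\<lambda>q. h q + k q)"
proof -
  obtain U V where "open U" "p \<in> U" "smooth_fun A U h" "open V" "p \<in> V" "smooth_fun A V k"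
    using assms by (auto simp: smooth_fun_near_def)
  then have "smooth_fun A (U \<inter> V) (\<lambda>q. h q + k q)"
    by (intro smooth_fun_add) (auto intro: smooth_fun_subset)
  then show ?thesis
    unfolding smooth_fun_near_def using \<open>open U\<close> \<open>open V\<close> \<open>p \<in> U\<close> \<open>p \<in> V\<close> by blast
qed

lemma smooth_at_mult:
  assumes "smooth_at p h" "smooth_at p k"
  shows "smooth_at p (\<lambda>q. h q * k q)"
proof -
  obtain U V where "open U" "p \<in> U" "smooth_fun A U h" "open V" "p \<in> V" "smooth_fun A V k"
    using assms by (auto simp: smooth_fun_near_def)
  then have "smooth_fun A (U \<inter> V) (\<lambda>q. h q * k q)"
    by (intro smooth_fun_mult) (auto intro: smooth_fun_subset)
  then show ?thesis
    unfolding smooth_fun_near_def using \<open>open U\<close> \<open>open V\<close> \<open>p \<in> U\<close> \<open>p \<in> V\<close> by blast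
qed

lemma smooth_at_minus: "smooth_at p h \<Longrightarrow> smooth_at p (\<lambda>q. - h q)"
  using smooth_at_mult[OF smooth_at_const[of p "-1"], of h] by simp

lemma smooth_at_diff: "smooth_at p h \<Longrightarrow> smooth_at p k \<Longrightarrow> smooth_at p (\<lambda>q. h q - k q)"
  using smooth_at_add[OF _ smooth_at_minus, of p h k] by simp

lemma smooth_at_sum:
  "(\<And>i. i \<in> I \<Longrightarrow> smooth_at p (h i)) \<Longrightarrow> smooth_at p (\<lambda>q. \<Sum>i\<in>I. h i q)"
  by (induction I rule: infinite_finite_induct) (auto intro: smooth_at_const smooth_at_add)

lemma smooth_vf_at_add:
  assumes "smooth_vf_at p X" "smooth_vf_at p Y"
  shows "smooth_vf_at p (\<lambda>q. X q + Y q)"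
proof -
  obtain U V where "open U" "p \<in> U" "smooth_vf A U X" "open V" "p \<in> V" "smooth_vf A V Y"
    using assms by (auto simp: smooth_vf_near_def)
  then have "smooth_vf A (U \<inter> V) (\<lambda>q. X q + Y q)"
    by (intro smooth_vf_add) (auto intro: smooth_vf_subset)
  then show ?thesis
    unfolding smooth_vf_near_def using \<open>open U\<close> \<open>open V\<close> \<open>p \<in> U\<close> \<open>p \<in> V\<close> by blast
qed

lemma smooth_vf_at_scaleR:
  assumes "smooth_at p h" "smooth_vf_at p Y"
  shows "smooth_vf_at p (\<lambda>q. h q *\<^sub>R Y q)"
proof -
  obtain U V where "open U" "p \<in> U" "smooth_fun A U h" "open V" "p \<in> V" "smooth_vf A V Y"
    using assms by (auto simp: smooth_vf_near_def smooth_fun_near_def)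
  then have "smooth_vf A (U \<inter> V) (\<lambda>q. h q *\<^sub>R Y q)"
    by (intro smooth_vf_scaleR) (auto intro: smooth_vf_subset smooth_fun_subset)
  then show ?thesis
    unfolding smooth_vf_near_def using \<open>open U\<close> \<open>open V\<close> \<open>p \<in> U\<close> \<open>p \<in> V\<close> by blast
qed

lemma smooth_vf_at_zero: "smooth_vf_at p (\<lambda>q. 0)"
  unfolding smooth_vf_near_def using smooth_vf_zero open_UNIV by blast

lemma smooth_vf_at_cmult: "smooth_vf_at p X \<Longrightarrow> smooth_vf_at p (\<lambda>q. a *\<^sub>R X q)"
  using smooth_vf_at_scaleR[OF smooth_at_const] .

lemma smooth_vf_at_minus: "smooth_vf_at p X \<Longrightarrow> smooth_vf_at p (\<lambda>q. - X q)"
  using smooth_vf_at_cmult[of p X "-1"] by simp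

lemma smooth_vf_at_diff:
  "smooth_vf_at p X \<Longrightarrow> smooth_vf_at p Y \<Longrightarrow> smooth_vf_at p (\<lambda>q. X q - Y q)"
  using smooth_vf_at_add[OF _ smooth_vf_at_minus, of p X Y] by simp

lemma smooth_vf_at_sum:
  "(\<And>i. i \<in> I \<Longrightarrow> smooth_vf_at p (X i)) \<Longrightarrow> smooth_vf_at p (\<lambda>q. \<Sum>i\<in>I. X i q)"
  by (induction I rule: infinite_finite_induct) (auto intro: smooth_vf_at_zero smooth_vf_at_add)

lemma smooth_at_eventually: "smooth_at p h \<Longrightarrow> \<forall>\<^sub>F q in nhds p. smooth_at q h"
  unfolding smooth_fun_near_def eventually_nhds by blast

lemma smooth_vf_at_eventually: "smooth_vf_at p X \<Longrightarrow> \<forall>\<^sub>F q in nhds p. smooth_vf_at q X"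
  unfolding smooth_vf_near_def eventually_nhds by blast

lemma smooth_at_cong:
  assumes "smooth_at p h" "\<forall>\<^sub>F q in nhds p. k q = h q"
  shows "smooth_at p k"
proof -
  obtain U where U: "open U" "p \<in> U" "smooth_fun A U h"
    using assms by (auto simp: smooth_fun_near_def)
  obtain V where "open V" "p \<in> V" "V \<subseteq> U" "\<And>q. q \<in> V \<Longrightarrow> k q = h q"
    using eventually_nhds_Int[OF U(1,2) assms(2)] by blast
  then show ?thesis
    unfolding smooth_fun_near_def using smooth_fun_cong[of V h k] smooth_fun_subset[OF U(3)] by auto
qed

lemma smooth_vf_at_cong:
  assumes "smooth_vf_at p X" "\<forall>\<^sub>F q in nhds p. Y q = X q"
  shows "smooth_vf_at p Y"
proof -
  obtain U where U: "open U" "p \<in> U" "smooth_vf A U X"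
    using assms by (auto simp: smooth_vf_near_def)
  obtain V where "open V" "p \<in> V" "V \<subseteq> U" "\<And>q. q \<in> V \<Longrightarrow> Y q = X q"
    using eventually_nhds_Int[OF U(1,2) assms(2)] by blast
  then show ?thesis
    unfolding smooth_vf_near_def using smooth_vf_cong[of V X Y] smooth_vf_subset[OF U(3)] by auto
qed

lemma smooth_vf_at_tangent: "smooth_vf_at p X \<Longrightarrow> X p \<in> T p"
  by (auto simp: smooth_vf_near_def smooth_vf_def)

lemma smooth_coord_at: "c \<in> charts_at A p \<Longrightarrow> smooth_at p (\<lambda>q. snd c q \<bullet> b)"
  unfolding smooth_fun_near_def charts_at_iff using smooth_coord open_chart by blast


subsection \<open>Directional derivatives and the Lie bracket\<close>

lemma smooth_at_derivative:
  assumes "smooth_at p h" "c \<in> charts_at A p"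
  shows "((h \<circ> chart_inv c) has_derivative frechet_derivative (h \<circ> chart_inv c) (at (snd c p)))
    (at (snd c p))"
  using assms smooth_on_derivative unfolding smooth_fun_near_def smooth_fun_def charts_at_iff
  by (metis Int_iff imageI)

text \<open>The Jacobian in the chain rule for \<open>h\<close> is the one by which the components
  of \<open>v\<close> transform, so the chart picked by \<open>chart_at\<close> can be exchanged for
  any other.\<close>

lemma dir_deriv_chart:
  assumes h: "smooth_at p h" and v: "v \<in> T p" and c: "c \<in> charts_at A p"
  shows "dir_deriv A p v h = frechet_derivative (h \<circ> chart_inv c) (at (snd c p)) (v c)"
proof -
  have "frechet_derivative (h \<circ> chart_inv (chart_at A p)) (at (snd (chart_at A p) p)) =
    (\<lambda>v. frechet_derivative (h \<circ> chart_inv c) (at (snd c p)) (jac (chart_at A p) c p v))"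
    using frechet_derivative_at[OF chart_change_derivative[OF chart_at_in c smooth_at_derivative[OF h c]]]
    by simp
  then show ?thesis
    using tangent_spaceD[OF v chart_at_in c] by (simp add: dir_deriv_def)
qed

lemma dir_deriv_eqI:
  assumes "((h \<circ> chart_inv (chart_at A p)) has_derivative h') (at (snd (chart_at A p) p))"
  shows "dir_deriv A p v h = h' (v (chart_at A p))"
  unfolding dir_deriv_def by (simp add: frechet_derivative_at[OF assms, symmetric])

lemma dir_deriv_works:
  assumes "smooth_at p h"
  shows "((h \<circ> chart_inv (chart_at A p)) has_derivative
    frechet_derivative (h \<circ> chart_inv (chart_at A p)) (at (snd (chart_at A p) p)))
    (at (snd (chart_at A p) p))"
  using smooth_at_derivative[OF assms chart_at_in] .

lemma dir_deriv_const: "dir_deriv A p v (\<lambda>q. a) = 0"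
  by (simp add: dir_deriv_def comp_def)

lemma dir_deriv_add:
  assumes "smooth_at p h" "smooth_at p k"
  shows "dir_deriv A p v (\<lambda>q. h q + k q) = dir_deriv A p v h + dir_deriv A p v k"
  using dir_deriv_eqI[of "\<lambda>q. h q + k q"] has_derivative_add[OF assms[THEN dir_deriv_works]]
  by (simp add: comp_def dir_deriv_def)

lemma dir_deriv_mult:
  assumes "smooth_at p h" "smooth_at p k"
  shows "dir_deriv A p v (\<lambda>q. h q * k q) = h p * dir_deriv A p v k + dir_deriv A p v h * k p"
  using dir_deriv_eqI[of "\<lambda>q. h q * k q"] has_derivative_mult[OF assms[THEN dir_deriv_works]]
    chart_at_in[of p]
  by (simp add: comp_def dir_deriv_def charts_at_iff chart_inv_chart)

lemma dir_deriv_minus: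
  assumes "smooth_at p h"
  shows "dir_deriv A p v (\<lambda>q. - h q) = - dir_deriv A p v h"
  using dir_deriv_mult[OF smooth_at_const[of p "-1"] assms] by (simp add: dir_deriv_const)

lemma dir_deriv_diff:
  assumes "smooth_at p h" "smooth_at p k"
  shows "dir_deriv A p v (\<lambda>q. h q - k q) = dir_deriv A p v h - dir_deriv A p v k"
  using dir_deriv_add[OF assms(1) smooth_at_minus[OF assms(2)]] dir_deriv_minus[OF assms(2)] by simp

lemma dir_deriv_sum:
  assumes "finite I" "\<And>i. i \<in> I \<Longrightarrow> smooth_at p (h i)"
  shows "dir_deriv A p v (\<lambda>q. \<Sum>i\<in>I. h i q) = (\<Sum>i\<in>I. dir_deriv A p v (h i))"
  using assms
  by (induction I rule: finite_induct) (auto simp: dir_deriv_const dir_deriv_add smooth_at_sum)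

lemma dir_deriv_cong:
  assumes "smooth_at p h" "\<forall>\<^sub>F q in nhds p. k q = h q"
  shows "dir_deriv A p v k = dir_deriv A p v h"
proof -
  have c: "chart_at A p \<in> A" "p \<in> fst (chart_at A p)"
    using chart_at_in[of p] by (auto simp: charts_at_iff)
  obtain U where U: "open U" "p \<in> U" "U \<subseteq> fst (chart_at A p)" "\<And>q. q \<in> U \<Longrightarrow> k q = h q"
    using eventually_nhds_Int[OF open_chart[OF c(1)] c(2) assms(2)] by blast
  have "((k \<circ> chart_inv (chart_at A p)) has_derivative
      frechet_derivative (h \<circ> chart_inv (chart_at A p)) (at (snd (chart_at A p) p)))
      (at (snd (chart_at A p) p))"
  proof (rule has_derivative_transform_within_open[OF dir_deriv_works[OF assms(1)]])
    show "open (snd (chart_at A p) ` (fst (chart_at A p) \<inter> U))"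
      using open_chart_image[OF c(1) U(1)] .
  qed (use U c in \<open>auto simp: chart_inv_chart\<close>)
  then show ?thesis
    using dir_deriv_eqI by (simp add: dir_deriv_def)
qed

lemma linear_dir_deriv:
  assumes "smooth_at p h"
  shows "linear (\<lambda>v. dir_deriv A p v h)"
proof -
  interpret linear "frechet_derivative (h \<circ> chart_inv (chart_at A p)) (at (snd (chart_at A p) p))"
    using dir_deriv_works[OF assms] has_derivative_linear by blast
  show ?thesis
    by (rule linearI) (simp_all add: dir_deriv_def add scaleR)
qed

lemma dir_deriv_coord:
  assumes "c \<in> charts_at A p" "v \<in> T p"
  shows "dir_deriv A p v (\<lambda>q. snd c q \<bullet> b) = v c \<bullet> b"
proof -
  have "((\<lambda>x. (snd c \<circ> chart_inv c) x \<bullet> b) has_derivative (\<lambda>v. jac c c p v \<bullet> b)) (at (snd c p))"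
    by (rule has_derivative_inner_left[OF jac_derivative[OF assms(1,1)]])
  moreover have "(\<lambda>q. snd c q \<bullet> b) \<circ> chart_inv c = (\<lambda>x. (snd c \<circ> chart_inv c) x \<bullet> b)"
    by (simp add: comp_def)
  ultimately show ?thesis
    unfolding dir_deriv_chart[OF smooth_coord_at[OF assms(1), of b] assms(2,1)]
    by (metis frechet_derivative_at jac_same[OF assms(1)])
qed

text \<open>The derivatives of the coordinate functions are the components of the vector. This gives
  the uniqueness in the definition of the Lie bracket.\<close>

lemma tangent_eq_dir_derivI:
  assumes "v \<in> T p" "w \<in> T p" "\<And>h. smooth_at p h \<Longrightarrow> dir_deriv A p v h = dir_deriv A p w h"
  shows "v = w"
proof (rule tangent_eqI[OF assms(1,2) chart_at_in])
  show "v (chart_at A p) = w (chart_at A p)"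
    using assms(3)[OF smooth_coord_at[OF chart_at_in]] dir_deriv_coord[OF chart_at_in] assms(1,2)
    by (metis euclidean_eqI)
qed

text \<open>\<open>chart_at A q\<close> may jump with \<open>q\<close>, so \<open>dir_deriv\<close>
  is first rewritten in one fixed chart by \<open>dir_deriv_chart\<close>.\<close>

lemma smooth_dir_deriv:
  assumes U: "open U" and X: "smooth_vf A U X" and h: "smooth_fun A U h"
  shows "smooth_fun A U (\<lambda>q. dir_deriv A q (X q) h)"
  unfolding smooth_fun_def smooth_on_def
proof (intro ballI allI)
  fix c k assume c: "c \<in> A"
  have o: "open (snd c ` (fst c \<inter> U))"
    using open_chart_image[OF c U] .
  show "Ck_on k (snd c ` (fst c \<inter> U)) ((\<lambda>q. dir_deriv A q (X q) h) \<circ> chart_inv c)"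
  proof (rule Ck_on_cong[OF o])
    show "Ck_on k (snd c ` (fst c \<inter> U))
        (\<lambda>x. frechet_derivative (h \<circ> chart_inv c) (at x) (X (chart_inv c x) c))"
      using X h c unfolding smooth_fun_def smooth_vf_def
      by (intro Ck_on_frechet_derivative[OF o] smooth_onD) auto
  next
    fix x assume "x \<in> snd c ` (fst c \<inter> U)"
    then obtain q where q: "q \<in> fst c" "q \<in> U" "x = snd c q" by auto
    have "dir_deriv A q (X q) h = frechet_derivative (h \<circ> chart_inv c) (at (snd c q)) (X q c)"
      using q U X h c by (intro dir_deriv_chart) (auto simp: smooth_fun_near_def smooth_vf_def charts_at_iff)
    then show "frechet_derivative (h \<circ> chart_inv c) (at x) (X (chart_inv c x) c) =
        ((\<lambda>q. dir_deriv A q (X q) h) \<circ> chart_inv c) x"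
      using q c by (simp add: chart_inv_chart)
  qed
qed

lemma smooth_at_dir_deriv:
  assumes "smooth_vf_at p X" "smooth_at p h"
  shows "smooth_at p (\<lambda>q. dir_deriv A q (X q) h)"
proof -
  obtain U V where "open U" "p \<in> U" "smooth_vf A U X" "open V" "p \<in> V" "smooth_fun A V h"
    using assms by (auto simp: smooth_vf_near_def smooth_fun_near_def)
  then have "smooth_fun A (U \<inter> V) (\<lambda>q. dir_deriv A q (X q) h)"
    by (intro smooth_dir_deriv) (auto intro: smooth_vf_subset smooth_fun_subset)
  then show ?thesis
    unfolding smooth_fun_near_def using \<open>open U\<close> \<open>open V\<close> \<open>p \<in> U\<close> \<open>p \<in> V\<close> by blast
qed

text \<open>The product rule in coordinates splits the iterated derivative into a first-order term,
  where \<open>Y\<close> is differentiated, and a Hessian term, where \<open>h\<close> is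
  differentiated twice.\<close>

lemma second_dir_deriv_chart:
  assumes X: "smooth_vf_at p X" and Y: "smooth_vf_at p Y" and h: "smooth_at p h"
    and c: "c \<in> charts_at A p"
  shows "dir_deriv A p (X p) (\<lambda>q. dir_deriv A q (Y q) h) =
    frechet_derivative (h \<circ> chart_inv c) (at (snd c p))
      (frechet_derivative (\<lambda>x. Y (chart_inv c x) c) (at (snd c p)) (X p c)) +
    (\<Sum>b\<in>Basis. \<Sum>d\<in>Basis. (Y p c \<bullet> b) * (X p c \<bullet> d) *
      frechet_derivative (\<lambda>x. frechet_derivative (h \<circ> chart_inv c) (at x) b) (at (snd c p)) d)"
proof -
  define H where "H = h \<circ> chart_inv c"
  define \<eta> where "\<eta> = (\<lambda>x. Y (chart_inv c x) c)"
  define x0 where "x0 = snd c p"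
  obtain U where U: "open U" "p \<in> U" "smooth_vf A U Y" "smooth_fun A U h"
  proof -
    obtain V W where "open V" "p \<in> V" "smooth_vf A V Y" "open W" "p \<in> W" "smooth_fun A W h"
      using Y h by (auto simp: smooth_vf_near_def smooth_fun_near_def)
    then show thesis
      using that[of "V \<inter> W"] smooth_vf_subset[of V Y] smooth_fun_subset[of W h] by auto
  qed
  define S where "S = snd c ` (fst c \<inter> U)"
  have cA: "c \<in> A" and p: "p \<in> fst c"
    using c by (auto simp: charts_at_iff)
  have S: "open S" "x0 \<in> S"
    using open_chart_image[OF cA U(1)] p U(2) by (auto simp: S_def x0_def)
  have H: "smooth_on S H" and \<eta>: "smooth_on S \<eta>"
    using U cA by (auto simp: smooth_fun_def smooth_vf_def H_def \<eta>_def S_def)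
  have dH: "((\<lambda>x. frechet_derivative H (at x) b) has_derivative
      frechet_derivative (\<lambda>x. frechet_derivative H (at x) b) (at x0)) (at x0)" for b
    using smooth_onD[OF H, of "Suc (Suc 0)"] S by (simp add: frechet_derivative_works)
  have d\<eta>: "(\<eta> has_derivative frechet_derivative \<eta> (at x0)) (at x0)"
    using smooth_on_derivative[OF \<eta> S(2)] .
  have Hdiff: "H differentiable (at x)" if "x \<in> S" for x
    using smooth_on_derivative[OF H that] by (auto simp: differentiable_def)
  have eq: "(\<Sum>b\<in>Basis. (\<eta> x \<bullet> b) * frechet_derivative H (at x) b) =
      ((\<lambda>q. dir_deriv A q (Y q) h) \<circ> chart_inv c) x" if x: "x \<in> S" for x
  proof -
    obtain q where q: "q \<in> fst c" "q \<in> U" "x = snd c q"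
      using x by (auto simp: S_def)
    have "dir_deriv A q (Y q) h = frechet_derivative H (at (snd c q)) (Y q c)"
      unfolding H_def using q U cA
      by (intro dir_deriv_chart) (auto simp: smooth_fun_near_def smooth_vf_def charts_at_iff)
    then show ?thesis
      using frechet_derivative_Basis[OF Hdiff[OF x], of "\<eta> x"] q cA
      by (simp add: chart_inv_chart \<eta>_def)
  qed
  have "((\<lambda>x. \<Sum>b\<in>Basis. (\<eta> x \<bullet> b) * frechet_derivative H (at x) b) has_derivative
      (\<lambda>u. \<Sum>b\<in>Basis. (\<eta> x0 \<bullet> b) * frechet_derivative (\<lambda>x. frechet_derivative H (at x) b) (at x0) u +
        (frechet_derivative \<eta> (at x0) u \<bullet> b) * frechet_derivative H (at x0) b)) (at x0)"
    by (intro has_derivative_sum has_derivative_mult has_derivative_inner_left dH d\<eta>)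
  from has_derivative_transform_within_open[OF this S eq]
  have "frechet_derivative ((\<lambda>q. dir_deriv A q (Y q) h) \<circ> chart_inv c) (at x0) =
      (\<lambda>u. \<Sum>b\<in>Basis. (\<eta> x0 \<bullet> b) * frechet_derivative (\<lambda>x. frechet_derivative H (at x) b) (at x0) u +
        (frechet_derivative \<eta> (at x0) u \<bullet> b) * frechet_derivative H (at x0) b)"
    by (rule frechet_derivative_at[symmetric])
  moreover have "(\<Sum>b\<in>Basis. (w \<bullet> b) * frechet_derivative H (at x0) b) = frechet_derivative H (at x0) w" for w
    using frechet_derivative_Basis[OF Hdiff[OF S(2)], of w] by simp
  moreover have "frechet_derivative (\<lambda>x. frechet_derivative H (at x) b) (at x0) (X p c) =
    (\<Sum>d\<in>Basis. (X p c \<bullet> d) * frechet_derivative (\<lambda>x. frechet_derivative H (at x) b) (at x0) d)" for b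
    using frechet_derivative_Basis[of "\<lambda>x. frechet_derivative H (at x) b" x0 "X p c"] dH
    by (auto simp: differentiable_def)
  ultimately show ?thesis
    using dir_deriv_chart[OF smooth_at_dir_deriv[OF Y h] smooth_vf_at_tangent[OF X] c] p cA
    by (simp add: H_def[symmetric] \<eta>_def[symmetric] x0_def[symmetric] sum.distrib sum_distrib_left
        mult.assoc) (simp add: \<eta>_def x0_def chart_inv_chart)
qed

text \<open>In the commutator the Hessian terms cancel. The rest is the derivative along the vector
  with components \<open>dY(X) - dX(Y)\<close>, which is the witness \<open>v\<close>.\<close>

lemma lie_bracket:
  assumes X: "smooth_vf_at p X" and Y: "smooth_vf_at p Y"
  shows lie_bracket_tangent: "lie_bracket A X Y p \<in> T p"
    and dir_deriv_lie_bracket: "\<And>h. smooth_at p h \<Longrightarrow> dir_deriv A p (lie_bracket A X Y p) h =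
      dir_deriv A p (X p) (\<lambda>q. dir_deriv A q (Y q) h) - dir_deriv A p (Y p) (\<lambda>q. dir_deriv A q (X q) h)"
proof -
  define c where "c = chart_at A p"
  have c: "c \<in> charts_at A p" "c \<in> A" "p \<in> fst c"
    using chart_at_in[of p] by (auto simp: c_def charts_at_iff)
  let ?P = "\<lambda>v. v \<in> T p \<and> (\<forall>h. smooth_at p h \<longrightarrow> dir_deriv A p v h =
      dir_deriv A p (X p) (\<lambda>q. dir_deriv A q (Y q) h) - dir_deriv A p (Y p) (\<lambda>q. dir_deriv A q (X q) h))"
  define v where "v = coord_vec A c p
    (frechet_derivative (\<lambda>x. Y (chart_inv c x) c) (at (snd c p)) (X p c) -
     frechet_derivative (\<lambda>x. X (chart_inv c x) c) (at (snd c p)) (Y p c))"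
  have "?P v"
  proof (intro conjI allI impI)
    show v: "v \<in> T p"
      unfolding v_def by (rule coord_vec_tangent[OF c(1)])
    fix h assume h: "smooth_at p h"
    define H where "H = h \<circ> chart_inv c"
    obtain U where U: "open U" "p \<in> U" "smooth_fun A U h"
      using h by (auto simp: smooth_fun_near_def)
    have S: "open (snd c ` (fst c \<inter> U))" "snd c p \<in> snd c ` (fst c \<inter> U)"
      using open_chart_image[OF c(2) U(1)] c U by auto
    have sym: "frechet_derivative (\<lambda>x. frechet_derivative H (at x) b) (at (snd c p)) d =
        frechet_derivative (\<lambda>x. frechet_derivative H (at x) d) (at (snd c p)) b" for b d
      by (rule second_derivative_symmetric[OF S])
        (use U c in \<open>auto simp: H_def smooth_fun_def smooth_on_def\<close>)
    interpret linear "frechet_derivative H (at (snd c p))"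
      using smooth_at_derivative[OF h c(1)] has_derivative_linear unfolding H_def by blast
    \<comment> \<open>Exchanging the summation indices and the order of differentiation exchanges
      the roles of \<open>X\<close> and \<open>Y\<close>.\<close>
    have "(\<Sum>b\<in>Basis. \<Sum>d\<in>Basis. (Y p c \<bullet> b) * (X p c \<bullet> d) *
        frechet_derivative (\<lambda>x. frechet_derivative H (at x) b) (at (snd c p)) d) =
      (\<Sum>b\<in>Basis. \<Sum>d\<in>Basis. (X p c \<bullet> b) * (Y p c \<bullet> d) *
        frechet_derivative (\<lambda>x. frechet_derivative H (at x) b) (at (snd c p)) d)"
      by (subst sum.swap, intro sum.cong refl, subst sym) (simp add: mult.commute)
    then show "dir_deriv A p v h = dir_deriv A p (X p) (\<lambda>q. dir_deriv A q (Y q) h) -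
        dir_deriv A p (Y p) (\<lambda>q. dir_deriv A q (X q) h)"
      using second_dir_deriv_chart[OF X Y h c(1)] second_dir_deriv_chart[OF Y X h c(1)]
        dir_deriv_chart[OF h v c(1)] coord_vec_chart[OF c(1)]
      by (simp add: H_def[symmetric] v_def diff)
  qed
  then have "\<exists>!v. ?P v"
    by (intro ex1I[of ?P v]) (auto intro: tangent_eq_dir_derivI)
  from theI'[OF this, folded lie_bracket_def] show "lie_bracket A X Y p \<in> T p"
    "\<And>h. smooth_at p h \<Longrightarrow> dir_deriv A p (lie_bracket A X Y p) h =
      dir_deriv A p (X p) (\<lambda>q. dir_deriv A q (Y q) h) - dir_deriv A p (Y p) (\<lambda>q. dir_deriv A q (X q) h)"
    by blast+
qed

end


text \<open>As rewrite rules, these equations expand sums and multiples of tangent vectors, which are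
  functions of the chart, into abstractions.\<close>

declare plus_fun_apply [simp del] scaleR_fun_apply [simp del] zero_fun_apply [simp del]
  minus_apply [simp del] uminus_apply [simp del]

subsection \<open>Riemannian metrics and orthonormal frames\<close>

locale riemannian_manifold = smooth_manifold A
  for A :: "('m::{t2_space,second_countable_topology}, 'e::euclidean_space) chart set" +
  fixes g :: "('m, 'e) metric" and D :: "('m, 'e) connection"
  assumes metric: "riemannian_metric A g"
    and connection: "levi_civita A g D"
begin

text \<open>Linearity is demanded on the tangent space only: \<open>T p\<close> is a proper part of
  the function type \<open>tvec\<close>, and metric, connection and curvature are unspecified
  outside it.\<close>

definition tlinear :: "'m \<Rightarrow> (('m, 'e) tvec \<Rightarrow> 'b::real_vector) \<Rightarrow> bool" where
  "tlinear p L \<longleftrightarrow> (\<forall>v\<in>T p. \<forall>w\<in>T p. L (v + w) = L v + L w) \<and> (\<forall>a. \<forall>v\<in>T p. L (a *\<^sub>R v) = a *\<^sub>R L v)"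

lemma tlinearI:
  assumes "\<And>v w. v \<in> T p \<Longrightarrow> w \<in> T p \<Longrightarrow> L (v + w) = L v + L w"
    and "\<And>a v. v \<in> T p \<Longrightarrow> L (a *\<^sub>R v) = a *\<^sub>R L v"
  shows "tlinear p L"
  using assms by (simp add: tlinear_def)

lemma tlinear_add: "tlinear p L \<Longrightarrow> v \<in> T p \<Longrightarrow> w \<in> T p \<Longrightarrow> L (v + w) = L v + L w"
  by (simp add: tlinear_def)

lemma tlinear_scaleR: "tlinear p L \<Longrightarrow> v \<in> T p \<Longrightarrow> L (a *\<^sub>R v) = a *\<^sub>R L v"
  by (simp add: tlinear_def)

lemma tlinear_zero: "tlinear p L \<Longrightarrow> L 0 = 0"
  using tlinear_scaleR[of p L 0 0] by simp

lemma tlinear_minus: "tlinear p L \<Longrightarrow> v \<in> T p \<Longrightarrow> L (- v) = - L v"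
  using tlinear_scaleR[of p L v "-1"] by simp

lemma tlinear_diff: "tlinear p L \<Longrightarrow> v \<in> T p \<Longrightarrow> w \<in> T p \<Longrightarrow> L (v - w) = L v - L w"
  using tlinear_add[of p L v "- w"] tlinear_minus[of p L w] by simp

lemma tlinear_sum:
  assumes "tlinear p L" "\<And>i. i \<in> I \<Longrightarrow> v i \<in> T p"
  shows "L (\<Sum>i\<in>I. v i) = (\<Sum>i\<in>I. L (v i))"
  using assms(2)
proof (induction I rule: infinite_finite_induct)
  case (insert i I)
  then show ?case
    using tlinear_add[OF assms(1), of "v i" "\<Sum>i\<in>I. v i"] by (simp add: tangent_sum)
qed (simp_all add: tlinear_zero[OF assms(1)])

lemma tlinear_sum_scaleR:
  assumes "tlinear p L" "\<And>i. i \<in> I \<Longrightarrow> v i \<in> T p"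
  shows "L (\<Sum>i\<in>I. a i *\<^sub>R v i) = (\<Sum>i\<in>I. a i *\<^sub>R L (v i))"
  using tlinear_sum[OF assms(1), of I "\<lambda>i. a i *\<^sub>R v i"] assms by (simp add: tlinear_scaleR)

lemma g_sym: "u \<in> T p \<Longrightarrow> v \<in> T p \<Longrightarrow> g p u v = g p v u"
  using metric by (simp add: riemannian_metric_def)

lemma g_linear_left:
  assumes w: "w \<in> T p"
  shows "tlinear p (\<lambda>v. g p v w)"
proof -
  have *: "g p (a *\<^sub>R u + b *\<^sub>R v) w = a * g p u w + b * g p v w" if "u \<in> T p" "v \<in> T p" for a b u v
    using bspec[OF bspec[OF spec[OF metric[unfolded riemannian_metric_def, THEN conjunct1], of p] that(1)] that(2)] w
    by blast
  show ?thesis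
  proof (rule tlinearI)
    show "g p (v + u) w = g p v w + g p u w" if "v \<in> T p" "u \<in> T p" for u v
      using *[OF that, of 1 1] by simp
    show "g p (a *\<^sub>R v) w = a *\<^sub>R g p v w" if "v \<in> T p" for a v
      using *[OF that that, of a 0] by simp
  qed
qed

lemma g_linear_right: "v \<in> T p \<Longrightarrow> tlinear p (g p v)"
  using g_linear_left[of v p] g_sym unfolding tlinear_def by simp

lemma g_pos: "v \<in> T p \<Longrightarrow> v \<noteq> 0 \<Longrightarrow> g p v v > 0"
  using metric by (simp add: riemannian_metric_def)

lemma g_smooth: "open U \<Longrightarrow> smooth_vf A U X \<Longrightarrow> smooth_vf A U Y \<Longrightarrow> smooth_fun A U (\<lambda>q. g q (X q) (Y q))"
  using metric by (simp add: riemannian_metric_def)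

lemma g_smooth_at:
  assumes "smooth_vf_at p X" "smooth_vf_at p Y"
  shows "smooth_at p (\<lambda>q. g q (X q) (Y q))"
proof -
  obtain U V where "open U" "p \<in> U" "smooth_vf A U X" "open V" "p \<in> V" "smooth_vf A V Y"
    using assms by (auto simp: smooth_vf_near_def)
  then have "smooth_fun A (U \<inter> V) (\<lambda>q. g q (X q) (Y q))"
    by (intro g_smooth) (auto intro: smooth_vf_subset)
  then show ?thesis
    unfolding smooth_fun_near_def using \<open>open U\<close> \<open>open V\<close> \<open>p \<in> U\<close> \<open>p \<in> V\<close>
    by (intro exI[of _ "U \<inter> V"]) auto
qed

lemma g_nondegenerate:
  assumes "v \<in> T p" "w \<in> T p" "\<And>u. u \<in> T p \<Longrightarrow> g p v u = g p w u"
  shows "v = w"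
proof (rule ccontr)
  assume "v \<noteq> w"
  then have "g p (v - w) (v - w) > 0"
    using assms by (intro g_pos) auto
  moreover have "g p (v - w) (v - w) = 0"
    using tlinear_diff[OF g_linear_left, of "v - w" p v w] assms by simp
  ultimately show False
    by simp
qed

text \<open>Indexing by the basis of the model space fixes the number of frame vectors. The
  expansion clause is carried along because traces and tensoriality are both computed from
  it.\<close>

definition onb :: "'m \<Rightarrow> ('e \<Rightarrow> ('m, 'e) tvec) \<Rightarrow> bool" where
  "onb p e \<longleftrightarrow> (\<forall>b\<in>Basis. e b \<in> T p) \<and>
    (\<forall>b\<in>Basis. \<forall>d\<in>Basis. g p (e b) (e d) = (if b = d then 1 else 0)) \<and>
    (\<forall>v\<in>T p. v = (\<Sum>b\<in>Basis. g p v (e b) *\<^sub>R e b))"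

text \<open>Orthonormalization of the coordinate fields on the whole chart domain. The triangularity
  clause, by which \<open>E b\<close> has no component outside \<open>B\<close>, keeps the next
  residual from vanishing; the last clause makes the result a spanning family.\<close>

lemma gram_schmidt:
  assumes c: "c \<in> A" and B: "finite B" "B \<subseteq> Basis"
  defines "C \<equiv> \<lambda>b q. coord_vec A c q b"
  shows "\<exists>E. (\<forall>b\<in>B. smooth_vf A (fst c) (E b)) \<and> (\<forall>q\<in>fst c.
    (\<forall>b\<in>B. \<forall>d\<in>B. g q (E b q) (E d q) = (if b = d then 1 else 0)) \<and>
    (\<forall>b\<in>B. \<forall>d\<in>Basis - B. E b q c \<bullet> d = 0) \<and>
    (\<forall>b\<in>B. C b q = (\<Sum>d\<in>B. g q (C b q) (E d q) *\<^sub>R E d q)))"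
  using B
proof (induction B rule: finite_induct)
  case empty
  show ?case by simp
next
  case (insert k B)
  obtain E where E: "\<forall>b\<in>B. smooth_vf A (fst c) (E b)"
    "\<forall>q\<in>fst c. (\<forall>b\<in>B. \<forall>d\<in>B. g q (E b q) (E d q) = (if b = d then 1 else 0)) \<and>
      (\<forall>b\<in>B. \<forall>d\<in>Basis - B. E b q c \<bullet> d = 0) \<and>
      (\<forall>b\<in>B. C b q = (\<Sum>d\<in>B. g q (C b q) (E d q) *\<^sub>R E d q))"
    using insert.IH insert.prems by blast
  have smooth: "smooth_vf A (fst c) (E b)" if "b \<in> B" for b
    using E(1) that by blast
  have on: "g q (E b q) (E d q) = (if b = d then 1 else 0)" if "q \<in> fst c" "b \<in> B" "d \<in> B" for q b d
    using E(2) that by blast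
  have tri: "E b q c \<bullet> d = 0" if "q \<in> fst c" "b \<in> B" "d \<in> Basis - B" for q b d
    using E(2) that by blast
  have span: "C b q = (\<Sum>d\<in>B. g q (C b q) (E d q) *\<^sub>R E d q)" if "q \<in> fst c" "b \<in> B" for q b
    using E(2) that by blast
  have k: "k \<in> Basis" "k \<notin> B" "finite B"
    using insert by auto
  note U = open_chart[OF c]
  have smoothC: "smooth_vf A (fst c) (C b)" for b
    unfolding C_def by (rule smooth_coord_vec[OF c])
  have CT: "C b q \<in> T q" if "q \<in> fst c" for b q
    using smoothC that by (simp add: smooth_vf_def)
  have ET: "E b q \<in> T q" if "q \<in> fst c" "b \<in> B" for b q
    using smooth[OF that(2)] that(1) by (simp add: smooth_vf_def)
  define Z where "Z q = C k q - (\<Sum>d\<in>B. g q (C k q) (E d q) *\<^sub>R E d q)" for q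
  define N where "N q = sqrt (g q (Z q) (Z q))" for q
  define E' where "E' = E(k := \<lambda>q. inverse (N q) *\<^sub>R Z q)"
  have E'k: "E' k q = inverse (N q) *\<^sub>R Z q" for q
    by (simp add: E'_def)
  have E'B: "E' b = E b" if "b \<in> B" for b
    using that k by (auto simp: E'_def)
  have sumT: "(\<Sum>d\<in>B. a d *\<^sub>R E d q) \<in> T q" if "q \<in> fst c" for q and a :: "'e \<Rightarrow> real"
    using ET that by (intro tangent_sum tangent_scaleR)
  have ZT: "Z q \<in> T q" if "q \<in> fst c" for q
    unfolding Z_def using CT[OF that] sumT[OF that] by simp
  have "smooth_vf A (fst c) (\<lambda>q. \<Sum>d\<in>B'. g q (C k q) (E d q) *\<^sub>R E d q)" if "finite B'" "B' \<subseteq> B" for B'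
    using that
  proof (induction B' rule: finite_induct)
    case (insert d B')
    then have "smooth_vf A (fst c) (\<lambda>q. g q (C k q) (E d q) *\<^sub>R E d q + (\<Sum>d\<in>B'. g q (C k q) (E d q) *\<^sub>R E d q))"
      by (intro smooth_vf_add[OF U] smooth_vf_scaleR[OF U] g_smooth[OF U] smoothC smooth) auto
    with insert.hyps show ?case
      by simp
  qed (simp add: smooth_vf_zero)
  then have sm: "smooth_vf A (fst c) (\<lambda>q. \<Sum>d\<in>B. g q (C k q) (E d q) *\<^sub>R E d q)"
    using k by simp
  have "smooth_vf A (fst c) (\<lambda>q. C k q + (-1) *\<^sub>R (\<Sum>d\<in>B. g q (C k q) (E d q) *\<^sub>R E d q))"
    by (intro smooth_vf_add[OF U] smoothC smooth_vf_scaleR[OF U smooth_fun_const sm])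
  then have smoothZ: "smooth_vf A (fst c) Z"
    by (rule smooth_vf_cong[OF U, rotated]) (simp add: Z_def)
  \<comment> \<open>The coordinate field of \<open>k\<close> contributes component 1 along
    \<open>k\<close> and the earlier frame fields contribute 0, so the residual \<open>Z\<close> is
    nonzero at every point.\<close>
  have inner: "Z q c \<bullet> d = (if d = k then 1 else 0)" if "q \<in> fst c" "d \<in> Basis - B" for q d
  proof -
    have "C k q c = k"
      using that c by (simp add: C_def coord_vec_chart charts_at_iff)
    then show ?thesis
      using tri[OF that(1) _ that(2)] that k
      by (simp add: Z_def sum_fun_apply inner_diff_left inner_sum_left inner_Basis scaleR_fun_apply minus_apply)
  qed
  have pos: "g q (Z q) (Z q) > 0" if "q \<in> fst c" for q
  proof (rule g_pos[OF ZT[OF that]])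
    show "Z q \<noteq> 0"
      using inner[OF that, of k] k by (auto simp: zero_fun_apply)
  qed
  have N: "N q > 0" "N q * N q = g q (Z q) (Z q)" if "q \<in> fst c" for q
    using pos[OF that] by (simp_all add: N_def)
  have smoothN: "smooth_fun A (fst c) N"
    unfolding N_def by (intro smooth_fun_sqrt[OF U] pos g_smooth[OF U] smoothZ)
  have smoothE: "smooth_vf A (fst c) (E' b)" if "b \<in> insert k B" for b
  proof (cases "b = k")
    case True
    have "smooth_vf A (fst c) (\<lambda>q. inverse (N q) *\<^sub>R Z q)"
      by (rule smooth_vf_scaleR[OF U smooth_fun_inverse[OF U _ smoothN] smoothZ]) (use N(1) in fastforce)
    then show ?thesis
      using True by (simp add: E'_def)
  qed (use that smooth E'B in auto)
  have ZE: "g q (Z q) (E d q) = 0" if q: "q \<in> fst c" and d: "d \<in> B" for q d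
  proof -
    have "g q (Z q) (E d q) = g q (C k q) (E d q) - (\<Sum>b\<in>B. g q (C k q) (E b q) * g q (E b q) (E d q))"
      unfolding Z_def
      using tlinear_diff[OF g_linear_left[OF ET[OF q d]] CT[OF q, of k] sumT[OF q]]
        tlinear_sum_scaleR[where I=B and v="\<lambda>b. E b q" and a="\<lambda>b. g q (C k q) (E b q)",
          OF g_linear_left[OF ET[OF q d]] ET[OF q]] by simp
    also have "(\<Sum>b\<in>B. g q (C k q) (E b q) * g q (E b q) (E d q)) = (\<Sum>b\<in>B. if b = d then g q (C k q) (E b q) else 0)"
      using on[OF q _ d] by (intro sum.cong) auto
    finally show ?thesis
      using d k by simp
  qed
  have E'E: "g q (E' k q) (E d q) = 0" "g q (E d q) (E' k q) = 0" if q: "q \<in> fst c" and d: "d \<in> B" for q d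
    using tlinear_scaleR[OF g_linear_left[OF ET[OF q d]] ZT[OF q]] ZE[OF q d] g_sym[of "E d q" q "E' k q"]
      ET[OF q d] ZT[OF q] by (simp_all add: E'k)
  have ZE': "g q (Z q) (E' k q) = N q" if q: "q \<in> fst c" for q
    using tlinear_scaleR[OF g_linear_right[OF ZT[OF q]] ZT[OF q]] N[OF q]
    by (simp add: E'k divide_inverse[symmetric] field_simps)
  have E'E': "g q (E' k q) (E' k q) = 1" if q: "q \<in> fst c" for q
    using tlinear_scaleR[OF g_linear_left ZT[OF q], of "E' k q"] ZT[OF q] N[OF q] ZE'[OF q]
    by (simp add: E'k)
  show ?case
  proof (intro exI[of _ E'] conjI ballI)
    fix q b d assume q: "q \<in> fst c" and b: "b \<in> insert k B" and d: "d \<in> insert k B"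
    show "g q (E' b q) (E' d q) = (if b = d then 1 else 0)"
      using b d E'E'[OF q] E'E[OF q] on[OF q] k E'B by auto
  next
    fix q b d assume q: "q \<in> fst c" and b: "b \<in> insert k B" and d: "d \<in> Basis - insert k B"
    show "E' b q c \<bullet> d = 0"
      using b d tri[OF q] inner[OF q, of d] k E'B by (cases "b = k") (auto simp: E'k scaleR_fun_apply)
  next
    fix q b assume q: "q \<in> fst c" and b: "b \<in> insert k B"
    have sumE: "(\<Sum>d\<in>insert k B. a (E' d q) *\<^sub>R E' d q) = a (E' k q) *\<^sub>R E' k q + (\<Sum>d\<in>B. a (E d q) *\<^sub>R E d q)" for a
      using k E'B by (simp cong: sum.cong)
    show "C b q = (\<Sum>d\<in>insert k B. g q (C b q) (E' d q) *\<^sub>R E' d q)"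
    proof (cases "b = k")
      case True
      have E'T: "E' k q \<in> T q"
        using ZT[OF q] by (simp add: E'k)
      \<comment> \<open>Pairing with the new frame vector gives \<open>N\<close>, so its term in the
        expansion is \<open>Z\<close> itself, which adds up with the subtracted projection to
        \<open>C k\<close>.\<close>
      have "C k q = Z q + (\<Sum>d\<in>B. g q (C k q) (E d q) *\<^sub>R E d q)"
        by (simp add: Z_def)
      then have "g q (C k q) (E' k q) = g q (Z q + (\<Sum>d\<in>B. g q (C k q) (E d q) *\<^sub>R E d q)) (E' k q)"
        by (rule arg_cong)
      also have "\<dots> = g q (Z q) (E' k q) + g q (\<Sum>d\<in>B. g q (C k q) (E d q) *\<^sub>R E d q) (E' k q)"
        by (rule tlinear_add[OF g_linear_left[OF E'T] ZT[OF q] sumT[OF q]])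
      also have "g q (\<Sum>d\<in>B. g q (C k q) (E d q) *\<^sub>R E d q) (E' k q) = 0"
        using tlinear_sum_scaleR[where I=B and v="\<lambda>b. E b q" and a="\<lambda>b. g q (C k q) (E b q)",
          OF g_linear_left[OF E'T] ET[OF q]] E'E[OF q] by simp
      finally have "g q (C k q) (E' k q) *\<^sub>R E' k q = Z q"
        using ZE'[OF q] N[OF q] by (simp add: E'k)
      then show ?thesis
        unfolding sumE True by (simp add: Z_def)
    next
      case False
      then have bB: "b \<in> B"
        using b by simp
      have E'T: "E' k q \<in> T q"
        using ZT[OF q] by (simp add: E'k)
      have "g q (C b q) (E' k q) = 0"
        using E'E[OF q] arg_cong[OF span[OF q bB], of "\<lambda>v. g q v (E' k q)"]
          tlinear_sum_scaleR[where I=B and v="\<lambda>d. E d q" and a="\<lambda>d. g q (C b q) (E d q)",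
            OF g_linear_left[OF E'T] ET[OF q]]
        by simp
      then show ?thesis
        unfolding sumE using span[OF q bB] by simp
    qed
  qed (rule smoothE)
qed

text \<open>Gram-Schmidt is taken with all of \<open>Basis\<close>. A general tangent vector is a
  combination of coordinate vectors, each of which is a combination of the frame.\<close>

lemma orthonormal_frame:
  obtains E where "\<And>b. b \<in> Basis \<Longrightarrow> smooth_vf_at p (E b)" "\<forall>\<^sub>F q in nhds p. onb q (\<lambda>b. E b q)"
proof -
  define c where "c = chart_at A p"
  have c: "c \<in> A" "p \<in> fst c"
    using chart_at_in[of p] by (auto simp: c_def charts_at_iff)
  obtain E :: "'e \<Rightarrow> 'm \<Rightarrow> ('m, 'e) tvec" where E1: "\<forall>b\<in>Basis. smooth_vf A (fst c) (E b)"
    and E2: "\<forall>q\<in>fst c. (\<forall>b\<in>Basis. \<forall>d\<in>Basis. g q (E b q) (E d q) = (if b = d then 1 else 0)) \<and>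
      (\<forall>b\<in>Basis. \<forall>d\<in>Basis - Basis. E b q c \<bullet> d = 0) \<and>
      (\<forall>b\<in>Basis. coord_vec A c q b = (\<Sum>d\<in>Basis. g q (coord_vec A c q b) (E d q) *\<^sub>R E d q))"
    using gram_schmidt[OF c(1) finite_Basis order_refl] by blast
  have E: "\<And>b. b \<in> Basis \<Longrightarrow> smooth_vf A (fst c) (E b)"
    "\<And>q b d. q \<in> fst c \<Longrightarrow> b \<in> Basis \<Longrightarrow> d \<in> Basis \<Longrightarrow> g q (E b q) (E d q) = (if b = d then 1 else 0)"
    "\<And>q b. q \<in> fst c \<Longrightarrow> b \<in> Basis \<Longrightarrow>
      coord_vec A c q b = (\<Sum>d\<in>Basis. g q (coord_vec A c q b) (E d q) *\<^sub>R E d q)"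
    using E1 E2 by blast+
  have "onb q (\<lambda>b. E b q)" if q: "q \<in> fst c" for q
    unfolding onb_def
  proof (intro conjI ballI)
    show ET: "E b q \<in> T q" if "b \<in> Basis" for b
      using E(1)[OF that] q by (simp add: smooth_vf_def)
    fix v assume v: "v \<in> T q"
    have cq: "c \<in> charts_at A q"
      using c q by (simp add: charts_at_iff)
    define C where "C b = coord_vec A c q b" for b
    have CT: "C b \<in> T q" for b
      unfolding C_def by (rule coord_vec_tangent[OF cq])
    have v_eq: "v = (\<Sum>b\<in>Basis. (v c \<bullet> b) *\<^sub>R C b)"
      unfolding C_def by (rule tangent_Basis_expand[OF cq v])
    have gv: "g q v (E d q) = (\<Sum>b\<in>Basis. (v c \<bullet> b) * g q (C b) (E d q))" if "d \<in> Basis" for d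
      using tlinear_sum_scaleR[where I=Basis and v=C and a="\<lambda>b. v c \<bullet> b",
          OF g_linear_left[OF ET[OF that]] CT] v_eq
      by simp
    have "v = (\<Sum>b\<in>Basis. (v c \<bullet> b) *\<^sub>R (\<Sum>d\<in>Basis. g q (C b) (E d q) *\<^sub>R E d q))"
      using v_eq E(3)[OF q] by (simp add: C_def[symmetric])
    also have "\<dots> = (\<Sum>d\<in>Basis. (\<Sum>b\<in>Basis. (v c \<bullet> b) * g q (C b) (E d q)) *\<^sub>R E d q)"
      by (simp add: scaleR_sum_right scaleR_sum_left) (rule sum.swap)
    also have "\<dots> = (\<Sum>d\<in>Basis. g q v (E d q) *\<^sub>R E d q)"
      using gv by simp
    finally show "v = (\<Sum>d\<in>Basis. g q v (E d q) *\<^sub>R E d q)" .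
  qed (use E(2)[OF q] in auto)
  then have "\<forall>\<^sub>F q in nhds p. onb q (\<lambda>b. E b q)"
    using open_chart[OF c(1)] c(2) unfolding eventually_nhds by blast
  moreover have "smooth_vf_at p (E b)" if "b \<in> Basis" for b
    using E(1)[OF that] open_chart[OF c(1)] c(2) unfolding smooth_vf_near_def by blast
  ultimately show thesis
    using that by blast
qed

lemma onb_exists: obtains e where "onb p e"
proof -
  obtain E where "\<forall>\<^sub>F q in nhds p. onb q (\<lambda>b. E b q)"
    using orthonormal_frame by blast
  then show thesis
    using that eventually_nhds_x_imp_x by blast
qed

lemma onb_tangent: "onb p e \<Longrightarrow> b \<in> Basis \<Longrightarrow> e b \<in> T p"
  by (simp add: onb_def)

lemma onb_orthonormal: "onb p e \<Longrightarrow> b \<in> Basis \<Longrightarrow> d \<in> Basis \<Longrightarrow> g p (e b) (e d) = (if b = d then 1 else 0)"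
  by (simp add: onb_def)

lemma onb_expand: "onb p e \<Longrightarrow> v \<in> T p \<Longrightarrow> v = (\<Sum>b\<in>Basis. g p v (e b) *\<^sub>R e b)"
  unfolding onb_def by blast

lemma onb_expand_linear:
  "onb p e \<Longrightarrow> tlinear p L \<Longrightarrow> v \<in> T p \<Longrightarrow> L v = (\<Sum>b\<in>Basis. g p v (e b) *\<^sub>R L (e b))"
  using onb_expand[of p e v] tlinear_sum_scaleR[of p L Basis e "\<lambda>b. g p v (e b)"] onb_tangent by simp

text \<open>Inserting the frame expansion of the coordinate vectors and exchanging the sums
  collects, for each frame vector, the coordinate expansion of its image. This is basis independence
  of the trace.\<close>

lemma trace_at_onb:
  assumes e: "onb p e" and L: "tlinear p L" "\<And>v. v \<in> T p \<Longrightarrow> L v \<in> T p"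
  shows "trace_at A p L = (\<Sum>b\<in>Basis. g p (L (e b)) (e b))"
proof -
  define c where "c = chart_at A p"
  have c: "c \<in> charts_at A p"
    unfolding c_def by (rule chart_at_in)
  define C where "C b = coord_vec A c p b" for b
  have CT: "C b \<in> T p" for b
    unfolding C_def by (rule coord_vec_tangent[OF c])
  have "trace_at A p L = (\<Sum>b\<in>Basis. L (C b) c \<bullet> b)"
    by (simp add: trace_at_def C_def c_def)
  also have "\<dots> = (\<Sum>b\<in>Basis. \<Sum>d\<in>Basis. g p (C b) (e d) * (L (e d) c \<bullet> b))"
    using onb_expand_linear[OF e L(1) CT]
    by (simp add: sum_fun_apply scaleR_fun_apply inner_sum_left)
  also have "\<dots> = (\<Sum>d\<in>Basis. \<Sum>b\<in>Basis. (L (e d) c \<bullet> b) * g p (C b) (e d))"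
    by (subst sum.swap) (simp add: mult.commute)
  also have "\<dots> = (\<Sum>d\<in>Basis. g p (L (e d)) (e d))"
  proof (rule sum.cong[OF refl])
    fix d :: 'e assume d: "d \<in> Basis"
    show "(\<Sum>b\<in>Basis. (L (e d) c \<bullet> b) * g p (C b) (e d)) = g p (L (e d)) (e d)"
      using tangent_Basis_expand[OF c L(2)[OF onb_tangent[OF e d]]]
        tlinear_sum_scaleR[where I=Basis and v=C and a="\<lambda>b. L (e d) c \<bullet> b",
          OF g_linear_left[OF onb_tangent[OF e d]] CT]
      by (simp add: C_def)
  qed
  finally show ?thesis .
qed

lemma trace_at_cong: "(\<And>v. v \<in> T p \<Longrightarrow> L v = L' v) \<Longrightarrow> trace_at A p L = trace_at A p L'"
  unfolding trace_at_def using coord_vec_tangent[OF chart_at_in] by simp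

lemma trace_at_add: "trace_at A p (\<lambda>v. L v + L' v) = trace_at A p L + trace_at A p L'"
  by (simp add: trace_at_def plus_fun_apply inner_add_left sum.distrib)

lemma trace_at_scaleR: "trace_at A p (\<lambda>v. a *\<^sub>R L v) = a * trace_at A p L"
  by (simp add: trace_at_def scaleR_fun_apply sum_distrib_left)

text \<open>Riesz representation: an orthonormal basis provides the vector, nondegeneracy its
  uniqueness.\<close>

lemma sharp:
  assumes \<omega>: "tlinear p \<omega>"
  shows sharp_tangent: "sharp A g p \<omega> \<in> T p"
    and g_sharp: "u \<in> T p \<Longrightarrow> g p (sharp A g p \<omega>) u = \<omega> u"
proof -
  obtain e where e: "onb p e"
    by (rule onb_exists)
  define w where "w = (\<Sum>b\<in>Basis. \<omega> (e b) *\<^sub>R e b)"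
  have w: "w \<in> T p"
    unfolding w_def by (intro tangent_sum tangent_scaleR onb_tangent[OF e])
  have "g p w u = \<omega> u" if u: "u \<in> T p" for u
    using tlinear_sum_scaleR[OF g_linear_left[OF u], of Basis e "\<lambda>b. \<omega> (e b)"] onb_tangent[OF e]
      onb_expand_linear[OF e \<omega> u] g_sym[OF u]
    by (simp add: w_def mult.commute)
  then have "\<exists>!w. w \<in> T p \<and> (\<forall>u\<in>T p. g p w u = \<omega> u)"
    using w g_nondegenerate by (intro ex1I[of _ w]) auto
  from theI'[OF this, folded sharp_def] show "sharp A g p \<omega> \<in> T p"
    "u \<in> T p \<Longrightarrow> g p (sharp A g p \<omega>) u = \<omega> u"
    by auto
qed

lemma dir_deriv_linear: "smooth_at p h \<Longrightarrow> tlinear p (\<lambda>v. dir_deriv A p v h)"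
  using linear_dir_deriv[of p h]
  by (auto simp: tlinear_def linear_add[of "\<lambda>v. dir_deriv A p v h"] linear_scale[of "\<lambda>v. dir_deriv A p v h"])

lemma grad_tangent: "smooth_at p h \<Longrightarrow> grad A g h p \<in> T p"
  unfolding grad_def by (rule sharp_tangent[OF dir_deriv_linear])

lemma g_grad: "smooth_at p h \<Longrightarrow> u \<in> T p \<Longrightarrow> g p (grad A g h p) u = dir_deriv A p u h"
  unfolding grad_def by (rule g_sharp[OF dir_deriv_linear])

text \<open>Near \<open>p\<close> the coefficients of the gradient in a smooth orthonormal frame are
  the derivatives of \<open>h\<close> along the frame fields.\<close>

lemma grad_smooth_at:
  assumes h: "smooth_at p h"
  shows "smooth_vf_at p (grad A g h)"
proof -
  obtain E where E: "\<And>b. b \<in> Basis \<Longrightarrow> smooth_vf_at p (E b)" "\<forall>\<^sub>F q in nhds p. onb q (\<lambda>b. E b q)"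
    using orthonormal_frame by blast
  show ?thesis
  proof (rule smooth_vf_at_cong)
    show "smooth_vf_at p (\<lambda>q. \<Sum>b\<in>Basis. dir_deriv A q (E b q) h *\<^sub>R E b q)"
      by (intro smooth_vf_at_sum smooth_vf_at_scaleR smooth_at_dir_deriv E(1) h)
    show "\<forall>\<^sub>F q in nhds p. grad A g h q = (\<Sum>b\<in>Basis. dir_deriv A q (E b q) h *\<^sub>R E b q)"
      using E(2) smooth_at_eventually[OF h]
    proof eventually_elim
      case (elim q)
      show ?case
        using onb_expand[OF elim(1) grad_tangent[OF elim(2)]] g_grad[OF elim(2) onb_tangent[OF elim(1)]]
        by simp
    qed
  qed
qed


subsection \<open>The Levi-Civita connection\<close>

lemma affine: "affine_connection A D"
  using connection by (simp add: levi_civita_def)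

lemma D_tangent: "v \<in> T p \<Longrightarrow> smooth_vf_at p Y \<Longrightarrow> D p v Y \<in> T p"
  using affine unfolding affine_connection_def by blast

lemma D_linear:
  assumes Y: "smooth_vf_at p Y"
  shows "tlinear p (\<lambda>v. D p v Y)"
proof -
  have *: "D p (a *\<^sub>R v + b *\<^sub>R w) Y = a *\<^sub>R D p v Y + b *\<^sub>R D p w Y" if "v \<in> T p" "w \<in> T p" for a b v w
    using affine that Y unfolding affine_connection_def by blast
  show ?thesis
  proof (rule tlinearI)
    show "D p (v + w) Y = D p v Y + D p w Y" if "v \<in> T p" "w \<in> T p" for v w
      using *[OF that, of 1 1] by simp
    show "D p (a *\<^sub>R v) Y = a *\<^sub>R D p v Y" if "v \<in> T p" for a v
      using *[OF that that, of a 0] by simp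
  qed
qed

lemma D_add:
  "v \<in> T p \<Longrightarrow> smooth_vf_at p Y \<Longrightarrow> smooth_vf_at p Z \<Longrightarrow> D p v (\<lambda>q. Y q + Z q) = D p v Y + D p v Z"
  using affine unfolding affine_connection_def by blast

lemma D_scaleR:
  "v \<in> T p \<Longrightarrow> smooth_at p h \<Longrightarrow> smooth_vf_at p Y \<Longrightarrow>
    D p v (\<lambda>q. h q *\<^sub>R Y q) = dir_deriv A p v h *\<^sub>R Y p + h p *\<^sub>R D p v Y"
  using affine unfolding affine_connection_def by blast

lemma D_cong:
  "v \<in> T p \<Longrightarrow> smooth_vf_at p Y \<Longrightarrow> \<forall>\<^sub>F q in nhds p. Z q = Y q \<Longrightarrow> D p v Z = D p v Y"
  using affine unfolding affine_connection_def by blast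

lemma D_smooth_at:
  assumes "smooth_vf_at p X" "smooth_vf_at p Y"
  shows "smooth_vf_at p (\<lambda>q. D q (X q) Y)"
proof -
  obtain U V where "open U" "p \<in> U" "smooth_vf A U X" "open V" "p \<in> V" "smooth_vf A V Y"
    using assms by (auto simp: smooth_vf_near_def)
  moreover have "open W \<Longrightarrow> smooth_vf A W X \<Longrightarrow> smooth_vf A W Y \<Longrightarrow> smooth_vf A W (\<lambda>q. D q (X q) Y)" for W
    using affine unfolding affine_connection_def by blast
  ultimately have "smooth_vf A (U \<inter> V) (\<lambda>q. D q (X q) Y)"
    using smooth_vf_subset[of U X "U \<inter> V"] smooth_vf_subset[of V Y "U \<inter> V"] by auto
  then show ?thesis
    unfolding smooth_vf_near_def using \<open>open U\<close> \<open>open V\<close> \<open>p \<in> U\<close> \<open>p \<in> V\<close> by blast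
qed

lemma D_cmult:
  "v \<in> T p \<Longrightarrow> smooth_vf_at p Y \<Longrightarrow> D p v (\<lambda>q. a *\<^sub>R Y q) = a *\<^sub>R D p v Y"
  using D_scaleR[OF _ smooth_at_const, of v p Y a] by (simp add: dir_deriv_const)

lemma D_zero: "v \<in> T p \<Longrightarrow> D p v (\<lambda>q. 0) = 0"
  using D_cmult[OF _ smooth_vf_at_zero, of v p 0] by simp

lemma D_minus: "v \<in> T p \<Longrightarrow> smooth_vf_at p Y \<Longrightarrow> D p v (\<lambda>q. - Y q) = - D p v Y"
  using D_cmult[of v p Y "-1"] by simp

lemma D_diff:
  "v \<in> T p \<Longrightarrow> smooth_vf_at p Y \<Longrightarrow> smooth_vf_at p Z \<Longrightarrow> D p v (\<lambda>q. Y q - Z q) = D p v Y - D p v Z"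
  using D_add[OF _ _ smooth_vf_at_minus, of v p Y Z] by (simp add: D_minus)

lemma D_sum:
  assumes "v \<in> T p" "finite I" "\<And>i. i \<in> I \<Longrightarrow> smooth_vf_at p (Y i)"
  shows "D p v (\<lambda>q. \<Sum>i\<in>I. Y i q) = (\<Sum>i\<in>I. D p v (Y i))"
  using assms(2,3)
proof (induction I rule: finite_induct)
  case (insert i I)
  then show ?case
    using D_add[OF assms(1), of "Y i" "\<lambda>q. \<Sum>i\<in>I. Y i q"] by (simp add: smooth_vf_at_sum)
qed (simp add: D_zero assms(1))

lemma torsion:
  "smooth_vf_at p X \<Longrightarrow> smooth_vf_at p Y \<Longrightarrow> lie_bracket A X Y p = D p (X p) Y - D p (Y p) X"
  using connection by (simp add: levi_civita_def torsion_free_def)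

lemma D_metric:
  "v \<in> T p \<Longrightarrow> smooth_vf_at p Y \<Longrightarrow> smooth_vf_at p Z \<Longrightarrow>
    dir_deriv A p v (\<lambda>q. g q (Y q) (Z q)) = g p (D p v Y) (Z p) + g p (Y p) (D p v Z)"
  using connection by (simp add: levi_civita_def metric_compatible_def)

text \<open>Torsion-freeness writes the bracket through \<open>D\<close>, which preserves smoothness
  by definition.\<close>

lemma lie_bracket_smooth_at:
  assumes "smooth_vf_at p X" "smooth_vf_at p Y"
  shows "smooth_vf_at p (lie_bracket A X Y)"
proof (rule smooth_vf_at_cong)
  show "smooth_vf_at p (\<lambda>q. D q (X q) Y - D q (Y q) X)"
    using assms by (intro smooth_vf_at_diff D_smooth_at)
  show "\<forall>\<^sub>F q in nhds p. lie_bracket A X Y q = D q (X q) Y - D q (Y q) X"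
    using assms[THEN smooth_vf_at_eventually] by eventually_elim (rule torsion)
qed


subsection \<open>Tensorial expressions\<close>

text \<open>The third clause, dependence on the germ only, allows a field to be replaced by its
  frame expansion, which holds only near \<open>p\<close>.\<close>

definition tensorial :: "'m \<Rightarrow> (('m \<Rightarrow> ('m, 'e) tvec) \<Rightarrow> 'b::real_vector) \<Rightarrow> bool" where
  "tensorial p F \<longleftrightarrow>
    (\<forall>Y Z. smooth_vf_at p Y \<longrightarrow> smooth_vf_at p Z \<longrightarrow> F (\<lambda>q. Y q + Z q) = F Y + F Z) \<and>
    (\<forall>h Y. smooth_at p h \<longrightarrow> smooth_vf_at p Y \<longrightarrow> F (\<lambda>q. h q *\<^sub>R Y q) = h p *\<^sub>R F Y) \<and>
    (\<forall>Y Z. smooth_vf_at p Y \<longrightarrow> (\<forall>\<^sub>F q in nhds p. Z q = Y q) \<longrightarrow> F Z = F Y)"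

lemma tensorialI:
  assumes "\<And>Y Z. smooth_vf_at p Y \<Longrightarrow> smooth_vf_at p Z \<Longrightarrow> F (\<lambda>q. Y q + Z q) = F Y + F Z"
    and "\<And>h Y. smooth_at p h \<Longrightarrow> smooth_vf_at p Y \<Longrightarrow> F (\<lambda>q. h q *\<^sub>R Y q) = h p *\<^sub>R F Y"
    and "\<And>Y Z. smooth_vf_at p Y \<Longrightarrow> smooth_vf_at p Z \<Longrightarrow> \<forall>\<^sub>F q in nhds p. Z q = Y q \<Longrightarrow> F Z = F Y"
  shows "tensorial p F"
  unfolding tensorial_def
proof (intro conjI allI impI)
  show "F Z = F Y" if "smooth_vf_at p Y" "\<forall>\<^sub>F q in nhds p. Z q = Y q" for Y Z
    using assms(3)[OF that(1) smooth_vf_at_cong[OF that] that(2)] .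
qed (use assms(1,2) in auto)

lemma tensorial_sum:
  assumes F: "tensorial p F" and I: "finite I"
    and "\<And>i. i \<in> I \<Longrightarrow> smooth_at p (h i)" "\<And>i. i \<in> I \<Longrightarrow> smooth_vf_at p (Y i)"
  shows "F (\<lambda>q. \<Sum>i\<in>I. h i q *\<^sub>R Y i q) = (\<Sum>i\<in>I. h i p *\<^sub>R F (Y i))"
  using I assms(3,4)
proof (induction I rule: finite_induct)
  case empty
  have "F (\<lambda>q. 0 *\<^sub>R 0) = 0 *\<^sub>R F (\<lambda>q. 0)"
    using F smooth_at_const smooth_vf_at_zero unfolding tensorial_def by blast
  then show ?case by simp
next
  case (insert i I)
  then have sm: "smooth_vf_at p (\<lambda>q. h i q *\<^sub>R Y i q)" "smooth_vf_at p (\<lambda>q. \<Sum>i\<in>I. h i q *\<^sub>R Y i q)"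
    by (auto intro!: smooth_vf_at_sum smooth_vf_at_scaleR)
  have "F (\<lambda>q. h i q *\<^sub>R Y i q + (\<Sum>i\<in>I. h i q *\<^sub>R Y i q)) =
      F (\<lambda>q. h i q *\<^sub>R Y i q) + F (\<lambda>q. \<Sum>i\<in>I. h i q *\<^sub>R Y i q)"
    using F sm unfolding tensorial_def by blast
  moreover have "F (\<lambda>q. h i q *\<^sub>R Y i q) = h i p *\<^sub>R F (Y i)"
    using F insert.prems unfolding tensorial_def by blast
  ultimately show ?case
    using insert by simp
qed

text \<open>Expanded in a local orthonormal frame, the field enters \<open>F\<close> only through
  its coefficients at \<open>p\<close>. This is what removes the choice made by
  \<open>vf_extension\<close>.\<close>

lemma tensorial_eq:
  assumes F: "tensorial p F" and Y: "smooth_vf_at p Y" and Z: "smooth_vf_at p Z" and eq: "Y p = Z p"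
  shows "F Y = F Z"
proof -
  obtain E where E: "\<And>b. b \<in> Basis \<Longrightarrow> smooth_vf_at p (E b)" "\<forall>\<^sub>F q in nhds p. onb q (\<lambda>b. E b q)"
    using orthonormal_frame by blast
  have "F W = (\<Sum>b\<in>Basis. g p (W p) (E b p) *\<^sub>R F (E b))" if W: "smooth_vf_at p W" for W
  proof -
    have ev: "\<forall>\<^sub>F q in nhds p. W q = (\<Sum>b\<in>Basis. g q (W q) (E b q) *\<^sub>R E b q)"
      using E(2) smooth_vf_at_eventually[OF W]
      by eventually_elim (rule onb_expand[OF _ smooth_vf_at_tangent])
    have sm: "smooth_vf_at p (\<lambda>q. \<Sum>b\<in>Basis. g q (W q) (E b q) *\<^sub>R E b q)"
      by (intro smooth_vf_at_sum smooth_vf_at_scaleR g_smooth_at W E(1))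
    have "F W = F (\<lambda>q. \<Sum>b\<in>Basis. g q (W q) (E b q) *\<^sub>R E b q)"
      using F sm ev unfolding tensorial_def by blast
    then show ?thesis
      using tensorial_sum[OF F finite_Basis, of "\<lambda>b q. g q (W q) (E b q)" E] g_smooth_at[OF W E(1)] E(1)
      by simp
  qed
  from this[OF Y] this[OF Z] eq show ?thesis
    by simp
qed

lemma tensorial_linear:
  assumes F: "tensorial p F"
  shows "tlinear p (\<lambda>v. F (vf_extension A p v))"
proof (rule tlinearI)
  fix v w assume v: "v \<in> T p" and w: "w \<in> T p"
  have "F (vf_extension A p (v + w)) = F (\<lambda>q. vf_extension A p v q + vf_extension A p w q)"
    using smooth_vf_extension v w
    by (intro tensorial_eq[OF F]) (auto intro!: smooth_vf_at_add simp del: plus_fun_apply)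
  also have "\<dots> = F (vf_extension A p v) + F (vf_extension A p w)"
    using F smooth_vf_extension v w unfolding tensorial_def by blast
  finally show "F (vf_extension A p (v + w)) = F (vf_extension A p v) + F (vf_extension A p w)" .
next
  fix v and a :: real assume v: "v \<in> T p"
  have "F (vf_extension A p (a *\<^sub>R v)) = F (\<lambda>q. a *\<^sub>R vf_extension A p v q)"
    using smooth_vf_extension v
    by (intro tensorial_eq[OF F]) (auto intro!: smooth_vf_at_cmult simp del: scaleR_fun_apply)
  also have "\<dots> = a *\<^sub>R F (vf_extension A p v)"
    using F smooth_vf_extension[OF v] smooth_at_const[of p a] unfolding tensorial_def by blast
  finally show "F (vf_extension A p (a *\<^sub>R v)) = a *\<^sub>R F (vf_extension A p v)" .
qed

lemma tensorial_zero:
  assumes F: "tensorial p F" and Y: "smooth_vf_at p Y" "Y p = 0"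
  shows "F Y = 0"
proof -
  have "F Y = F (vf_extension A p 0)"
    using Y smooth_vf_extension[of 0 p] by (intro tensorial_eq[OF F]) auto
  then show ?thesis
    using tlinear_zero[OF tensorial_linear[OF F]] by simp
qed


subsection \<open>Curvature\<close>

text \<open>The second covariant derivative of \<open>Z\<close>. The subtracted term removes the
  derivative of \<open>Y\<close>, so that the expression is tensorial in \<open>Y\<close>; its skew
  part is the curvature, since torsion-freeness writes the bracket as
  \<open>D_X Y - D_Y X\<close>.\<close>

definition second_cov ::
  "'m \<Rightarrow> ('m, 'e) tvec \<Rightarrow> ('m \<Rightarrow> ('m, 'e) tvec) \<Rightarrow> ('m \<Rightarrow> ('m, 'e) tvec) \<Rightarrow> ('m, 'e) tvec" where
  "second_cov p v Y Z = D p v (\<lambda>q. D q (Y q) Z) - D p (D p v Y) Z"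

lemma second_cov_tensorial:
  assumes v: "v \<in> T p" and Z: "smooth_vf_at p Z"
  shows "tensorial p (\<lambda>Y. second_cov p v Y Z)"
proof (rule tensorialI)
  fix X Y assume X: "smooth_vf_at p X" and Y: "smooth_vf_at p Y"
  have "D p v (\<lambda>q. D q (X q + Y q) Z) = D p v (\<lambda>q. D q (X q) Z + D q (Y q) Z)"
  proof (rule D_cong[OF v])
    show "smooth_vf_at p (\<lambda>q. D q (X q) Z + D q (Y q) Z)"
      by (intro smooth_vf_at_add D_smooth_at X Y Z)
    show "\<forall>\<^sub>F q in nhds p. D q (X q + Y q) Z = D q (X q) Z + D q (Y q) Z"
      using X[THEN smooth_vf_at_eventually] Y[THEN smooth_vf_at_eventually] Z[THEN smooth_vf_at_eventually]
      by eventually_elim (rule tlinear_add[OF D_linear smooth_vf_at_tangent smooth_vf_at_tangent])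
  qed
  also have "\<dots> = D p v (\<lambda>q. D q (X q) Z) + D p v (\<lambda>q. D q (Y q) Z)"
    by (rule D_add[OF v D_smooth_at[OF X Z] D_smooth_at[OF Y Z]])
  finally show "second_cov p v (\<lambda>q. X q + Y q) Z = second_cov p v X Z + second_cov p v Y Z"
    using tlinear_add[OF D_linear[OF Z] D_tangent[OF v X] D_tangent[OF v Y]]
    by (simp add: second_cov_def D_add[OF v X Y])
next
  fix h Y assume h: "smooth_at p h" and Y: "smooth_vf_at p Y"
  have "D p v (\<lambda>q. D q (h q *\<^sub>R Y q) Z) = D p v (\<lambda>q. h q *\<^sub>R D q (Y q) Z)"
  proof (rule D_cong[OF v])
    show "smooth_vf_at p (\<lambda>q. h q *\<^sub>R D q (Y q) Z)"
      by (intro smooth_vf_at_scaleR D_smooth_at h Y Z)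
    show "\<forall>\<^sub>F q in nhds p. D q (h q *\<^sub>R Y q) Z = h q *\<^sub>R D q (Y q) Z"
      using Y[THEN smooth_vf_at_eventually] Z[THEN smooth_vf_at_eventually]
      by eventually_elim (rule tlinear_scaleR[OF D_linear smooth_vf_at_tangent])
  qed
  also have "\<dots> = dir_deriv A p v h *\<^sub>R D p (Y p) Z + h p *\<^sub>R D p v (\<lambda>q. D q (Y q) Z)"
    by (rule D_scaleR[OF v h D_smooth_at[OF Y Z]])
  moreover have "D p (D p v (\<lambda>q. h q *\<^sub>R Y q)) Z =
      dir_deriv A p v h *\<^sub>R D p (Y p) Z + h p *\<^sub>R D p (D p v Y) Z"
    using smooth_vf_at_tangent[OF Y] D_tangent[OF v Y]
    by (simp add: D_scaleR[OF v h Y] tlinear_add[OF D_linear[OF Z]] tlinear_scaleR[OF D_linear[OF Z]])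
  ultimately show "second_cov p v (\<lambda>q. h q *\<^sub>R Y q) Z = h p *\<^sub>R second_cov p v Y Z"
    by (simp add: second_cov_def scaleR_diff_right)
next
  fix Y Y' assume Y: "smooth_vf_at p Y" and Y': "\<forall>\<^sub>F q in nhds p. Y' q = Y q"
  have "D p v (\<lambda>q. D q (Y' q) Z) = D p v (\<lambda>q. D q (Y q) Z)"
    by (rule D_cong[OF v D_smooth_at[OF Y Z]]) (use Y' in eventually_elim, simp)
  then show "second_cov p v Y' Z = second_cov p v Y Z"
    by (simp add: second_cov_def D_cong[OF v Y Y'])
qed

lemma second_cov_tangent:
  "v \<in> T p \<Longrightarrow> smooth_vf_at p Y \<Longrightarrow> smooth_vf_at p Z \<Longrightarrow> second_cov p v Y Z \<in> T p"
  unfolding second_cov_def by (intro tangent_diff D_tangent D_smooth_at)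

lemma second_cov_linear:
  assumes Y: "smooth_vf_at p Y" and Z: "smooth_vf_at p Z"
  shows "tlinear p (\<lambda>v. second_cov p v Y Z)"
proof (rule tlinearI)
  fix v w assume v: "v \<in> T p" "w \<in> T p"
  then show "second_cov p (v + w) Y Z = second_cov p v Y Z + second_cov p w Y Z"
    using D_tangent[OF _ Y]
    by (simp add: second_cov_def tlinear_add[OF D_linear[OF Y]] tlinear_add[OF D_linear[OF Z]]
        tlinear_add[OF D_linear[OF D_smooth_at[OF Y Z]]])
next
  fix v and a :: real assume v: "v \<in> T p"
  then show "second_cov p (a *\<^sub>R v) Y Z = a *\<^sub>R second_cov p v Y Z"
    using D_tangent[OF _ Y]
    by (simp add: second_cov_def tlinear_scaleR[OF D_linear[OF Y]] tlinear_scaleR[OF D_linear[OF Z]]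
        tlinear_scaleR[OF D_linear[OF D_smooth_at[OF Y Z]]] scaleR_diff_right)
qed

lemma curvature_second_cov:
  assumes X: "smooth_vf_at p X" and Y: "smooth_vf_at p Y" and Z: "smooth_vf_at p Z"
  shows "curvature_op A D X Y Z p = second_cov p (X p) Y Z - second_cov p (Y p) X Z"
  using tlinear_diff[OF D_linear[OF Z] D_tangent[OF smooth_vf_at_tangent[OF X] Y]
      D_tangent[OF smooth_vf_at_tangent[OF Y] X]]
  by (simp add: curvature_op_def second_cov_def torsion[OF X Y])

lemma D_D_scaleR:
  assumes V: "smooth_vf_at p V" and v: "v \<in> T p" and h: "smooth_at p h" and Z: "smooth_vf_at p Z"
  shows "D p v (\<lambda>q. D q (V q) (\<lambda>r. h r *\<^sub>R Z r)) =
    dir_deriv A p v (\<lambda>q. dir_deriv A q (V q) h) *\<^sub>R Z p + dir_deriv A p (V p) h *\<^sub>R D p v Z +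
    (dir_deriv A p v h *\<^sub>R D p (V p) Z + h p *\<^sub>R D p v (\<lambda>q. D q (V q) Z))"
proof -
  have sm: "smooth_vf_at p (\<lambda>q. dir_deriv A q (V q) h *\<^sub>R Z q)" "smooth_vf_at p (\<lambda>q. h q *\<^sub>R D q (V q) Z)"
    by (intro smooth_vf_at_scaleR smooth_at_dir_deriv D_smooth_at V h Z)+
  have "D p v (\<lambda>q. D q (V q) (\<lambda>r. h r *\<^sub>R Z r)) =
      D p v (\<lambda>q. dir_deriv A q (V q) h *\<^sub>R Z q + h q *\<^sub>R D q (V q) Z)"
  proof (rule D_cong[OF v smooth_vf_at_add[OF sm]])
    show "\<forall>\<^sub>F q in nhds p. D q (V q) (\<lambda>r. h r *\<^sub>R Z r) = dir_deriv A q (V q) h *\<^sub>R Z q + h q *\<^sub>R D q (V q) Z"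
      using V[THEN smooth_vf_at_eventually] Z[THEN smooth_vf_at_eventually] h[THEN smooth_at_eventually]
      by eventually_elim (rule D_scaleR[OF smooth_vf_at_tangent])
  qed
  then show ?thesis
    by (simp only: D_add[OF v sm] D_scaleR[OF v smooth_at_dir_deriv[OF V h] Z] D_scaleR[OF v h D_smooth_at[OF V Z]])
qed

text \<open>For a factor \<open>h\<close>, the products of a first derivative of \<open>h\<close>
  with a first derivative of \<open>Z\<close> are symmetric in \<open>X\<close> and \<open>Y\<close>
  and cancel; the second derivatives of \<open>h\<close> combine to its derivative along the
  bracket, which the bracket term takes away.\<close>

lemma curvature_tensorial:
  assumes X: "smooth_vf_at p X" and Y: "smooth_vf_at p Y"
  shows "tensorial p (\<lambda>Z. curvature_op A D X Y Z p)"
proof (rule tensorialI)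
  note Xp = smooth_vf_at_tangent[OF X] and Yp = smooth_vf_at_tangent[OF Y]
  note br = lie_bracket_tangent[OF X Y]
  {
    fix Z W assume Z: "smooth_vf_at p Z" and W: "smooth_vf_at p W"
    have *: "D p v (\<lambda>q. D q (V q) (\<lambda>q. Z q + W q)) = D p v (\<lambda>q. D q (V q) Z) + D p v (\<lambda>q. D q (V q) W)"
      if V: "smooth_vf_at p V" and v: "v \<in> T p" for V v
    proof -
      have "D p v (\<lambda>q. D q (V q) (\<lambda>q. Z q + W q)) = D p v (\<lambda>q. D q (V q) Z + D q (V q) W)"
      proof (rule D_cong[OF v])
        show "smooth_vf_at p (\<lambda>q. D q (V q) Z + D q (V q) W)"
          by (intro smooth_vf_at_add D_smooth_at V Z W)
        show "\<forall>\<^sub>F q in nhds p. D q (V q) (\<lambda>q. Z q + W q) = D q (V q) Z + D q (V q) W"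
          using V[THEN smooth_vf_at_eventually] Z[THEN smooth_vf_at_eventually] W[THEN smooth_vf_at_eventually]
          by eventually_elim (rule D_add[OF smooth_vf_at_tangent])
      qed
      then show ?thesis
        by (simp only: D_add[OF v D_smooth_at[OF V Z] D_smooth_at[OF V W]])
    qed
    show "curvature_op A D X Y (\<lambda>q. Z q + W q) p = curvature_op A D X Y Z p + curvature_op A D X Y W p"
      by (simp add: curvature_op_def *[OF X Yp] *[OF Y Xp] D_add[OF br Z W])
  next
    fix h Z assume h: "smooth_at p h" and Z: "smooth_vf_at p Z"
    show "curvature_op A D X Y (\<lambda>q. h q *\<^sub>R Z q) p = h p *\<^sub>R curvature_op A D X Y Z p"
      by (simp add: curvature_op_def D_D_scaleR[OF X Yp h Z] D_D_scaleR[OF Y Xp h Z] D_scaleR[OF br h Z]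
          dir_deriv_lie_bracket[OF X Y h] scaleR_diff_right scaleR_diff_left)
  next
    fix Z W assume Z: "smooth_vf_at p Z" and WZ: "\<forall>\<^sub>F q in nhds p. W q = Z q"
    \<comment> \<open>To compare derivatives at a nearby \<open>q\<close>, the fields must agree on
      a neighbourhood of \<open>q\<close>; agreement near \<open>p\<close> provides this for all
      \<open>q\<close> close to \<open>p\<close>.\<close>
    have *: "D p v (\<lambda>q. D q (V q) W) = D p v (\<lambda>q. D q (V q) Z)"
      if V: "smooth_vf_at p V" and v: "v \<in> T p" for V v
    proof (rule D_cong[OF v D_smooth_at[OF V Z]])
      show "\<forall>\<^sub>F q in nhds p. D q (V q) W = D q (V q) Z"
        using eventually_eventually[THEN iffD2, OF WZ] V[THEN smooth_vf_at_eventually]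
          Z[THEN smooth_vf_at_eventually]
        by eventually_elim (rule D_cong[OF smooth_vf_at_tangent])
    qed
    show "curvature_op A D X Y W p = curvature_op A D X Y Z p"
      by (simp add: curvature_op_def *[OF X Yp] *[OF Y Xp] D_cong[OF br Z WZ])
  }
qed

text \<open>The third slot is handled by tensoriality of the curvature, the first two by
  tensoriality of the second covariant derivative. Hence the extensions chosen in
  \<open>Riem\<close> may be replaced by the given fields.\<close>

lemma Riem_curvature:
  assumes X: "smooth_vf_at p X" and Y: "smooth_vf_at p Y" and Z: "smooth_vf_at p Z"
  shows "Riem A D p (X p) (Y p) (Z p) = curvature_op A D X Y Z p"
proof -
  note Xp = smooth_vf_at_tangent[OF X] and Yp = smooth_vf_at_tangent[OF Y] and Zp = smooth_vf_at_tangent[OF Z]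
  note X' = smooth_vf_extension[OF Xp] and Y' = smooth_vf_extension[OF Yp] and Z' = smooth_vf_extension[OF Zp]
  have "Riem A D p (X p) (Y p) (Z p) =
      curvature_op A D (vf_extension A p (X p)) (vf_extension A p (Y p)) Z p"
    unfolding Riem_def by (rule tensorial_eq[OF curvature_tensorial[OF X'(1) Y'(1)] Z'(1) Z Z'(2)])
  also have "\<dots> = second_cov p (X p) (vf_extension A p (Y p)) Z - second_cov p (Y p) (vf_extension A p (X p)) Z"
    by (simp add: curvature_second_cov[OF X'(1) Y'(1) Z] X'(2) Y'(2))
  also have "\<dots> = second_cov p (X p) Y Z - second_cov p (Y p) X Z"
    using tensorial_eq[OF second_cov_tensorial[OF Xp Z] Y'(1) Y Y'(2)]
      tensorial_eq[OF second_cov_tensorial[OF Yp Z] X'(1) X X'(2)] by simp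
  finally show ?thesis
    by (simp add: curvature_second_cov[OF X Y Z])
qed

lemma Riem_second_cov:
  assumes u: "u \<in> T p" and v: "v \<in> T p" and Z: "smooth_vf_at p Z"
  shows "Riem A D p u v (Z p) =
    second_cov p u (vf_extension A p v) Z - second_cov p v (vf_extension A p u) Z"
  using Riem_curvature[OF smooth_vf_extension(1)[OF u] smooth_vf_extension(1)[OF v] Z]
    curvature_second_cov[OF smooth_vf_extension(1)[OF u] smooth_vf_extension(1)[OF v] Z]
  by (simp add: smooth_vf_extension(2) u v)

lemma Riem_tangent: "u \<in> T p \<Longrightarrow> v \<in> T p \<Longrightarrow> w \<in> T p \<Longrightarrow> Riem A D p u v w \<in> T p"
  using Riem_second_cov[of u p v "vf_extension A p w"] smooth_vf_extension
  by (simp add: second_cov_tangent)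

lemma Riem_skew_left: "u \<in> T p \<Longrightarrow> v \<in> T p \<Longrightarrow> w \<in> T p \<Longrightarrow> Riem A D p v u w = - Riem A D p u v w"
  using Riem_second_cov[of u p v "vf_extension A p w"] Riem_second_cov[of v p u "vf_extension A p w"]
    smooth_vf_extension[of w p] by simp

lemma Riem_linear_left:
  assumes v: "v \<in> T p" and w: "w \<in> T p"
  shows "tlinear p (\<lambda>u. Riem A D p u v w)"
proof -
  define Z where "Z = vf_extension A p w"
  have Z: "smooth_vf_at p Z" "Z p = w"
    using smooth_vf_extension[OF w] by (auto simp: Z_def)
  note V = smooth_vf_extension(1)[OF v]
  note 1 = second_cov_linear[OF V Z(1)] and 2 = tensorial_linear[OF second_cov_tensorial[OF v Z(1)]]
  have eq: "Riem A D p u v w = second_cov p u (vf_extension A p v) Z - second_cov p v (vf_extension A p u) Z"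
    if "u \<in> T p" for u
    using Riem_second_cov[OF that v Z(1)] Z(2) by simp
  show ?thesis
    by (rule tlinearI)
      (simp_all add: eq tlinear_add[OF 1] tlinear_add[OF 2] tlinear_scaleR[OF 1] tlinear_scaleR[OF 2] scaleR_diff_right)
qed

text \<open>The extensions inside \<open>Riem A D q\<close> vary with \<open>q\<close> without any
  regularity; at every nearby \<open>q\<close> they are replaced by the fixed fields, for which
  smoothness is visible.\<close>

lemma Riem_smooth_at:
  assumes X: "smooth_vf_at p X" and Y: "smooth_vf_at p Y" and Z: "smooth_vf_at p Z"
  shows "smooth_vf_at p (\<lambda>q. Riem A D q (X q) (Y q) (Z q))"
proof (rule smooth_vf_at_cong)
  show "smooth_vf_at p (\<lambda>q. D q (X q) (\<lambda>r. D r (Y r) Z) - D q (Y q) (\<lambda>r. D r (X r) Z) - D q (lie_bracket A X Y q) Z)"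
    by (intro smooth_vf_at_diff D_smooth_at lie_bracket_smooth_at X Y Z)
  show "\<forall>\<^sub>F q in nhds p. Riem A D q (X q) (Y q) (Z q) =
      D q (X q) (\<lambda>r. D r (Y r) Z) - D q (Y q) (\<lambda>r. D r (X r) Z) - D q (lie_bracket A X Y q) Z"
    using X[THEN smooth_vf_at_eventually] Y[THEN smooth_vf_at_eventually] Z[THEN smooth_vf_at_eventually]
    by eventually_elim (simp add: Riem_curvature curvature_op_def)
qed

lemma second_dir_deriv_g:
  assumes V: "smooth_vf_at p V" and v: "v \<in> T p" and Z: "smooth_vf_at p Z" and W: "smooth_vf_at p W"
  shows "dir_deriv A p v (\<lambda>q. dir_deriv A q (V q) (\<lambda>r. g r (Z r) (W r))) =
    g p (D p v (\<lambda>q. D q (V q) Z)) (W p) + g p (D p (V p) Z) (D p v W) +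
    (g p (D p v Z) (D p (V p) W) + g p (Z p) (D p v (\<lambda>q. D q (V q) W)))"
proof -
  note DZ = D_smooth_at[OF V Z] and DW = D_smooth_at[OF V W]
  note sm = g_smooth_at[OF DZ W] g_smooth_at[OF Z DW]
  have "dir_deriv A p v (\<lambda>q. dir_deriv A q (V q) (\<lambda>r. g r (Z r) (W r))) =
      dir_deriv A p v (\<lambda>q. g q (D q (V q) Z) (W q) + g q (Z q) (D q (V q) W))"
  proof (rule dir_deriv_cong[OF smooth_at_add[OF sm]])
    show "\<forall>\<^sub>F q in nhds p. dir_deriv A q (V q) (\<lambda>r. g r (Z r) (W r)) =
        g q (D q (V q) Z) (W q) + g q (Z q) (D q (V q) W)"
      using V[THEN smooth_vf_at_eventually] Z[THEN smooth_vf_at_eventually] W[THEN smooth_vf_at_eventually]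
      by eventually_elim (rule D_metric[OF smooth_vf_at_tangent])
  qed
  then show ?thesis
    by (simp only: dir_deriv_add[OF sm] D_metric[OF v DZ W] D_metric[OF v Z DW])
qed

text \<open>The commutator of two derivatives of \<open>g(Z, W)\<close> is its derivative along the
  bracket. Metric compatibility expands both sides, and the terms in which \<open>Z\<close> and
  \<open>W\<close> are each differentiated once cancel.\<close>

lemma curvature_skew:
  assumes X: "smooth_vf_at p X" and Y: "smooth_vf_at p Y" and Z: "smooth_vf_at p Z" and W: "smooth_vf_at p W"
  shows "g p (curvature_op A D X Y Z p) (W p) = - g p (Z p) (curvature_op A D X Y W p)"
proof -
  note Xp = smooth_vf_at_tangent[OF X] and Yp = smooth_vf_at_tangent[OF Y]
    and Zp = smooth_vf_at_tangent[OF Z] and Wp = smooth_vf_at_tangent[OF W]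
  note br = lie_bracket_tangent[OF X Y]
  note t = D_tangent[OF Xp D_smooth_at[OF Y Z]] D_tangent[OF Yp D_smooth_at[OF X Z]] D_tangent[OF br Z]
    D_tangent[OF Xp D_smooth_at[OF Y W]] D_tangent[OF Yp D_smooth_at[OF X W]] D_tangent[OF br W]
  note l = tlinear_diff[OF g_linear_left[OF Wp]] and r = tlinear_diff[OF g_linear_right[OF Zp]]
  show ?thesis
    using dir_deriv_lie_bracket[OF X Y g_smooth_at[OF Z W]] D_metric[OF br Z W]
      second_dir_deriv_g[OF Y Xp Z W] second_dir_deriv_g[OF X Yp Z W]
    by (simp add: curvature_op_def l r t)
qed

lemma Riem_skew_right:
  assumes "u \<in> T p" "v \<in> T p" "w \<in> T p" "z \<in> T p"
  shows "g p (Riem A D p u v w) z = - g p (Riem A D p u v z) w"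
  using curvature_skew[OF assms[THEN smooth_vf_extension(1)]] assms[THEN smooth_vf_extension(2)]
    g_sym[OF assms(3) Riem_tangent[OF assms(1,2,4)]]
  by (simp add: Riem_def)


subsection \<open>Fields that are parallel at a point, and the second Bianchi identity\<close>

text \<open>These fields play the role of normal coordinates: at \<open>p\<close>, derivatives of a
  tensor evaluated on them are covariant derivatives of the tensor.\<close>

definition parallel_at :: "'m \<Rightarrow> ('m \<Rightarrow> ('m, 'e) tvec) \<Rightarrow> bool" where
  "parallel_at p X \<longleftrightarrow> smooth_vf_at p X \<and> (\<forall>w\<in>T p. D p w X = 0)"

lemma parallel_atD:
  assumes "parallel_at p X"
  shows "smooth_vf_at p X" "w \<in> T p \<Longrightarrow> D p w X = 0"
  using assms by (auto simp: parallel_at_def)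

text \<open>An arbitrary extension \<open>Y\<close> is corrected by multiples of fields
  \<open>Z b\<close> that extend the derivative of \<open>Y\<close> along the coordinate vectors; at
  \<open>p\<close> the correction vanishes and has the same derivative as \<open>Y\<close>.\<close>

lemma parallel_extension:
  assumes v: "v \<in> T p"
  obtains X where "parallel_at p X" "X p = v"
proof -
  define c where "c = chart_at A p"
  have c: "c \<in> charts_at A p"
    unfolding c_def by (rule chart_at_in)
  define Y where "Y = vf_extension A p v"
  have Y: "smooth_vf_at p Y" "Y p = v"
    using smooth_vf_extension[OF v] by (auto simp: Y_def)
  \<comment> \<open>Coordinates shifted to vanish at \<open>p\<close>, so that the product rule
    there keeps only the derivatives of the coefficients.\<close>
  define h where "h b q = snd c q \<bullet> b - snd c p \<bullet> b" for b q
  define Z where "Z b = vf_extension A p (D p (coord_vec A c p b) Y)" for b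
  have Z: "smooth_vf_at p (Z b)" "Z b p = D p (coord_vec A c p b) Y" for b
    using smooth_vf_extension[OF D_tangent[OF coord_vec_tangent[OF c] Y(1)]] by (auto simp: Z_def)
  have h: "smooth_at p (h b)" for b
    unfolding h_def by (intro smooth_at_diff smooth_coord_at[OF c] smooth_at_const)
  have sm: "smooth_vf_at p (\<lambda>q. h b q *\<^sub>R Z b q)" for b
    by (intro smooth_vf_at_scaleR h Z)
  have sum: "smooth_vf_at p (\<lambda>q. \<Sum>b\<in>Basis. h b q *\<^sub>R Z b q)"
    by (intro smooth_vf_at_sum sm)
  have "D p w (\<lambda>q. Y q - (\<Sum>b\<in>Basis. h b q *\<^sub>R Z b q)) = 0" if w: "w \<in> T p" for w
  proof -
    have dh: "dir_deriv A p w (h b) = w c \<bullet> b" for b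
      unfolding h_def
      by (simp add: dir_deriv_diff smooth_coord_at[OF c] smooth_at_const dir_deriv_coord[OF c w] dir_deriv_const)
    have "D p w (\<lambda>q. h b q *\<^sub>R Z b q) = (w c \<bullet> b) *\<^sub>R D p (coord_vec A c p b) Y" for b
      using D_scaleR[OF w h Z(1), of b b] by (simp add: dh Z(2)) (simp add: h_def)
    moreover have "D p w Y = (\<Sum>b\<in>Basis. (w c \<bullet> b) *\<^sub>R D p (coord_vec A c p b) Y)"
      using tlinear_sum_scaleR[where I=Basis and v="coord_vec A c p" and a="\<lambda>b. w c \<bullet> b",
          OF D_linear[OF Y(1)] coord_vec_tangent[OF c]] tangent_Basis_expand[OF c w] by simp
    ultimately show ?thesis
      by (simp add: D_diff[OF w Y(1) sum] D_sum[OF w finite_Basis sm])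
  qed
  then have "parallel_at p (\<lambda>q. Y q - (\<Sum>b\<in>Basis. h b q *\<^sub>R Z b q))"
    by (simp add: parallel_at_def smooth_vf_at_diff[OF Y(1) sum])
  moreover have "Y p - (\<Sum>b\<in>Basis. h b p *\<^sub>R Z b p) = v"
    by (simp add: h_def Y(2))
  ultimately show thesis
    using that by blast
qed

lemma parallel_lie_bracket: "parallel_at p X \<Longrightarrow> parallel_at p Y \<Longrightarrow> lie_bracket A X Y p = 0"
  using torsion[of p X Y] by (simp add: parallel_atD smooth_vf_at_tangent)

text \<open>The commutator of the two derivatives is a curvature term plus a bracket term; the first
  vanishes because \<open>Z p = 0\<close>, the second because the bracket is 0 at \<open>p\<close>.
  It is applied to first derivatives of a parallel field.\<close>

lemma parallel_D_commute:
  assumes X: "parallel_at p X" and Y: "parallel_at p Y" and Z: "smooth_vf_at p Z" "Z p = 0"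
  shows "D p (X p) (\<lambda>q. D q (Y q) Z) = D p (Y p) (\<lambda>q. D q (X q) Z)"
proof -
  note X' = parallel_atD(1)[OF X] and Y' = parallel_atD(1)[OF Y]
  have "curvature_op A D X Y Z p = 0"
    using tensorial_zero[OF curvature_tensorial[OF X' Y'] Z] .
  then show ?thesis
    by (simp add: curvature_op_def parallel_lie_bracket[OF X Y] tlinear_zero[OF D_linear[OF Z(1)]])
qed

lemma D_Riem_parallel:
  assumes X: "parallel_at p X" and Y: "parallel_at p Y" and Z: "parallel_at p Z" and W: "parallel_at p W"
  shows "D p (X p) (\<lambda>q. Riem A D q (Y q) (Z q) (W q)) =
    D p (X p) (\<lambda>q. D q (Y q) (\<lambda>r. D r (Z r) W)) - D p (X p) (\<lambda>q. D q (Z q) (\<lambda>r. D r (Y r) W))"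
proof -
  note X' = parallel_atD(1)[OF X] and Y' = parallel_atD(1)[OF Y] and Z' = parallel_atD(1)[OF Z]
    and W' = parallel_atD(1)[OF W]
  note Xp = smooth_vf_at_tangent[OF X'] and br = lie_bracket_smooth_at[OF Y' Z']
  note s1 = D_smooth_at[OF Y' D_smooth_at[OF Z' W']] and s2 = D_smooth_at[OF Z' D_smooth_at[OF Y' W']]
    and s3 = D_smooth_at[OF br W']
  have "D p (X p) (\<lambda>q. Riem A D q (Y q) (Z q) (W q)) =
      D p (X p) (\<lambda>q. D q (Y q) (\<lambda>r. D r (Z r) W) - D q (Z q) (\<lambda>r. D r (Y r) W) - D q (lie_bracket A Y Z q) W)"
  proof (rule D_cong[OF Xp smooth_vf_at_diff[OF smooth_vf_at_diff[OF s1 s2] s3]])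
    show "\<forall>\<^sub>F q in nhds p. Riem A D q (Y q) (Z q) (W q) =
        D q (Y q) (\<lambda>r. D r (Z r) W) - D q (Z q) (\<lambda>r. D r (Y r) W) - D q (lie_bracket A Y Z q) W"
      using Y'[THEN smooth_vf_at_eventually] Z'[THEN smooth_vf_at_eventually] W'[THEN smooth_vf_at_eventually]
      by eventually_elim (simp add: Riem_curvature curvature_op_def)
  qed
  \<comment> \<open>The bracket vanishes only at \<open>p\<close>, so its derivative may survive.
    Tensoriality of \<open>second_cov\<close> leaves a derivative of \<open>W\<close> along the
    derivative of the bracket, and this is 0 since \<open>W\<close> is parallel at
    \<open>p\<close>.\<close>
  moreover have "D p (X p) (\<lambda>q. D q (lie_bracket A Y Z q) W) = 0"
    using tensorial_zero[OF second_cov_tensorial[OF Xp W'] br parallel_lie_bracket[OF Y Z]]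
      parallel_atD(2)[OF W D_tangent[OF Xp br]] by (simp add: second_cov_def)
  ultimately show ?thesis
    by (simp add: D_diff[OF Xp smooth_vf_at_diff[OF s1 s2] s3] D_diff[OF Xp s1 s2])
qed

text \<open>For fields parallel at \<open>p\<close> the bracket terms vanish at \<open>p\<close>, so that neither commuting fields
  nor the Jacobi identity are needed.\<close>

lemma second_Bianchi:
  assumes X: "parallel_at p X" and Y: "parallel_at p Y" and Z: "parallel_at p Z" and W: "parallel_at p W"
  shows "D p (X p) (\<lambda>q. Riem A D q (Y q) (Z q) (W q)) + D p (Y p) (\<lambda>q. Riem A D q (Z q) (X q) (W q)) +
    D p (Z p) (\<lambda>q. Riem A D q (X q) (Y q) (W q)) = 0"
proof -
  \<comment> \<open>First derivatives of \<open>W\<close> vanish at \<open>p\<close>, so the two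
    outer derivatives in each third derivative commute there, and the six terms cancel in
    pairs.\<close>
  have W0: "smooth_vf_at p (\<lambda>q. D q (V q) W)" "D p (V p) W = 0" if "parallel_at p V" for V
    using D_smooth_at parallel_atD[OF W] parallel_atD(1)[OF that] smooth_vf_at_tangent by auto
  show ?thesis
    by (simp add: D_Riem_parallel[OF X Y Z W] D_Riem_parallel[OF Y Z X W] D_Riem_parallel[OF Z X Y W]
        parallel_D_commute[OF X Y W0[OF Z]] parallel_D_commute[OF Y Z W0[OF X]]
        parallel_D_commute[OF Z X W0[OF Y]])
qed


subsection \<open>Covariant derivative and trace of endomorphism fields\<close>

text \<open>A (1,1)-tensor field near \<open>p\<close>, with smoothness tested by its action on
  vector fields.\<close>

definition endo_at :: "'m \<Rightarrow> ('m \<Rightarrow> ('m, 'e) tvec \<Rightarrow> ('m, 'e) tvec) \<Rightarrow> bool" where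
  "endo_at p L \<longleftrightarrow> (\<forall>\<^sub>F q in nhds p. tlinear q (L q) \<and> (\<forall>v\<in>T q. L q v \<in> T q)) \<and>
    (\<forall>X. smooth_vf_at p X \<longrightarrow> smooth_vf_at p (\<lambda>q. L q (X q)))"

lemma endo_atD:
  assumes "endo_at p L"
  shows "\<forall>\<^sub>F q in nhds p. tlinear q (L q)" "\<forall>\<^sub>F q in nhds p. \<forall>v\<in>T q. L q v \<in> T q"
    "smooth_vf_at p X \<Longrightarrow> smooth_vf_at p (\<lambda>q. L q (X q))" "tlinear p (L p)" "v \<in> T p \<Longrightarrow> L p v \<in> T p"
  using assms eventually_nhds_x_imp_x[of "\<lambda>q. tlinear q (L q) \<and> (\<forall>v\<in>T q. L q v \<in> T q)" p]
  by (auto simp: endo_at_def eventually_conj_iff)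

lemma cov_endo_tensorial:
  assumes L: "endo_at p L" and v: "v \<in> T p"
  shows "tensorial p (\<lambda>E. D p v (\<lambda>q. L q (E q)) - L p (D p v E))"
proof (rule tensorialI)
  note lin = endo_atD(4)[OF L] and sm = endo_atD(3)[OF L]
  {
    fix X Y assume X: "smooth_vf_at p X" and Y: "smooth_vf_at p Y"
    have "D p v (\<lambda>q. L q (X q + Y q)) = D p v (\<lambda>q. L q (X q) + L q (Y q))"
    proof (rule D_cong[OF v smooth_vf_at_add[OF sm[OF X] sm[OF Y]]])
      show "\<forall>\<^sub>F q in nhds p. L q (X q + Y q) = L q (X q) + L q (Y q)"
        using X[THEN smooth_vf_at_eventually] Y[THEN smooth_vf_at_eventually] endo_atD(1)[OF L]
        by eventually_elim (rule tlinear_add[OF _ smooth_vf_at_tangent smooth_vf_at_tangent])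
    qed
    then show "D p v (\<lambda>q. L q (X q + Y q)) - L p (D p v (\<lambda>q. X q + Y q)) =
        D p v (\<lambda>q. L q (X q)) - L p (D p v X) + (D p v (\<lambda>q. L q (Y q)) - L p (D p v Y))"
      by (simp add: D_add[OF v X Y] D_add[OF v sm[OF X] sm[OF Y]]
          tlinear_add[OF lin D_tangent[OF v X] D_tangent[OF v Y]])
  next
    fix h Y assume h: "smooth_at p h" and Y: "smooth_vf_at p Y"
    note Yp = smooth_vf_at_tangent[OF Y]
    have "D p v (\<lambda>q. L q (h q *\<^sub>R Y q)) = D p v (\<lambda>q. h q *\<^sub>R L q (Y q))"
    proof (rule D_cong[OF v smooth_vf_at_scaleR[OF h sm[OF Y]]])
      show "\<forall>\<^sub>F q in nhds p. L q (h q *\<^sub>R Y q) = h q *\<^sub>R L q (Y q)"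
        using Y[THEN smooth_vf_at_eventually] endo_atD(1)[OF L]
        by eventually_elim (rule tlinear_scaleR[OF _ smooth_vf_at_tangent])
    qed
    then show "D p v (\<lambda>q. L q (h q *\<^sub>R Y q)) - L p (D p v (\<lambda>q. h q *\<^sub>R Y q)) =
        h p *\<^sub>R (D p v (\<lambda>q. L q (Y q)) - L p (D p v Y))"
      using D_tangent[OF v Y] Yp
      by (simp add: D_scaleR[OF v h Y] D_scaleR[OF v h sm[OF Y]] tlinear_add[OF lin] tlinear_scaleR[OF lin]
          scaleR_diff_right)
  next
    fix Y Z assume Y: "smooth_vf_at p Y" and ZY: "\<forall>\<^sub>F q in nhds p. Z q = Y q"
    have "D p v (\<lambda>q. L q (Z q)) = D p v (\<lambda>q. L q (Y q))"
      by (rule D_cong[OF v sm[OF Y]]) (use ZY in eventually_elim, simp)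
    then show "D p v (\<lambda>q. L q (Z q)) - L p (D p v Z) = D p v (\<lambda>q. L q (Y q)) - L p (D p v Y)"
      by (simp add: D_cong[OF v Y ZY])
  }
qed

lemma cov_endo_field:
  assumes "endo_at p L" "v \<in> T p" "smooth_vf_at p E"
  shows "cov_endo A D p v L (E p) = D p v (\<lambda>q. L q (E q)) - L p (D p v E)"
  unfolding cov_endo_def
  by (rule tensorial_eq[OF cov_endo_tensorial[OF assms(1,2)]])
    (simp_all add: assms smooth_vf_extension smooth_vf_at_tangent)

lemma cov_endo_linear: "endo_at p L \<Longrightarrow> v \<in> T p \<Longrightarrow> tlinear p (cov_endo A D p v L)"
  using tensorial_linear[OF cov_endo_tensorial, of p L v] unfolding cov_endo_def[abs_def] .

lemma cov_endo_tangent: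
  assumes "endo_at p L" "v \<in> T p" "e \<in> T p"
  shows "cov_endo A D p v L e \<in> T p"
  unfolding cov_endo_def
  using D_tangent[OF assms(2) endo_atD(3)[OF assms(1) smooth_vf_extension(1)[OF assms(3)]]]
    endo_atD(5)[OF assms(1) D_tangent[OF assms(2) smooth_vf_extension(1)[OF assms(3)]]]
  by simp

text \<open>The trace is computed in a frame orthonormal near \<open>p\<close>. Differentiating the
  frame fields produces the coefficients \<open>\<omega>\<close>, which are skew, so their two
  contributions cancel in the sum and only \<open>cov_endo\<close> remains.\<close>

lemma trace_deriv:
  assumes L: "endo_at p L"
  shows smooth_at_trace: "smooth_at p (\<lambda>q. trace_at A q (L q))"
    and dir_deriv_trace: "v \<in> T p \<Longrightarrow>
      dir_deriv A p v (\<lambda>q. trace_at A q (L q)) = trace_at A p (cov_endo A D p v L)"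
proof -
  obtain E where E: "\<And>b. b \<in> Basis \<Longrightarrow> smooth_vf_at p (E b)" and onb: "\<forall>\<^sub>F q in nhds p. onb q (\<lambda>b. E b q)"
    using orthonormal_frame by blast
  have e: "onb p (\<lambda>b. E b p)"
    using eventually_nhds_x_imp_x[OF onb] .
  note ET = onb_tangent[OF e]
  have ev: "\<forall>\<^sub>F q in nhds p. trace_at A q (L q) = (\<Sum>b\<in>Basis. g q (L q (E b q)) (E b q))"
    using onb endo_atD(1,2)[OF L] by eventually_elim (rule trace_at_onb, auto)
  have sm: "smooth_at p (\<lambda>q. g q (L q (E b q)) (E b q))" if "b \<in> Basis" for b
    by (intro g_smooth_at endo_atD(3)[OF L] E that)
  have sums: "smooth_at p (\<lambda>q. \<Sum>b\<in>Basis. g q (L q (E b q)) (E b q))"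
    by (intro smooth_at_sum sm)
  show "smooth_at p (\<lambda>q. trace_at A q (L q))"
    by (rule smooth_at_cong[OF sums ev])
  assume v: "v \<in> T p"
  define \<omega> where "\<omega> b d = g p (D p v (E b)) (E d p)" for b d
  define G where "G b d = g p (L p (E b p)) (E d p)" for b d
  have DT: "D p v (E b) \<in> T p" if "b \<in> Basis" for b
    by (intro D_tangent v E that)
  \<comment> \<open>The inner products of the frame fields are constant near \<open>p\<close>, so
    their derivatives vanish.\<close>
  have skew: "\<omega> b d = - \<omega> d b" if b: "b \<in> Basis" and d: "d \<in> Basis" for b d
  proof -
    have "dir_deriv A p v (\<lambda>q. g q (E b q) (E d q)) = dir_deriv A p v (\<lambda>q. if b = d then 1 else 0)"
    proof (rule dir_deriv_cong[OF smooth_at_const])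
      show "\<forall>\<^sub>F q in nhds p. g q (E b q) (E d q) = (if b = d then 1 else 0)"
        using onb by eventually_elim (rule onb_orthonormal[OF _ b d])
    qed
    then show ?thesis
      using D_metric[OF v E[OF b] E[OF d]] g_sym[OF ET[OF b] DT[OF d]]
      by (simp add: dir_deriv_const \<omega>_def)
  qed
  have summand: "dir_deriv A p v (\<lambda>q. g q (L q (E b q)) (E b q)) =
      g p (cov_endo A D p v L (E b p)) (E b p) + ((\<Sum>d\<in>Basis. \<omega> b d * G d b) + (\<Sum>d\<in>Basis. \<omega> b d * G b d))"
    if b: "b \<in> Basis" for b
  proof -
    have "D p v (\<lambda>q. L q (E b q)) = cov_endo A D p v L (E b p) + L p (D p v (E b))"
      by (simp add: cov_endo_field[OF L v E[OF b]])
    then have "g p (D p v (\<lambda>q. L q (E b q))) (E b p) =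
        g p (cov_endo A D p v L (E b p)) (E b p) + g p (L p (D p v (E b))) (E b p)"
      using tlinear_add[OF g_linear_left[OF ET[OF b]] cov_endo_tangent[OF L v ET[OF b]] endo_atD(5)[OF L DT[OF b]]]
      by simp
    moreover have "g p (L p (D p v (E b))) (E b p) = (\<Sum>d\<in>Basis. \<omega> b d * G d b)"
      using onb_expand_linear[OF e endo_atD(4)[OF L] DT[OF b]]
        tlinear_sum_scaleR[where I=Basis and v="\<lambda>d. L p (E d p)" and a="\<omega> b",
          OF g_linear_left[OF ET[OF b]] endo_atD(5)[OF L ET]]
      by (simp add: \<omega>_def G_def)
    moreover have "g p (L p (E b p)) (D p v (E b)) = (\<Sum>d\<in>Basis. \<omega> b d * G b d)"
      using onb_expand_linear[OF e g_linear_right[OF endo_atD(5)[OF L ET[OF b]]] DT[OF b]]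
      by (simp add: \<omega>_def G_def)
    ultimately show ?thesis
      by (simp add: D_metric[OF v endo_atD(3)[OF L E[OF b]] E[OF b]])
  qed
  have "(\<Sum>b\<in>Basis. \<Sum>d\<in>Basis. \<omega> b d * G b d) = (\<Sum>b\<in>Basis. \<Sum>d\<in>Basis. \<omega> d b * G d b)"
    by (rule sum.swap)
  also have "\<dots> = (\<Sum>b\<in>Basis. \<Sum>d\<in>Basis. - (\<omega> b d * G d b))"
    using skew by (intro sum.cong refl) (metis mult_minus_left)
  finally have cancel: "(\<Sum>b\<in>Basis. \<Sum>d\<in>Basis. \<omega> b d * G d b) + (\<Sum>b\<in>Basis. \<Sum>d\<in>Basis. \<omega> b d * G b d) = 0"
    by (simp add: sum_negf)
  have "dir_deriv A p v (\<lambda>q. trace_at A q (L q)) =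
      (\<Sum>b\<in>Basis. dir_deriv A p v (\<lambda>q. g q (L q (E b q)) (E b q)))"
    using dir_deriv_cong[OF sums ev, of v] dir_deriv_sum[OF finite_Basis sm, of "\<lambda>b. b" v] by simp
  also have "\<dots> = (\<Sum>b\<in>Basis. g p (cov_endo A D p v L (E b p)) (E b p))"
    using cancel by (simp add: summand sum.distrib)
  also have "\<dots> = trace_at A p (cov_endo A D p v L)"
    using trace_at_onb[OF e cov_endo_linear[OF L v] cov_endo_tangent[OF L v]] by simp
  finally show "dir_deriv A p v (\<lambda>q. trace_at A q (L q)) = trace_at A p (cov_endo A D p v L)" .
qed

lemma Riem_endo_at:
  assumes Y: "smooth_vf_at p Y" and Z: "smooth_vf_at p Z"
  shows "endo_at p (\<lambda>q u. Riem A D q u (Y q) (Z q))"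
proof -
  have "\<forall>\<^sub>F q in nhds p. tlinear q (\<lambda>u. Riem A D q u (Y q) (Z q)) \<and> (\<forall>v\<in>T q. Riem A D q v (Y q) (Z q) \<in> T q)"
    using Y[THEN smooth_vf_at_eventually] Z[THEN smooth_vf_at_eventually]
    by eventually_elim (simp add: Riem_linear_left Riem_tangent smooth_vf_at_tangent)
  then show ?thesis
    using Riem_smooth_at[OF _ Y Z] by (simp add: endo_at_def)
qed

text \<open>The Ricci form of two fields is the trace of an endomorphism field, so
  \<open>trace_deriv\<close> applies; on fields parallel at \<open>p\<close> the correction in
  \<open>cov_endo\<close> vanishes.\<close>

lemma dir_deriv_ric_parallel:
  assumes e: "onb p (\<lambda>b. X b p)" and X: "\<And>b. b \<in> Basis \<Longrightarrow> parallel_at p (X b)"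
    and Y: "smooth_vf_at p Y" and Z: "smooth_vf_at p Z" and v: "v \<in> T p"
  shows "dir_deriv A p v (\<lambda>q. ric_form A D q (Y q) (Z q)) =
    (\<Sum>a\<in>Basis. g p (D p v (\<lambda>q. Riem A D q (X a q) (Y q) (Z q))) (X a p))"
proof -
  note L = Riem_endo_at[OF Y Z]
  have "cov_endo A D p v (\<lambda>q u. Riem A D q u (Y q) (Z q)) (X a p) =
      D p v (\<lambda>q. Riem A D q (X a q) (Y q) (Z q))" if a: "a \<in> Basis" for a
    using cov_endo_field[OF L v parallel_atD(1)[OF X[OF a]]] tlinear_zero[OF endo_atD(4)[OF L]]
    by (simp add: parallel_atD(2)[OF X[OF a] v])
  then show ?thesis
    unfolding ric_form_def dir_deriv_trace[OF L v]
    by (simp add: trace_at_onb[OF e cov_endo_linear[OF L v] cov_endo_tangent[OF L v]])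
qed

lemma sharp_eqI:
  assumes "w \<in> T p" "\<And>u. u \<in> T p \<Longrightarrow> g p w u = \<omega> u"
  shows "sharp A g p \<omega> = w"
  unfolding sharp_def
  by (rule the_equality) (use assms g_nondegenerate in auto)

text \<open>Both Hessian terms come from iterated derivatives of \<open>h\<close>. Their commutator
  is the derivative along the bracket, and torsion-freeness matches it with the remaining
  terms.\<close>

lemma hess_symmetric:
  assumes h: "\<And>q. smooth_at q h" and u: "u \<in> T p" and w: "w \<in> T p"
  shows "g p (hess_op A g D h p u) w = g p (hess_op A g D h p w) u"
proof -
  define G where "G = grad A g h"
  have G: "smooth_vf_at q G" for q
    unfolding G_def by (rule grad_smooth_at[OF h])
  define X where "X = vf_extension A p u"
  define Y where "Y = vf_extension A p w"
  have X: "smooth_vf_at p X" "X p = u" and Y: "smooth_vf_at p Y" "Y p = w"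
    using smooth_vf_extension u w by (auto simp: X_def Y_def)
  have *: "dir_deriv A p v (\<lambda>q. dir_deriv A q (V q) h) = g p (D p v G) (V p) + g p (G p) (D p v V)"
    if V: "smooth_vf_at p V" and v: "v \<in> T p" for V v
  proof -
    have "dir_deriv A p v (\<lambda>q. dir_deriv A q (V q) h) = dir_deriv A p v (\<lambda>q. g q (G q) (V q))"
    proof (rule dir_deriv_cong[OF g_smooth_at[OF G V]])
      show "\<forall>\<^sub>F q in nhds p. dir_deriv A q (V q) h = g q (G q) (V q)"
        using V[THEN smooth_vf_at_eventually]
        by eventually_elim (simp add: G_def g_grad[OF h] smooth_vf_at_tangent)
    qed
    then show ?thesis
      by (simp only: D_metric[OF v G V])
  qed
  have "g p (G p) (lie_bracket A X Y p) = dir_deriv A p (lie_bracket A X Y p) h"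
    unfolding G_def by (rule g_grad[OF h lie_bracket_tangent[OF X(1) Y(1)]])
  moreover have "g p (G p) (lie_bracket A X Y p) = g p (G p) (D p u Y) - g p (G p) (D p w X)"
    using tlinear_diff[OF g_linear_right[OF smooth_vf_at_tangent[OF G]] D_tangent[OF u Y(1)] D_tangent[OF w X(1)]]
    by (simp add: torsion[OF X(1) Y(1)] X Y)
  ultimately show ?thesis
    using dir_deriv_lie_bracket[OF X(1) Y(1) h] *[OF Y(1) u] *[OF X(1) w]
    by (simp add: X Y hess_op_def G_def[symmetric])
qed

end


subsection \<open>Gradient Ricci solitons\<close>

locale ricci_soliton = riemannian_manifold A g D
  for A :: "('m::{t2_space,second_countable_topology}, 'e::euclidean_space) chart set"
    and g :: "('m, 'e) metric" and D :: "('m, 'e) connection" +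
  fixes f :: "'m \<Rightarrow> real" and lam :: real
  assumes smooth: "smooth_fun A UNIV f"
    and soliton: "\<And>p v w. v \<in> tangent_space A p \<Longrightarrow> w \<in> tangent_space A p \<Longrightarrow>
          ric_form A D p v w + hess_form A g D f p v w = lam * g p v w"
begin

abbreviation "gradf \<equiv> grad A g f"
abbreviation "S \<equiv> hess_op A g D f"
abbreviation "Rc \<equiv> Ric A g D"
abbreviation "sc \<equiv> scal A g D"
abbreviation "cov \<equiv> cov_endo A D"

lemma smooth_at_f: "smooth_at p f"
  unfolding smooth_fun_near_def using smooth by blast

lemma gradf_smooth_at: "smooth_vf_at p gradf"
  by (rule grad_smooth_at[OF smooth_at_f])

lemma gradf_tangent: "gradf p \<in> T p"
  by (rule grad_tangent[OF smooth_at_f])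

lemma S_linear: "tlinear p (S p)"
  using D_linear[OF gradf_smooth_at] by (simp add: hess_op_def[abs_def])

lemma S_tangent: "v \<in> T p \<Longrightarrow> S p v \<in> T p"
  using D_tangent[OF _ gradf_smooth_at] by (simp add: hess_op_def)

lemma S_smooth_at: "smooth_vf_at p X \<Longrightarrow> smooth_vf_at p (\<lambda>q. S q (X q))"
  using D_smooth_at[OF _ gradf_smooth_at] by (simp add: hess_op_def)

lemma S_endo_at: "endo_at p S"
  by (simp add: endo_at_def S_linear S_tangent S_smooth_at)

lemma S_symmetric: "u \<in> T p \<Longrightarrow> w \<in> T p \<Longrightarrow> g p (S p u) w = g p (S p w) u"
  by (rule hess_symmetric[OF smooth_at_f])

lemma ric_form_eq:
  "v \<in> T p \<Longrightarrow> w \<in> T p \<Longrightarrow> ric_form A D p v w = lam * g p v w - g p (S p v) w"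
  using soliton[of v p w] by (simp add: hess_form_def)

lemma Ric_eq: "v \<in> T p \<Longrightarrow> Rc p v = lam *\<^sub>R v - S p v"
  unfolding Ric_def
  by (rule sharp_eqI)
    (simp_all add: S_tangent ric_form_eq tlinear_diff[OF g_linear_left] tlinear_scaleR[OF g_linear_left])

lemma Ric_endo_at: "endo_at p Rc"
proof -
  have "tlinear q (Rc q)" for q
    by (rule tlinearI)
      (simp_all add: Ric_eq S_tangent tlinear_add[OF S_linear] tlinear_scaleR[OF S_linear] scaleR_add_right scaleR_diff_right)
  moreover have "smooth_vf_at p (\<lambda>q. Rc q (X q))" if X: "smooth_vf_at p X" for X
  proof (rule smooth_vf_at_cong)
    show "smooth_vf_at p (\<lambda>q. lam *\<^sub>R X q - S q (X q))"
      by (intro smooth_vf_at_diff smooth_vf_at_cmult S_smooth_at X)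
    show "\<forall>\<^sub>F q in nhds p. Rc q (X q) = lam *\<^sub>R X q - S q (X q)"
      using X[THEN smooth_vf_at_eventually] by eventually_elim (rule Ric_eq[OF smooth_vf_at_tangent])
  qed
  ultimately show ?thesis
    by (simp add: endo_at_def Ric_eq S_tangent)
qed

text \<open>The multiple \<open>lam I\<close> of the identity is parallel, so only
  \<open>- S\<close> contributes.\<close>

lemma cov_Ric:
  assumes v: "v \<in> T p" and e: "e \<in> T p"
  shows "cov p v Rc e = - cov p v S e"
proof -
  define E where "E = vf_extension A p e"
  have E: "smooth_vf_at p E"
    using smooth_vf_extension[OF e] by (simp add: E_def)
  have "D p v (\<lambda>q. Rc q (E q)) = D p v (\<lambda>q. lam *\<^sub>R E q - S q (E q))"
  proof (rule D_cong[OF v])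
    show "smooth_vf_at p (\<lambda>q. lam *\<^sub>R E q - S q (E q))"
      by (intro smooth_vf_at_diff smooth_vf_at_cmult S_smooth_at E)
    show "\<forall>\<^sub>F q in nhds p. Rc q (E q) = lam *\<^sub>R E q - S q (E q)"
      using E[THEN smooth_vf_at_eventually] by eventually_elim (rule Ric_eq[OF smooth_vf_at_tangent])
  qed
  also have "\<dots> = lam *\<^sub>R D p v E - D p v (\<lambda>q. S q (E q))"
    by (simp add: D_diff[OF v smooth_vf_at_cmult[OF E] S_smooth_at[OF E]] D_cmult[OF v E])
  finally show ?thesis
    by (simp add: cov_endo_def E_def[symmetric] Ric_eq[OF D_tangent[OF v E]])
qed

lemma scal_smooth_at: "smooth_at p sc"
  using smooth_at_trace[OF Ric_endo_at] by (simp add: scal_def[abs_def])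

lemma dir_deriv_scal: "v \<in> T p \<Longrightarrow> dir_deriv A p v sc = trace_at A p (cov p v Rc)"
  using dir_deriv_trace[OF Ric_endo_at] by (simp add: scal_def[abs_def])

text \<open>For the gradient field, the second covariant derivative is by definition the covariant
  derivative of \<open>S\<close>.\<close>

lemma Riem_gradf:
  assumes u: "u \<in> T p" and v: "v \<in> T p"
  shows "Riem A D p u v (gradf p) = cov p u S v - cov p v S u"
  using Riem_second_cov[OF u v gradf_smooth_at]
  by (simp add: second_cov_def cov_endo_def hess_op_def)

section \<open>The contracted Bianchi identity and the scalar curvature\<close>

text \<open>The left side is the derivative of the Ricci form. By the soliton equation it splits
  into a multiple of \<open>g(Y, Z)\<close>, with derivative 0 since both fields are parallel at
  \<open>p\<close>, and the Hessian part.\<close>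

lemma sum_D_Riem_parallel:
  assumes e: "onb p (\<lambda>b. X b p)" and X: "\<And>b. b \<in> Basis \<Longrightarrow> parallel_at p (X b)"
    and Y: "parallel_at p Y" and Z: "parallel_at p Z" and v: "v \<in> T p"
  shows "(\<Sum>a\<in>Basis. g p (D p v (\<lambda>q. Riem A D q (X a q) (Y q) (Z q))) (X a p)) = - g p (cov p v S (Y p)) (Z p)"
proof -
  note Y' = parallel_atD(1)[OF Y] and Z' = parallel_atD(1)[OF Z]
  note sm = g_smooth_at[OF S_smooth_at[OF Y'] Z'] and sm' = smooth_at_mult[OF smooth_at_const g_smooth_at[OF Y' Z']]
  have "dir_deriv A p v (\<lambda>q. ric_form A D q (Y q) (Z q)) =
      dir_deriv A p v (\<lambda>q. lam * g q (Y q) (Z q) - g q (S q (Y q)) (Z q))"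
  proof (rule dir_deriv_cong[OF smooth_at_diff[OF sm' sm]])
    show "\<forall>\<^sub>F q in nhds p. ric_form A D q (Y q) (Z q) = lam * g q (Y q) (Z q) - g q (S q (Y q)) (Z q)"
      using Y'[THEN smooth_vf_at_eventually] Z'[THEN smooth_vf_at_eventually]
      by eventually_elim (rule ric_form_eq[OF smooth_vf_at_tangent smooth_vf_at_tangent])
  qed
  also have "\<dots> = - g p (D p v (\<lambda>q. S q (Y q))) (Z p)"
    using smooth_vf_at_tangent[OF Y'] smooth_vf_at_tangent[OF Z']
    by (simp add: dir_deriv_diff[OF sm' sm] dir_deriv_mult[OF smooth_at_const g_smooth_at[OF Y' Z']] dir_deriv_const
        D_metric[OF v Y' Z'] D_metric[OF v S_smooth_at[OF Y'] Z'] parallel_atD(2)[OF Y v] parallel_atD(2)[OF Z v]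
        tlinear_zero[OF g_linear_left] tlinear_zero[OF g_linear_right] S_tangent)
  also have "D p v (\<lambda>q. S q (Y q)) = cov p v S (Y p)"
    by (simp add: cov_endo_field[OF S_endo_at v Y'] parallel_atD(2)[OF Y v] tlinear_zero[OF S_linear])
  finally show ?thesis
    using dir_deriv_ric_parallel[OF e X Y' Z' v] by simp
qed

text \<open>Contracting the second Bianchi identity twice leaves only derivatives of the Ricci tensor, which
  are those of \<open>- S\<close>; the sum on the left is the divergence of \<open>S\<close>.\<close>

lemma contracted_Bianchi:
  assumes e: "onb p e" and y: "y \<in> T p"
  shows "2 * (\<Sum>b\<in>Basis. g p (cov p (e b) S y) (e b)) = trace_at A p (cov p y S)"
proof -
  have "\<forall>b. \<exists>X. b \<in> Basis \<longrightarrow> parallel_at p X \<and> X p = e b"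
    using parallel_extension onb_tangent[OF e] by metis
  then obtain X where X: "\<And>b. b \<in> Basis \<Longrightarrow> parallel_at p (X b)" "\<And>b. b \<in> Basis \<Longrightarrow> X b p = e b"
    by metis
  obtain Y where Y: "parallel_at p Y" "Y p = y"
    using parallel_extension[OF y] by blast
  have e': "onb p (\<lambda>b. X b p)"
    using e X(2) by (simp add: onb_def)
  note X' = parallel_atD(1)[OF X(1)] and Y' = parallel_atD(1)[OF Y(1)]
  note eT = onb_tangent[OF e]
  \<comment> \<open>The second Bianchi identity for \<open>X a\<close>, \<open>X b\<close>,
    \<open>Y\<close> acting on \<open>X b\<close> reads \<open>P - Q + K = 0\<close>. Paired with
    \<open>e a\<close> and summed, \<open>P\<close> and \<open>- Q\<close> each give the divergence
    of \<open>S\<close> at \<open>y\<close>, and \<open>K\<close> gives minus the trace.\<close>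
  define P where "P a b = D p (e a) (\<lambda>q. Riem A D q (X b q) (Y q) (X b q))" for a b
  define Q where "Q a b = D p (e b) (\<lambda>q. Riem A D q (X a q) (Y q) (X b q))" for a b
  define K where "K a b = D p y (\<lambda>q. Riem A D q (X a q) (X b q) (X b q))" for a b
  have T: "P a b \<in> T p" "Q a b \<in> T p" "K a b \<in> T p" if "a \<in> Basis" "b \<in> Basis" for a b
    using that by (simp_all add: P_def Q_def K_def D_tangent eT y Riem_smooth_at X' Y')
  have bianchi: "g p (P a b) (e a) - g p (Q a b) (e a) + g p (K a b) (e a) = 0"
    if a: "a \<in> Basis" and b: "b \<in> Basis" for a b
  proof -
    note sm = Riem_smooth_at[OF X'[OF a] Y' X'[OF b]]
    have "D p (e b) (\<lambda>q. Riem A D q (Y q) (X a q) (X b q)) =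
        D p (e b) (\<lambda>q. - Riem A D q (X a q) (Y q) (X b q))"
    proof (rule D_cong[OF eT[OF b] smooth_vf_at_minus[OF sm]])
      show "\<forall>\<^sub>F q in nhds p. Riem A D q (Y q) (X a q) (X b q) = - Riem A D q (X a q) (Y q) (X b q)"
        using X'[OF a, THEN smooth_vf_at_eventually] X'[OF b, THEN smooth_vf_at_eventually]
          Y'[THEN smooth_vf_at_eventually]
        by eventually_elim (intro Riem_skew_left smooth_vf_at_tangent)
    qed
    also have "\<dots> = - Q a b"
      unfolding Q_def by (rule D_minus[OF eT[OF b] sm])
    finally have "P a b - Q a b + K a b = 0"
      using second_Bianchi[OF X(1)[OF a] X(1)[OF b] Y(1) X(1)[OF b]] a b
      by (simp add: P_def K_def X(2) Y(2))
    then have "g p (P a b - Q a b + K a b) (e a) = 0"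
      using tlinear_zero[OF g_linear_left[OF eT[OF a]]] by simp
    then show ?thesis
      using T[OF a b]
      by (simp add: tlinear_add[OF g_linear_left[OF eT[OF a]]] tlinear_diff[OF g_linear_left[OF eT[OF a]]])
  qed
  \<comment> \<open>In \<open>P\<close> the index \<open>b\<close> sits in the first and third slot,
    while a Ricci contraction joins the first and the last. Skewness in the last two slots,
    differentiated at \<open>p\<close>, moves it there.\<close>
  have P_skew: "g p (P a b) (e a) = - g p (D p (e a) (\<lambda>q. Riem A D q (X b q) (Y q) (X a q))) (e b)"
    if a: "a \<in> Basis" and b: "b \<in> Basis" for a b
  proof -
    note sm = Riem_smooth_at[OF X'[OF b] Y' X'[OF b]] and sm' = Riem_smooth_at[OF X'[OF b] Y' X'[OF a]]
    have "dir_deriv A p (e a) (\<lambda>q. g q (Riem A D q (X b q) (Y q) (X b q)) (X a q)) =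
        dir_deriv A p (e a) (\<lambda>q. - g q (Riem A D q (X b q) (Y q) (X a q)) (X b q))"
    proof (rule dir_deriv_cong[OF smooth_at_minus[OF g_smooth_at[OF sm' X'[OF b]]]])
      show "\<forall>\<^sub>F q in nhds p. g q (Riem A D q (X b q) (Y q) (X b q)) (X a q) =
          - g q (Riem A D q (X b q) (Y q) (X a q)) (X b q)"
        using X'[OF a, THEN smooth_vf_at_eventually] X'[OF b, THEN smooth_vf_at_eventually]
          Y'[THEN smooth_vf_at_eventually]
        by eventually_elim (intro Riem_skew_right smooth_vf_at_tangent)
    qed
    then show ?thesis
      using X(2)[OF a] X(2)[OF b] smooth_vf_at_tangent[OF sm] smooth_vf_at_tangent[OF sm']
      by (simp add: P_def dir_deriv_minus[OF g_smooth_at[OF sm' X'[OF b]]] D_metric[OF eT[OF a] sm X'[OF a]]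
          D_metric[OF eT[OF a] sm' X'[OF b]] parallel_atD(2)[OF X(1) eT] a b tlinear_zero[OF g_linear_right])
  qed
  have contract: "(\<Sum>a\<in>Basis. g p (D p v (\<lambda>q. Riem A D q (X a q) (V q) (W q))) (e a)) =
      - g p (cov p v S (V p)) (W p)" if "parallel_at p V" "parallel_at p W" "v \<in> T p" for v V W
    using sum_D_Riem_parallel[OF e' X(1) that] X(2) by simp
  have "(\<Sum>b\<in>Basis. \<Sum>a\<in>Basis. g p (P a b) (e a)) =
      (\<Sum>a\<in>Basis. - (\<Sum>b\<in>Basis. g p (D p (e a) (\<lambda>q. Riem A D q (X b q) (Y q) (X a q))) (e b)))"
    by (subst sum.swap) (simp add: P_skew sum_negf)
  also have "\<dots> = (\<Sum>b\<in>Basis. g p (cov p (e b) S y) (e b))"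
    using contract[OF Y(1) X(1) eT] by (simp add: X(2) Y(2))
  finally have 1: "(\<Sum>b\<in>Basis. \<Sum>a\<in>Basis. g p (P a b) (e a)) = (\<Sum>b\<in>Basis. g p (cov p (e b) S y) (e b))" .
  have 2: "(\<Sum>b\<in>Basis. \<Sum>a\<in>Basis. g p (Q a b) (e a)) = - (\<Sum>b\<in>Basis. g p (cov p (e b) S y) (e b))"
    using contract[OF Y(1) X(1) eT] by (simp add: Q_def X(2) Y(2) sum_negf)
  have 3: "(\<Sum>b\<in>Basis. \<Sum>a\<in>Basis. g p (K a b) (e a)) = - trace_at A p (cov p y S)"
    using contract[OF X(1) X(1) y]
      trace_at_onb[OF e cov_endo_linear[OF S_endo_at y] cov_endo_tangent[OF S_endo_at y]]
    by (simp add: K_def X(2) sum_negf)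
  have "(\<Sum>b\<in>Basis. \<Sum>a\<in>Basis. g p (P a b) (e a) - g p (Q a b) (e a) + g p (K a b) (e a)) = 0"
    using bianchi by simp
  then show ?thesis
    using 1 2 3 by (simp add: sum.distrib sum_subtractf)
qed

text \<open>With \<open>t\<close> the trace of the derivative of \<open>S\<close> along
  \<open>y\<close>, the trace of \<open>Riem_gradf\<close> is the divergence minus \<open>t\<close>,
  that is \<open>t/2 - t\<close>. Since \<open>t\<close> is minus the derivative of
  \<open>scal\<close>, this is the source of the factor 2.\<close>

lemma dir_deriv_scal_ric:
  assumes y: "y \<in> T p"
  shows "dir_deriv A p y sc = 2 * ric_form A D p y (gradf p)"
proof -
  obtain e where e: "onb p e"
    by (rule onb_exists)
  note eT = onb_tangent[OF e] and G = gradf_tangent[of p]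
  have "ric_form A D p y (gradf p) = (\<Sum>b\<in>Basis. g p (Riem A D p (e b) y (gradf p)) (e b))"
    unfolding ric_form_def by (rule trace_at_onb[OF e Riem_linear_left[OF y G] Riem_tangent[OF _ y G]])
  also have "\<dots> = (\<Sum>b\<in>Basis. g p (cov p (e b) S y) (e b)) - (\<Sum>b\<in>Basis. g p (cov p y S (e b)) (e b))"
    using eT y by (simp add: Riem_gradf tlinear_diff[OF g_linear_left] cov_endo_tangent[OF S_endo_at] sum_subtractf)
  also have "(\<Sum>b\<in>Basis. g p (cov p y S (e b)) (e b)) = trace_at A p (cov p y S)"
    by (rule trace_at_onb[OF e cov_endo_linear[OF S_endo_at y] cov_endo_tangent[OF S_endo_at y], symmetric])
  finally have "2 * ric_form A D p y (gradf p) = - trace_at A p (cov p y S)"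
    using contracted_Bianchi[OF e y] by simp
  also have "\<dots> = trace_at A p (\<lambda>v. (-1) *\<^sub>R cov p y S v)"
    using trace_at_scaleR[of p "-1" "cov p y S"] by simp
  also have "\<dots> = dir_deriv A p y sc"
    unfolding dir_deriv_scal[OF y] by (rule trace_at_cong) (simp add: cov_Ric[OF y])
  finally show ?thesis ..
qed

lemma grad_scal: "grad A g sc p = 2 *\<^sub>R Rc p (gradf p)"
  unfolding grad_def[of A g sc]
proof (rule sharp_eqI)
  note G = gradf_tangent[of p]
  show "2 *\<^sub>R Rc p (grad A g f p) \<in> T p"
    using endo_atD(5)[OF Ric_endo_at G] by simp
  \<comment> \<open>Symmetry of \<open>S\<close> moves the Ricci operator from \<open>u\<close>,
    where the previous lemma has it, to the gradient.\<close>
  show "g p (2 *\<^sub>R Rc p (gradf p)) u = dir_deriv A p u sc" if u: "u \<in> T p" for u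
    using u G S_symmetric[OF u G] g_sym[OF u G]
    by (simp add: dir_deriv_scal_ric ric_form_eq Ric_eq S_tangent tlinear_scaleR[OF g_linear_left] tlinear_diff[OF g_linear_left])
qed

lemma cov_S_gradf:
  assumes e: "e \<in> T p"
  shows "cov p (gradf p) S e + S p (S p e - lam *\<^sub>R e) =
    - Riem A D p e (gradf p) (gradf p) - (1/2) *\<^sub>R hess_op A g D sc p e"
proof -
  have S_gradf: "S q (gradf q) = lam *\<^sub>R gradf q - (1/2) *\<^sub>R grad A g sc q" for q
    using grad_scal[of q] Ric_eq[OF gradf_tangent, of q] by simp
  note sm = smooth_vf_at_cmult[OF gradf_smooth_at] smooth_vf_at_cmult[OF grad_smooth_at[OF scal_smooth_at]]
  \<comment> \<open>The formula for \<open>S\<close> on the gradient holds at every \<open>q\<close>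
    and may be differentiated along \<open>e\<close>. The correction in the covariant derivative is
    \<open>S\<close> of \<open>D_e gradf\<close>, which is where the square of \<open>S\<close>
    comes from.\<close>
  have "cov p e S (gradf p) = D p e (\<lambda>q. lam *\<^sub>R gradf q - (1/2) *\<^sub>R grad A g sc q) - S p (S p e)"
    unfolding cov_endo_field[OF S_endo_at e gradf_smooth_at] S_gradf by (simp add: hess_op_def)
  also have "\<dots> = lam *\<^sub>R S p e - (1/2) *\<^sub>R hess_op A g D sc p e - S p (S p e)"
    unfolding D_diff[OF e sm] D_cmult[OF e gradf_smooth_at] D_cmult[OF e grad_smooth_at[OF scal_smooth_at]]
    by (simp add: hess_op_def)
  finally show ?thesis
    using Riem_gradf[OF e gradf_tangent] e
    by (simp add: tlinear_diff[OF S_linear] tlinear_scaleR[OF S_linear] S_tangent)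
qed

lemma cov_Ric_gradf:
  assumes e: "e \<in> T p"
  shows "cov p (gradf p) Rc e + Rc p (lam *\<^sub>R e - Rc p e) =
    Riem A D p e (gradf p) (gradf p) + (1/2) *\<^sub>R hess_op A g D sc p e"
proof -
  \<comment> \<open>Since \<open>lam I - Ric\<close> is \<open>S\<close>, the product is
    \<open>(lam I - S) S\<close>, and \<open>S\<close> commutes with \<open>lam I\<close>.\<close>
  have "Rc p (lam *\<^sub>R e - Rc p e) = - S p (S p e - lam *\<^sub>R e)"
    using e by (simp add: Ric_eq S_tangent tlinear_diff[OF S_linear] tlinear_scaleR[OF S_linear])
  then show ?thesis
    using cov_S_gradf[OF e, folded eq_diff_eq] cov_Ric[OF gradf_tangent e] by simp
qed

text \<open>The curvature term has trace \<open>Ric(gradf, gradf)\<close>, which is half the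
  derivative of \<open>scal\<close> along the gradient. It cancels half of the trace of the left
  side, leaving exactly half of the drift term.\<close>

lemma drift_laplacian_scal:
  "(1/2) * drift_laplacian A g D f sc p = trace_at A p (\<lambda>e. Rc p (lam *\<^sub>R e - Rc p e))"
proof -
  note G = gradf_tangent[of p]
  have "trace_at A p (\<lambda>e. cov p (gradf p) Rc e + Rc p (lam *\<^sub>R e - Rc p e)) =
      trace_at A p (\<lambda>e. Riem A D p e (gradf p) (gradf p) + (1/2) *\<^sub>R hess_op A g D sc p e)"
    by (rule trace_at_cong) (rule cov_Ric_gradf)
  then have "dir_deriv A p (gradf p) sc + trace_at A p (\<lambda>e. Rc p (lam *\<^sub>R e - Rc p e)) =
      ric_form A D p (gradf p) (gradf p) + (1/2) * laplacian A g D sc p"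
    unfolding trace_at_add trace_at_scaleR by (simp add: dir_deriv_scal[OF G] ric_form_def laplacian_def)
  then show ?thesis
    using dir_deriv_scal_ric[OF G] by (simp add: drift_laplacian_def)
qed

end


theorem lemma2p3:
  fixes A :: "('m::{t2_space,second_countable_topology}, 'e::euclidean_space) chart set"
    and g :: "('m, 'e) metric" and D :: "('m, 'e) connection"
    and f :: "'m \<Rightarrow> real" and lam :: real
  assumes manifold: "smooth_atlas A"
    and metric: "riemannian_metric A g"
    and connection: "levi_civita A g D"
    and smooth: "smooth_fun A UNIV f"
    and soliton: "\<And>p v w. v \<in> tangent_space A p \<Longrightarrow> w \<in> tangent_space A p \<Longrightarrow>
          ric_form A D p v w + hess_form A g D f p v w = lam * g p v w"
  defines "S \<equiv> hess_op A g D f"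
  shows "(\<forall>p. grad A g (scal A g D) p = 2 *\<^sub>R Ric A g D p (grad A g f p)) \<and>
    (\<forall>p. \<forall>e\<in>tangent_space A p.
       cov_endo A D p (grad A g f p) S e + S p (S p e - lam *\<^sub>R e) =
         - Riem A D p e (grad A g f p) (grad A g f p)
         - (1/2) *\<^sub>R hess_op A g D (scal A g D) p e) \<and>
    (\<forall>p. \<forall>e\<in>tangent_space A p.
       cov_endo A D p (grad A g f p) (Ric A g D) e
         + Ric A g D p (lam *\<^sub>R e - Ric A g D p e) =
         Riem A D p e (grad A g f p) (grad A g f p)
         + (1/2) *\<^sub>R hess_op A g D (scal A g D) p e) \<and>
    (\<forall>p. (1/2) * (laplacian A g D (scal A g D) p - dir_deriv A p (grad A g f p) (scal A g D)) =
           (1/2) * drift_laplacian A g D f (scal A g D) p \<and>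
         (1/2) * drift_laplacian A g D f (scal A g D) p =
           trace_at A p (\<lambda>e. Ric A g D p (lam *\<^sub>R e - Ric A g D p e)))"
proof -
  interpret ricci_soliton A g D f lam
    using manifold metric connection smooth soliton by unfold_locales
  show ?thesis
    unfolding S_def using grad_scal cov_S_gradf cov_Ric_gradf drift_laplacian_scal
    by (auto simp: drift_laplacian_def)
qed

end
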